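(* Let $k,l,m$ be integers with $k\le l$, and let $P_{k,l,m}(a,b,c;x)$ and $\tilde P_{k,l,m}(a,b,c;x)$ be the polynomials in $x$ defined in the context. Then $$P_{k,l,m}(a,b,c;x)=\lambda\cdot\tilde P_{k,l,m}(a,b,c;x),$$ where, with $M=\max\{k+l-m,0\}$, $$\lambda=(-1)^{k+l-m-1+M}q^{\{k(k-1)+l(l-1)-m(m-1)+M(M-1)\}/2}\,\frac{(q-c)a^kb^l}{(b-a)c^m}\left(\frac{ab}{c}\right)^{M}\frac{(c)_m}{(a)_k(b)_l}.$$ Therefore the degree of $P_{k,l,m}$ in $x$ equals the degree of $\tilde P_{k,l,m}$ in $x$. Moreover, let $d=\max\{m,0\}+\max\{k+l-m,0\}-k-1$. Then the degree of $\tilde P_{k,l,m}$ is no more than $d$, and the coefficient of $x^d$ in $\tilde P_{k,l,m}$ is equal to $$\begin{cases}\left(\dfrac{c}{ab}\right)^kq^{k(m-k-l+1)}\left\{a^{m-2k}(a)_k(aq/c)_{k-m}-b^{m-2k}(b)_k(bq/c)_{k-m}\right\} & (k=l),\\[2ex]\left(\dfrac{c}{ab}\right)^kq^{k(m-k-l+1)}a^{m-k-l}\,\dfrac{(a)_k(aq/c)_{k-m}}{(aq/b)_{k-l}} & (k<l).\end{cases}$$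
   Context: Here $q$ is a complex number with $0<|q|<1$, and $a,b,c$ are nonzero complex parameters satisfying E1: $c,\ a/b\notin q^{\mathbb{Z}}$ and E2: $a,\ b,\ c/a,\ c/b\notin q^{\mathbb{Z}}$. Put $(u)_\infty=\prod_{n\ge 0}(1-uq^n)$ and $(u)_n=(u)_\infty/(uq^n)_\infty$ for $n\in\mathbb{Z}$; i.e. $(u)_n=\prod_{j=0}^{n-1}(1-uq^j)$ for $n\ge0$ and $(u)_{-n}=\prod_{j=1}^{n}(1-uq^{-j})^{-1}$ for $n>0$. Define $${}_4\phi_3(a_0,a_1,a_2,a_3;b_1,b_2,b_3;q,z)=\sum_{i\ge0}\frac{(a_0)_i(a_1)_i(a_2)_i(a_3)_i}{(q)_i(b_1)_i(b_2)_i(b_3)_i}z^i .$$ For integers $k\le l$ and $m$, the polynomial $P_{k,l,m}(a,b,c;x)$ is $$P_{k,l,m}(a,b,c;x)=\begin{cases}\sum_{n=0}^{l-1}(A_n-B_{n-m})x^n & (m\ge0,\ k+l-m\ge0),\\ \sum_{n=0}^{m-k-1}(\tilde A_n-\tilde B_{n-m})x^n & (m\ge0,\ k+l-m<0),\\ \sum_{n=0}^{l-m-1}(A_{n+m}-B_n)x^n & (m<0,\ k+l-m\ge0),\\ \sum_{n=0}^{-k-1}(\tilde A_{n+m}-\tilde B_n)x^n & (m<0,\ k+l-m<0),\end{cases}$$ where $A_n=B_n=\tilde A_n=\tilde B_n=0$ for $n<0$, and for $n\ge0$ $$A_n=\frac{-c\,(aq/c)_{k-m}(bq/c)_{l-m}}{(q^2/c)_{-m-1}}\,\frac{(c)_{m-n-1}}{(q^{-n})_n(a)_{k-n}(b)_{l-n}}\,q^{m-n-1}\;{}_4\phi_3\!\left(q^{-n},cq^{m-n-1},a,b;\,c,aq^{k-n},bq^{l-n};\,q,q\right),$$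 $$B_n=\frac{(aq/c)_n(bq/c)_n}{(q)_n(q^2/c)_n}\;{}_4\phi_3\!\left(q^{-n},cq^{-n-1},cq^{m-k}/a,cq^{m-l}/b;\,cq^m,cq^{-n}/a,cq^{-n}/b;\,q,q^{k+l-m+1}\right),$$ $$\tilde A_n=\frac{(c)_m}{(a)_k(b)_l}\,\frac{(aq/c)_{n+k-m}(bq/c)_{n+l-m}}{(q)_n(q^2/c)_{n-m}}\;{}_4\phi_3\!\left(q^{-n},cq^{m-n-1},c/a,c/b;\,c,cq^{m-k-n}/a,cq^{m-l-n}/b;\,q,q^{m-k-l+1}\right),$$ $$\tilde B_n=\frac{(aq^{-n})_n(bq^{-n})_n}{(q^{-n})_n(cq^{-n-1})_n}\,q^{-n}\;{}_4\phi_3\!\left(q^{-n},cq^{-n-1},aq^k,bq^l;\,cq^m,aq^{-n},bq^{-n};\,q,q\right).$$ The polynomial $\tilde P_{k,l,m}(a,b,c;x)$ is $$\tilde P_{k,l,m}(a,b,c;x)=\begin{cases}\sum_{n=0}^{l-1}(C_n-D_{n+k-l})x^{l-1-n} & (m\ge0,\ k+l-m\ge0),\\ \sum_{n=0}^{m-k-1}(\tilde C_n-\tilde D_{n+k-l})x^{m-k-1-n} & (m\ge0,\ k+l-m<0),\\ \sum_{n=0}^{l-m-1}(C_n-D_{n+k-l})x^{l-m-1-n} & (m<0,\ k+l-m\ge0),\\ \sum_{n=0}^{-k-1}(\tilde C_n-\tilde D_{n+k-l})x^{-k-1-n} & (m<0,\ k+l-m<0),\end{cases}$$ where $D_n=\tilde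 D_n=0$ for $n<0$, and for $n\ge0$ $$C_n=\mu_1\frac{(b)_n(bq/c)_n}{(q)_n(bq/a)_n}\left(\frac{cq}{ab}\right)^n{}_4\phi_3\!\left(q^{-n},aq^{-n}/b,q^{1-l}/b,cq^{m-l}/b;\,aq^{k-l+1}/b,q^{1-n}/b,cq^{-n}/b;\,q,q\right),$$ $$D_n=\mu_2\frac{(q^{1-k}/a)_n(cq^{m-k}/a)_n}{(q)_n(bq^{l-k+1}/a)_n}q^n\,{}_4\phi_3\!\left(q^{-n},aq^{k-l-n}/b,a,aq/c;\,aq/b,aq^{k-n},aq^{k-m-n+1}/c;\,q,q^{k+l-m+1}\right),$$ $$\tilde C_n=\mu_1\frac{(aq^k)_n(aq^{k-m+1}/c)_n}{(q)_n(aq^{k-l+1}/b)_n}\left(\frac{cq^{m-k-l+1}}{ab}\right)^n{}_4\phi_3\!\left(q^{-n},bq^{l-k-n}/a,q/a,c/a;\,bq/a,q^{1-k-n}/a,cq^{m-k-n}/a;\,q,q\right),$$ $$\tilde D_n=\mu_2\frac{(q/b)_n(c/b)_n}{(q)_n(aq/b)_n}q^n\,{}_4\phi_3\!\left(q^{-n},bq^{-n}/a,bq^l,bq^{l-m+1}/c;\,bq^{l-k+1}/a,bq^{-n},bq^{1-n}/c;\,q,q^{m-k-l+1}\right),$$ with $$\mu_1=a^{m-k-l}\left(\frac{c}{ab}\right)^kq^{k(m-k-l+1)}\frac{(a)_k(aq/c)_{k-m}}{(aq/b)_{k-l}},\qquad \mu_2=b^{m-k-l}\left(\frac{c}{ab}\right)^lq^{l(m-k-l+1)}\frac{(b)_l(bq/c)_{l-m}}{(bq/a)_{l-k}}.$$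 An empty sum is $0$. *)

theory Defs
  imports "HOL-Analysis.Analysis" "HOL-Computational_Algebra.Polynomial"
begin

definition qpoch_inf :: "complex \<Rightarrow> complex \<Rightarrow> complex" where
  "qpoch_inf q u = (\<Prod>n. 1 - u * q ^ n)"

text \<open>
  The shifted factorial \<open>(u)\<^sub>n\<close> for every integer \<open>n\<close>. The finite products are taken as the
  definition because the quotient \<open>(u)\<^sub>\<infinity> / (u q\<^sup>n)\<^sub>\<infinity>\<close> is \<open>0 / 0\<close> for arguments such as
  \<open>u = q\<^sup>-\<^sup>n\<close>, which occur below; \<open>qpoch_eq_quotient\<close> shows that the two agree otherwise.
\<close>

definition qpoch :: "complex \<Rightarrow> complex \<Rightarrow> int \<Rightarrow> complex" where
  "qpoch q u n =
     (if 0 \<le> n then (\<Prod>j<nat n. 1 - u * q ^ j)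
      else (\<Prod>j=1..nat (- n). inverse (1 - u * q powi (- int j))))"

lemma qpoch_inf_shift:
  assumes q: "norm q < 1"
  shows "qpoch_inf q u = (\<Prod>j<n. 1 - u * q ^ j) * qpoch_inf q (u * q ^ n)"
proof -
  have "summable (\<lambda>n. norm (- (u * q ^ n)))"
    using q by (simp add: norm_mult norm_power summable_geometric summable_mult)
  hence "abs_convergent_prod (\<lambda>n. 1 + - (u * q ^ n))"
    by (subst abs_convergent_prod_conv_summable) (simp add: norm_mult)
  hence conv: "convergent_prod (\<lambda>n. 1 - u * q ^ n)"
    using abs_convergent_prod_imp_convergent_prod by force
  have "(\<lambda>N. \<Prod>i\<le>N. 1 - u * q ^ i) \<longlonglongrightarrow> qpoch_inf q u"
    unfolding qpoch_inf_def by (rule convergent_prod_LIMSEQ[OF conv])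
  hence L1: "(\<lambda>N. \<Prod>i\<le>N + n. 1 - u * q ^ i) \<longlonglongrightarrow> qpoch_inf q u"
    by (rule LIMSEQ_ignore_initial_segment)
  have "convergent_prod (\<lambda>i. 1 - (u * q ^ n) * q ^ i)"
    using convergent_prod_ignore_initial_segment[OF conv, of n]
    by (simp add: power_add mult_ac)
  hence "(\<lambda>N. \<Prod>i\<le>N. 1 - (u * q ^ n) * q ^ i) \<longlonglongrightarrow> qpoch_inf q (u * q ^ n)"
    unfolding qpoch_inf_def by (rule convergent_prod_LIMSEQ)
  hence L2: "(\<lambda>N. (\<Prod>j<n. 1 - u * q ^ j) * (\<Prod>i\<le>N. 1 - (u * q ^ n) * q ^ i))
      \<longlonglongrightarrow> (\<Prod>j<n. 1 - u * q ^ j) * qpoch_inf q (u * q ^ n)"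
    by (rule tendsto_mult_left)
  have "(\<Prod>i\<le>N + n. 1 - u * q ^ i)
      = (\<Prod>j<n. 1 - u * q ^ j) * (\<Prod>i\<le>N. 1 - (u * q ^ n) * q ^ i)" for N
  proof (induction N)
    case 0
    show ?case by (simp add: lessThan_Suc_atMost[symmetric])
  next
    case (Suc N)
    then show ?case by (simp add: power_add mult_ac)
  qed
  with L1 L2 show ?thesis
    using LIMSEQ_unique by auto
qed

lemma qpoch_eq_quotient:
  assumes q: "0 < norm q" "norm q < 1"
    and nz: "qpoch_inf q (u * q powi n) \<noteq> 0"
  shows "qpoch q u n = qpoch_inf q u / qpoch_inf q (u * q powi n)"
proof (cases "0 \<le> n")
  case True
  hence "q powi n = q ^ nat n"
    by (simp add: power_int_def)
  with True nz show ?thesis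
    using qpoch_inf_shift[OF q(2), of u "nat n"] by (simp add: qpoch_def)
next
  case False
  define N where "N = nat (- n)"
  have n: "n = - int N" using False by (simp add: N_def)
  have q0: "q \<noteq> 0" using q by auto
  define v where "v = u * q powi n"
  have v: "v * q ^ N = u" using q0 by (simp add: v_def n power_int_minus)
  have "(\<Prod>j<N. 1 - v * q ^ j) = (\<Prod>j=1..N. 1 - u * q powi (- int j))"
  proof (rule prod.reindex_bij_witness[where i = "\<lambda>j. N - j" and j = "\<lambda>j. N - j"])
    fix j assume "j \<in> {..<N}"
    hence "j < N" by (simp only: lessThan_iff)
    hence "n + int j = - int (N - j)" unfolding n by linarith
    moreover have "q powi (n + int j) = q powi n * q powi int j"
      by (rule power_int_add) (use q0 in blast)
    ultimately have "q powi n * q ^ j = q powi (- int (N - j))"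
      by (simp only: power_int_of_nat)
    thus "1 - u * q powi (- int (N - j)) = 1 - v * q ^ j"
      by (simp only: v_def mult.assoc)
  qed auto
  moreover have "qpoch_inf q v = (\<Prod>j<N. 1 - v * q ^ j) * qpoch_inf q u"
    using qpoch_inf_shift[OF q(2), of v N] v by simp
  ultimately have "qpoch_inf q v = (\<Prod>j=1..N. 1 - u * q powi (- int j)) * qpoch_inf q u"
    by (simp only:)
  moreover have "qpoch q u n = inverse (\<Prod>j=1..N. 1 - u * q powi (- int j))"
    using False unfolding qpoch_def N_def by (simp add: prod_inversef[symmetric, unfolded o_def])
  moreover have "qpoch_inf q v \<noteq> 0"
    using nz by (simp only: v_def not_False_eq_True)
  ultimately show ?thesis
    unfolding v_def[symmetric] by (simp add: divide_simps)
qed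

definition phi43 :: "complex \<Rightarrow> complex \<Rightarrow> complex \<Rightarrow> complex \<Rightarrow> complex \<Rightarrow> complex \<Rightarrow> complex
    \<Rightarrow> complex \<Rightarrow> complex \<Rightarrow> complex" where
  "phi43 a0 a1 a2 a3 b1 b2 b3 q z =
     (\<Sum>i. (qpoch q a0 (int i) * qpoch q a1 (int i) * qpoch q a2 (int i) * qpoch q a3 (int i))
        / (qpoch q q (int i) * qpoch q b1 (int i) * qpoch q b2 (int i) * qpoch q b3 (int i))
        * z ^ i)"

definition qZ :: "complex \<Rightarrow> complex set" where
  "qZ q = range (\<lambda>n::int. q powi n)"

text \<open>The coefficient families carry an integer index, so that the shifted indices
  \<open>n - m\<close>, \<open>n + m\<close> and \<open>n + k - l\<close> may be negative.\<close>

definition A_coef :: "complex \<Rightarrow> int \<Rightarrow> int \<Rightarrow> int \<Rightarrow> complex \<Rightarrow> complex \<Rightarrow> complex \<Rightarrow> int \<Rightarrow> complex" where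
  "A_coef q k l m a b c n = (if n < 0 then 0 else
     (- c * qpoch q (a * q / c) (k - m) * qpoch q (b * q / c) (l - m))
       / qpoch q (q\<^sup>2 / c) (- m - 1)
     * (qpoch q c (m - n - 1)
       / (qpoch q (q powi (- n)) n * qpoch q a (k - n) * qpoch q b (l - n)))
     * q powi (m - n - 1)
     * phi43 (q powi (- n)) (c * q powi (m - n - 1)) a b
         c (a * q powi (k - n)) (b * q powi (l - n)) q q)"

definition B_coef :: "complex \<Rightarrow> int \<Rightarrow> int \<Rightarrow> int \<Rightarrow> complex \<Rightarrow> complex \<Rightarrow> complex \<Rightarrow> int \<Rightarrow> complex" where
  "B_coef q k l m a b c n = (if n < 0 then 0 else
     (qpoch q (a * q / c) n * qpoch q (b * q / c) n) / (qpoch q q n * qpoch q (q\<^sup>2 / c) n)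
     * phi43 (q powi (- n)) (c * q powi (- n - 1)) (c * q powi (m - k) / a) (c * q powi (m - l) / b)
         (c * q powi m) (c * q powi (- n) / a) (c * q powi (- n) / b) q (q powi (k + l - m + 1)))"

definition At_coef :: "complex \<Rightarrow> int \<Rightarrow> int \<Rightarrow> int \<Rightarrow> complex \<Rightarrow> complex \<Rightarrow> complex \<Rightarrow> int \<Rightarrow> complex" where
  "At_coef q k l m a b c n = (if n < 0 then 0 else
     qpoch q c m / (qpoch q a k * qpoch q b l)
     * ((qpoch q (a * q / c) (n + k - m) * qpoch q (b * q / c) (n + l - m))
       / (qpoch q q n * qpoch q (q\<^sup>2 / c) (n - m)))
     * phi43 (q powi (- n)) (c * q powi (m - n - 1)) (c / a) (c / b)
         c (c * q powi (m - k - n) / a) (c * q powi (m - l - n) / b) q (q powi (m - k - l + 1)))"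

definition Bt_coef :: "complex \<Rightarrow> int \<Rightarrow> int \<Rightarrow> int \<Rightarrow> complex \<Rightarrow> complex \<Rightarrow> complex \<Rightarrow> int \<Rightarrow> complex" where
  "Bt_coef q k l m a b c n = (if n < 0 then 0 else
     (qpoch q (a * q powi (- n)) n * qpoch q (b * q powi (- n)) n)
       / (qpoch q (q powi (- n)) n * qpoch q (c * q powi (- n - 1)) n)
     * q powi (- n)
     * phi43 (q powi (- n)) (c * q powi (- n - 1)) (a * q powi k) (b * q powi l)
         (c * q powi m) (a * q powi (- n)) (b * q powi (- n)) q q)"

definition P_poly :: "complex \<Rightarrow> int \<Rightarrow> int \<Rightarrow> int \<Rightarrow> complex \<Rightarrow> complex \<Rightarrow> complex \<Rightarrow> complex poly" where
  "P_poly q k l m a b c =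
    (if m \<ge> 0 \<and> k + l - m \<ge> 0 then
       (\<Sum>n=0..l - 1. monom (A_coef q k l m a b c n - B_coef q k l m a b c (n - m)) (nat n))
     else if m \<ge> 0 \<and> k + l - m < 0 then
       (\<Sum>n=0..m - k - 1. monom (At_coef q k l m a b c n - Bt_coef q k l m a b c (n - m)) (nat n))
     else if m < 0 \<and> k + l - m \<ge> 0 then
       (\<Sum>n=0..l - m - 1. monom (A_coef q k l m a b c (n + m) - B_coef q k l m a b c n) (nat n))
     else
       (\<Sum>n=0..- k - 1. monom (At_coef q k l m a b c (n + m) - Bt_coef q k l m a b c n) (nat n)))"

definition mu1 :: "complex \<Rightarrow> int \<Rightarrow> int \<Rightarrow> int \<Rightarrow> complex \<Rightarrow> complex \<Rightarrow> complex \<Rightarrow> complex" where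
  "mu1 q k l m a b c =
     a powi (m - k - l) * (c / (a * b)) powi k * q powi (k * (m - k - l + 1))
     * ((qpoch q a k * qpoch q (a * q / c) (k - m)) / qpoch q (a * q / b) (k - l))"

definition mu2 :: "complex \<Rightarrow> int \<Rightarrow> int \<Rightarrow> int \<Rightarrow> complex \<Rightarrow> complex \<Rightarrow> complex \<Rightarrow> complex" where
  "mu2 q k l m a b c =
     b powi (m - k - l) * (c / (a * b)) powi l * q powi (l * (m - k - l + 1))
     * ((qpoch q b l * qpoch q (b * q / c) (l - m)) / qpoch q (b * q / a) (l - k))"

definition C_coef :: "complex \<Rightarrow> int \<Rightarrow> int \<Rightarrow> int \<Rightarrow> complex \<Rightarrow> complex \<Rightarrow> complex \<Rightarrow> int \<Rightarrow> complex" where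
  "C_coef q k l m a b c n =
     mu1 q k l m a b c
     * ((qpoch q b n * qpoch q (b * q / c) n) / (qpoch q q n * qpoch q (b * q / a) n))
     * (c * q / (a * b)) powi n
     * phi43 (q powi (- n)) (a * q powi (- n) / b) (q powi (1 - l) / b) (c * q powi (m - l) / b)
         (a * q powi (k - l + 1) / b) (q powi (1 - n) / b) (c * q powi (- n) / b) q q"

definition D_coef :: "complex \<Rightarrow> int \<Rightarrow> int \<Rightarrow> int \<Rightarrow> complex \<Rightarrow> complex \<Rightarrow> complex \<Rightarrow> int \<Rightarrow> complex" where
  "D_coef q k l m a b c n = (if n < 0 then 0 else
     mu2 q k l m a b c
     * ((qpoch q (q powi (1 - k) / a) n * qpoch q (c * q powi (m - k) / a) n)
       / (qpoch q q n * qpoch q (b * q powi (l - k + 1) / a) n))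
     * q powi n
     * phi43 (q powi (- n)) (a * q powi (k - l - n) / b) a (a * q / c)
         (a * q / b) (a * q powi (k - n)) (a * q powi (k - m - n + 1) / c)
         q (q powi (k + l - m + 1)))"

definition Ct_coef :: "complex \<Rightarrow> int \<Rightarrow> int \<Rightarrow> int \<Rightarrow> complex \<Rightarrow> complex \<Rightarrow> complex \<Rightarrow> int \<Rightarrow> complex" where
  "Ct_coef q k l m a b c n =
     mu1 q k l m a b c
     * ((qpoch q (a * q powi k) n * qpoch q (a * q powi (k - m + 1) / c) n)
       / (qpoch q q n * qpoch q (a * q powi (k - l + 1) / b) n))
     * (c * q powi (m - k - l + 1) / (a * b)) powi n
     * phi43 (q powi (- n)) (b * q powi (l - k - n) / a) (q / a) (c / a)
         (b * q / a) (q powi (1 - k - n) / a) (c * q powi (m - k - n) / a) q q"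

definition Dt_coef :: "complex \<Rightarrow> int \<Rightarrow> int \<Rightarrow> int \<Rightarrow> complex \<Rightarrow> complex \<Rightarrow> complex \<Rightarrow> int \<Rightarrow> complex" where
  "Dt_coef q k l m a b c n = (if n < 0 then 0 else
     mu2 q k l m a b c
     * ((qpoch q (q / b) n * qpoch q (c / b) n) / (qpoch q q n * qpoch q (a * q / b) n))
     * q powi n
     * phi43 (q powi (- n)) (b * q powi (- n) / a) (b * q powi l) (b * q powi (l - m + 1) / c)
         (b * q powi (l - k + 1) / a) (b * q powi (- n)) (b * q powi (1 - n) / c)
         q (q powi (m - k - l + 1)))"

definition Pt_poly :: "complex \<Rightarrow> int \<Rightarrow> int \<Rightarrow> int \<Rightarrow> complex \<Rightarrow> complex \<Rightarrow> complex \<Rightarrow> complex poly" where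
  "Pt_poly q k l m a b c =
    (if m \<ge> 0 \<and> k + l - m \<ge> 0 then
       (\<Sum>n=0..l - 1. monom (C_coef q k l m a b c n - D_coef q k l m a b c (n + k - l)) (nat (l - 1 - n)))
     else if m \<ge> 0 \<and> k + l - m < 0 then
       (\<Sum>n=0..m - k - 1.
          monom (Ct_coef q k l m a b c n - Dt_coef q k l m a b c (n + k - l)) (nat (m - k - 1 - n)))
     else if m < 0 \<and> k + l - m \<ge> 0 then
       (\<Sum>n=0..l - m - 1.
          monom (C_coef q k l m a b c n - D_coef q k l m a b c (n + k - l)) (nat (l - m - 1 - n)))
     else
       (\<Sum>n=0..- k - 1.
          monom (Ct_coef q k l m a b c n - Dt_coef q k l m a b c (n + k - l)) (nat (- k - 1 - n))))"

text \<open>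
  The number \<open>d\<close> can be \<open>-1\<close> (for \<open>k = l = m = 0\<close>). So coefficients are indexed by
  integers here, vanishing at negative ones, and a degree bound is a bound for the library's
  \<open>degree\<close> unless the polynomial is zero, whose degree is minus infinity.
\<close>

definition int_coeff :: "complex poly \<Rightarrow> int \<Rightarrow> complex" where
  "int_coeff p i = (if 0 \<le> i then coeff p (nat i) else 0)"

definition degree_le :: "complex poly \<Rightarrow> int \<Rightarrow> bool" where
  "degree_le p i \<longleftrightarrow> p = 0 \<or> int (degree p) \<le> i"

end

theory Submission
  imports Defs "HOL-Computational_Algebra.Formal_Laurent_Series"
begin

text \<open>
  Both polynomials arise from one rational function, namely the coefficient of the shifted
  series in the three-term relation that expresses
  \<open>\<^sub>2\<phi>\<^sub>1(a q\<^sup>k, b q\<^sup>l; c q\<^sup>m; x)\<close> through two neighbours of \<open>\<^sub>2\<phi>\<^sub>1(a, b; c; x)\<close>: \<open>P\<close> comes from the expansion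
  at \<open>x = 0\<close> and \<open>P\<close> with a tilde from the one at \<open>x = \<infinity>\<close>. By Cramer's rule that coefficient is, up to
  a known product, the Casoratian of the solutions of parameters \<open>(k, l, m)\<close> with the solutions of
  parameters \<open>(0, 0, 0)\<close>. The proof below compares the formal Casoratians at the two points directly.
  
  The \<open>q\<close>-difference equation has two formal solutions in \<open>x\<close> and two in \<open>1/x\<close>. Normalised
  suitably, all four have coefficients given by a single formula in the exponent (\<open>sol\<close>), which
  contains a parameter \<open>z\<close> with the values \<open>1\<close>, \<open>q/c\<close>, \<open>1/a\<close>, \<open>1/b\<close>. Hence they all satisfy the same
  contiguous relations in \<open>(k, l, m)\<close>, and so do both Casoratians, after multiplication by the
  product of the factors \<open>1 - ab q\<^sup>i x/c\<close> for \<open>i < max (k + l - m) 0\<close> (\<open>casoratian_contiguous\<close>).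
  A family of sequences with these relations vanishes as soon as its members at
  \<open>(0, 0, 0)\<close> and \<open>(1, 0, 0)\<close> do (\<open>contiguous_zero\<close>). At \<open>(0, 0, 0)\<close> both Casoratians are \<open>0\<close>, and at
  \<open>(1, 0, 0)\<close> each is a monomial, because it satisfies a first-order \<open>q\<close>-difference equation
  (\<open>casoratian_const\<close>). So the two Casoratians, read as functions from the exponents of \<open>x\<close> to the
  complex numbers, agree up to the factor \<open>(q - c)/(b - a)\<close> and a shift of the exponent by one
  (\<open>main_identity\<close>). One of these functions vanishes far to the left and the other one far to the
  right; so both have finite support, which is where polynomials come from.
  
  It remains to read off coefficients. A Casoratian is a difference of products of two
  \<open>\<^sub>2\<phi>\<^sub>1\<close> series, and reversing one factor turns each coefficient of such a product into a terminating
  \<open>\<^sub>4\<phi>\<^sub>3\<close> (\<open>phi21_mult_nth\<close>). For \<open>k + l \<ge> m\<close> Euler's transformation first absorbs the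
  product above; this is why the cases \<open>k + l \<ge> m\<close> and \<open>k + l < m\<close> have different coefficients.
\<close>

unbundle no vec_syntax
unbundle fps_syntax

section \<open>Shifted factorials with an integer index\<close>

lemma qpoch_0 [simp]: "qpoch q u 0 = 1"
  by (simp add: qpoch_def)

lemma qpoch_int: "qpoch q u (int n) = (\<Prod>j<n. 1 - u * q ^ j)"
  by (simp add: qpoch_def)

text \<open>
  In each of the three forms below, the recurrence of the shifted factorial can fail only on one
  side of \<open>0\<close>. This matters for bases in \<open>q\<^sup>\<int>\<close>: the totalised values
  \<open>(1)\<^sub>t = 0\<close> for \<open>t > 0\<close> and \<open>1/(q)\<^sub>t = 0\<close> for \<open>t < 0\<close> are what cuts the formal series off.
\<close>
lemma qpoch_pred:
  assumes "t < 0"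
  shows "qpoch q u t = inverse (1 - u * q powi t) * qpoch q u (t + 1)"
proof -
  define N where "N = nat (- (t + 1))"
  have t: "t = - int (Suc N)" using assms by (simp add: N_def)
  have "nat (- t) = Suc N" "\<not> 0 \<le> t" unfolding t by simp_all
  hence "qpoch q u t = (\<Prod>j=1..Suc N. inverse (1 - u * q powi (- int j)))"
    unfolding qpoch_def by (simp only: if_False)
  also have "\<dots> = inverse (1 - u * q powi t) * (\<Prod>j=1..N. inverse (1 - u * q powi (- int j)))"
    unfolding t by (simp add: prod.cl_ivl_Suc del: of_nat_Suc)
  also have "(\<Prod>j=1..N. inverse (1 - u * q powi (- int j))) = qpoch q u (t + 1)"
    unfolding t by (cases "N = 0") (auto simp: qpoch_def)
  finally show ?thesis .
qed

lemma qpoch_succ: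
  assumes "0 \<le> t \<or> u * q powi t \<noteq> 1"
  shows "qpoch q u (t + 1) = (1 - u * q powi t) * qpoch q u t"
proof (cases "0 \<le> t")
  case True
  hence "nat (t + 1) = Suc (nat t)" by simp
  with True show ?thesis by (simp add: qpoch_def power_int_def)
next
  case False
  with assms have "1 - u * q powi t \<noteq> 0" by auto
  with False qpoch_pred[of t q u] show ?thesis by simp
qed

lemma inverse_qpoch_succ:
  assumes "t < 0 \<or> u * q powi t \<noteq> 1"
  shows "inverse (qpoch q u t) = (1 - u * q powi t) * inverse (qpoch q u (t + 1))"
proof (cases "t < 0")
  case True
  thus ?thesis by (simp add: qpoch_pred)
next
  case False
  with assms have "1 - u * q powi t \<noteq> 0" by auto
  with False qpoch_succ[of t u q] show ?thesis by simp
qed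

text \<open>
  All that the formal identities below require of \<open>q\<close>; it follows from \<open>0 < |q| < 1\<close>.
\<close>
locale nonroot_base =
  fixes q :: complex
  assumes q_nz [simp]: "q \<noteq> 0"
    and q_powi_ne_1: "n \<noteq> 0 \<Longrightarrow> q powi n \<noteq> 1"
begin

lemma q_powi_add: "q powi (i + j) = q powi i * q powi j"
  by (simp add: power_int_add)

lemma qZ_mult_iff [simp]: "u * q powi n \<in> qZ q \<longleftrightarrow> u \<in> qZ q"
proof
  assume "u * q powi n \<in> qZ q"
  then obtain i where "u * q powi n = q powi i" by (auto simp: qZ_def)
  hence "u = q powi (i - n)" by (simp add: power_int_diff field_simps)
  thus "u \<in> qZ q" by (auto simp: qZ_def)
next
  assume "u \<in> qZ q"
  then obtain i where "u = q powi i" by (auto simp: qZ_def)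
  hence "u * q powi n = q powi (i + n)" by (simp add: q_powi_add)
  thus "u * q powi n \<in> qZ q" by (auto simp: qZ_def)
qed

lemma qZ_mult_q_iff [simp]: "u * q \<in> qZ q \<longleftrightarrow> u \<in> qZ q"
  using qZ_mult_iff[of u 1] by simp

lemma qZ_inverse: "inverse u \<in> qZ q \<Longrightarrow> u \<in> qZ q"
proof -
  assume "inverse u \<in> qZ q"
  then obtain i where "inverse u = q powi i" by (auto simp: qZ_def)
  hence "u = q powi (- i)" by (metis inverse_inverse_eq power_int_minus)
  thus "u \<in> qZ q" by (auto simp: qZ_def)
qed

lemma qZ_mult_ne_1: "u \<notin> qZ q \<Longrightarrow> u * q powi n \<noteq> 1"
proof
  assume "u \<notin> qZ q" "u * q powi n = 1"
  moreover have "1 \<in> qZ q" unfolding qZ_def by (rule range_eqI[of _ _ 0]) simp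
  ultimately show False using qZ_mult_iff[of u n] by simp
qed

lemma qpoch_nonzero: "u \<notin> qZ q \<Longrightarrow> qpoch q u n \<noteq> 0"
  using qZ_mult_ne_1[of u] qZ_mult_ne_1[of u "int _"] qZ_mult_ne_1[of u "- int _"]
  by (auto simp: qpoch_def prod_zero_iff)

lemma qpoch_q_nonzero: "qpoch q q (int n) \<noteq> 0"
  using q_powi_ne_1[of "1 + int _"] by (auto simp: qpoch_int q_powi_add)

lemma qpoch_add:
  assumes u: "u \<notin> qZ q"
  shows "qpoch q u (r + s) = qpoch q u r * qpoch q (u * q powi r) s"
proof (induction s rule: int_induct[where k = 0])
  case base
  show ?case by simp
next
  case (step1 i)
  have "qpoch q u (r + (i + 1)) = (1 - u * q powi (r + i)) * qpoch q u (r + i)"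
    using qpoch_succ[of "r + i" u q] qZ_mult_ne_1[OF u] by (simp add: algebra_simps)
  moreover have "qpoch q (u * q powi r) (i + 1)
      = (1 - u * q powi (r + i)) * qpoch q (u * q powi r) i"
    using qpoch_succ[of i "u * q powi r" q] step1 by (simp add: q_powi_add mult_ac)
  ultimately show ?case using step1 by simp
next
  case (step2 i)
  have nz: "1 - u * q powi (r + (i - 1)) \<noteq> 0" using qZ_mult_ne_1[OF u] by auto
  have "qpoch q u (r + i) = (1 - u * q powi (r + (i - 1))) * qpoch q u (r + (i - 1))"
    using qpoch_succ[of "r + (i - 1)" u q] qZ_mult_ne_1[OF u] by (simp add: algebra_simps)
  moreover have "qpoch q (u * q powi r) i
      = (1 - u * q powi (r + (i - 1))) * qpoch q (u * q powi r) (i - 1)"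
    using qpoch_succ[of "i - 1" "u * q powi r" q] qZ_mult_ne_1[of "u * q powi r" "i - 1"] u
    by (simp add: power_int_add mult_ac)
  ultimately show ?case using step2 nz by simp
qed

definition triangular :: "int \<Rightarrow> int" where "triangular t = t * (t - 1) div 2"

lemma two_triangular: "2 * triangular t = t * (t - 1)"
  unfolding triangular_def by (rule dvd_mult_div_cancel) simp

lemma triangular_succ: "triangular (t + 1) = triangular t + t"
proof -
  have "2 * triangular (t + 1) = 2 * (triangular t + t)"
    unfolding distrib_left two_triangular by (simp add: algebra_simps)
  thus ?thesis by simp
qed

lemma triangular_0 [simp]: "triangular 0 = 0" by (simp add: triangular_def)

text \<open>
  Not only for \<open>v \<notin> q\<^sup>\<int>\<close>: the case \<open>v = 1\<close> is needed for the expansions at infinity.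
\<close>
lemma qpoch_neg:
  assumes "v \<noteq> 0" and ne: "\<And>i. i < 0 \<Longrightarrow> v * q powi i \<noteq> 1"
  shows "qpoch q v (- int n) * qpoch q (q / v) (int n) = (- q / v) ^ n * q powi triangular (int n)"
proof (induction n)
  case 0
  show ?case by simp
next
  case (Suc n)
  define w where "w = 1 - v * q powi (- int (Suc n))"
  have w: "w \<noteq> 0" using ne[of "- int (Suc n)"] by (auto simp: w_def)
  have "qpoch q v (- int (Suc n)) = inverse w * qpoch q v (- int n)"
    using qpoch_pred[of "- int (Suc n)" q v] by (simp add: w_def)
  moreover have "qpoch q (q / v) (int (Suc n)) = (- q / v * q ^ n * w) * qpoch q (q / v) (int n)"
  proof -
    have "1 - q / v * q powi int n = - q / v * q ^ n * w"
      using assms(1) by (simp add: w_def power_int_minus power_int_diff field_simps)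
    thus ?thesis using qpoch_succ[of "int n" "q / v" q] by (simp add: add.commute)
  qed
  ultimately have "qpoch q v (- int (Suc n)) * qpoch q (q / v) (int (Suc n))
      = (- q / v * q ^ n) * (qpoch q v (- int n) * qpoch q (q / v) (int n))"
    using w by simp
  also have "\<dots> = (- q / v) ^ Suc n * q powi triangular (int (Suc n))"
  proof -
    have "triangular (int (Suc n)) = int n + triangular (int n)"
      using triangular_succ[of "int n"] by (simp add: algebra_simps)
    thus ?thesis unfolding Suc by (simp add: q_powi_add mult_ac)
  qed
  finally show ?case .
qed

lemma qZ_q_div: "u \<notin> qZ q \<Longrightarrow> q / u \<notin> qZ q"
  using qZ_inverse[of u] qZ_mult_q_iff[of "inverse u"] by (auto simp: divide_inverse mult.commute)

lemma qpoch_reflect: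
  assumes u: "u \<notin> qZ q" and u0: "u \<noteq> 0"
  shows "qpoch q u t * qpoch q (q / u) (- t) = (- u) powi t * q powi triangular t"
proof (cases "0 \<le> t")
  case True
  then obtain n where t: "t = int n" using nonneg_int_cases by blast
  have "q / (q / u) = u" "- q / (q / u) = - u" by simp_all
  moreover have "qpoch q (q / u) (- int n) * qpoch q (q / (q / u)) (int n)
      = (- q / (q / u)) ^ n * q powi triangular (int n)"
    by (rule qpoch_neg) (use u0 qZ_mult_ne_1[OF qZ_q_div[OF u]] in auto)
  ultimately have "qpoch q (q / u) (- int n) * qpoch q u (int n) = (- u) ^ n * q powi triangular (int n)"
    by (simp only:)
  thus ?thesis unfolding t power_int_of_nat by (subst mult.commute)
next
  case False
  define n where "n = nat (- t)"
  have t: "t = - int n" using False by (simp add: n_def)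
  have "2 * triangular t = 2 * (int n + triangular (int n))"
    unfolding distrib_left two_triangular t by (simp add: algebra_simps)
  hence "triangular t = int n + triangular (int n)" by simp
  moreover have "(- q / u) ^ n = q ^ n * (- u) powi t"
  proof -
    have "- q / u = q * inverse (- u)" by (simp add: divide_inverse)
    thus ?thesis by (simp only: t power_mult_distrib power_int_minus power_int_of_nat power_inverse)
  qed
  moreover have "qpoch q u t * qpoch q (q / u) (- t) = (- q / u) ^ n * q powi triangular (int n)"
    unfolding t minus_minus by (rule qpoch_neg) (use u0 qZ_mult_ne_1[OF u] in auto)
  ultimately show ?thesis by (simp add: power_int_add mult_ac)
qed

lemma qpoch_neg_qZ:
  assumes "v \<noteq> 0" "v \<notin> qZ q"
  shows "qpoch q v (- int n) = (- q / v) ^ n * q powi triangular (int n) / qpoch q (q / v) (int n)"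
  using qpoch_neg[OF assms(1), of n] qZ_mult_ne_1[OF assms(2)]
    qpoch_nonzero[OF qZ_q_div[OF assms(2)], of "int n"]
  by (simp add: field_simps)

lemma qpoch_down_shifted:
  assumes "v \<noteq> 0" "v \<notin> qZ q"
  shows "qpoch q (v * q powi (- int n)) (int n)
    = qpoch q (q / v) (int n) / ((- q / v) ^ n * q powi triangular (int n))"
proof -
  have "1 = qpoch q v (- int n) * qpoch q (v * q powi (- int n)) (int n)"
    using qpoch_add[OF assms(2), of "- int n" "int n"] by simp
  thus ?thesis
    using assms qpoch_nonzero[OF qZ_q_div[OF assms(2)], of "int n"]
    unfolding qpoch_neg_qZ[OF assms] by (simp add: field_simps)
qed

lemma qpoch_Suc: "qpoch q u (int (Suc n)) = (1 - u * q ^ n) * qpoch q u (int n)"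
  by (simp add: qpoch_int del: of_nat_Suc)

text \<open>
  Counting the factors \<open>1 - X q\<^sup>j\<close> from the top, \<open>1 - X q\<^sup>j = - X q\<^sup>j (1 - q\<^sup>-\<^sup>j/X)\<close>. The product of
  the powers of \<open>q\<close> is kept as it stands: it does not depend on \<open>X\<close> and cancels
  between the factorials of one term.
\<close>
lemma qpoch_reverse:
  assumes "i \<le> n" "X \<noteq> 0"
  shows "qpoch q X (int n) * ((\<Prod>j<i. - (q powi (1 - int n + int j))) / X ^ i)
       = qpoch q X (int (n - i)) * qpoch q (q powi (1 - int n) / X) (int i)"
  using assms(1)
proof (induction i)
  case (Suc i)
  define d where "d = q powi (1 - int n + int i)"
  have d: "q ^ (n - Suc i) = 1 / d"
  proof -
    have "q ^ (n - Suc i) * d = q powi (int (n - Suc i) + (1 - int n + int i))"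
      unfolding d_def q_powi_add by simp
    also have "int (n - Suc i) + (1 - int n + int i) = 0" using Suc.prems by simp
    finally show ?thesis by (simp add: d_def field_simps)
  qed
  have "n - i = Suc (n - Suc i)" using Suc.prems by simp
  hence 1: "qpoch q X (int (n - i)) = (1 - X / d) * qpoch q X (int (n - Suc i))"
    using qpoch_Suc[of X "n - Suc i"] by (simp add: d)
  have 2: "qpoch q (q powi (1 - int n) / X) (int (Suc i))
      = (1 - d / X) * qpoch q (q powi (1 - int n) / X) (int i)"
    unfolding qpoch_Suc d_def q_powi_add by simp
  have d0: "d \<noteq> 0" by (simp add: d_def)
  have "qpoch q X (int n) * ((\<Prod>j<Suc i. - (q powi (1 - int n + int j))) / X ^ Suc i)
      = (- d / X) * (qpoch q X (int n) * ((\<Prod>j<i. - (q powi (1 - int n + int j))) / X ^ i))"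
    by (simp add: d_def)
  also have "\<dots> = (- d / X) * (1 - X / d) * (qpoch q X (int (n - Suc i))
      * qpoch q (q powi (1 - int n) / X) (int i))"
    unfolding Suc.IH[OF Suc_leD[OF Suc.prems]] 1 by (simp only: mult_ac)
  also have "(- d / X) * (1 - X / d) = 1 - d / X" using d0 assms(2) by (simp add: field_simps)
  finally show ?case unfolding 2 by (simp only: mult_ac)
qed simp

lemma qpoch_q_neg_eq_0: "n < i \<Longrightarrow> qpoch q (q powi (- int n)) (int i) = 0"
  by (auto simp: qpoch_int power_int_minus intro!: bexI[of _ n])

lemma qZ_reverse: "X \<notin> qZ q \<Longrightarrow> q powi i / X \<notin> qZ q"
  using qZ_q_div[of X] qZ_mult_iff[of "q / X" "i - 1"]
  by (simp add: power_int_diff)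

text \<open>
  The case \<open>v = 1\<close> of \<open>qpoch_down_shifted\<close>, where its hypothesis \<open>v \<notin> q\<^sup>\<int>\<close> fails.
\<close>
lemma qpoch_q_down:
  "qpoch q (q powi (- int n)) (int n) = qpoch q q (int n) / ((- q) ^ n * q powi triangular (int n))"
proof -
  have "qpoch q q (int n) * ((\<Prod>j<n. - (q powi (1 - int n + int j))) / q ^ n)
       = qpoch q (q powi (1 - int n) / q) (int n)"
    using qpoch_reverse[of n n q] by simp
  moreover have "q powi (1 - int n) / q = q powi (- int n)"
    by (simp add: power_int_diff power_int_minus field_simps)
  moreover have "(\<Prod>j<n. - (q powi (1 - int n + int j))) / q ^ n = 1 / ((- q) ^ n * q powi triangular (int n))"
  proof -
    have "(\<Prod>j<n. - (q powi (1 - int n + int j))) = (\<Prod>j<n. - (q powi (- int j)))"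
    proof (rule prod.reindex_bij_witness[of _ "\<lambda>j. n - 1 - j" "\<lambda>j. n - 1 - j"])
      fix j assume "j \<in> {..<n}"
      hence "1 - int n + int j = - int (n - 1 - j)" by auto
      thus "- (q powi (- int (n - 1 - j))) = - (q powi (1 - int n + int j))" by simp
    qed auto
    also have "\<dots> = (- 1) ^ n / q powi triangular (int n)"
    proof (induction n)
      case (Suc n)
      have "triangular (int (Suc n)) = triangular (int n) + int n" using triangular_succ[of "int n"] by (simp add: add.commute)
      thus ?case using Suc by (simp add: q_powi_add power_int_minus field_simps)
    qed simp
    finally have "(\<Prod>j<n. - (q powi (1 - int n + int j))) = (- 1) ^ n / q powi triangular (int n)" .
    moreover have "(- q) ^ n = (- 1) ^ n * q ^ n" by (rule power_minus)
    moreover have "(- 1) ^ n * (- 1) ^ n = (1::complex)" by (simp add: power_mult_distrib[symmetric])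
    ultimately show ?thesis by (simp add: field_simps)
  qed
  ultimately show ?thesis by simp
qed

end

section \<open>Formal hypergeometric series\<close>

definition dilate :: "complex \<Rightarrow> complex fps \<Rightarrow> complex fps" where
  "dilate p f = fps_compose f (fps_const p * fps_X)"

lemma dilate_nth [simp]: "dilate p f $ n = p ^ n * f $ n"
  by (simp add: dilate_def fps_compose_linear)

lemma dilate_mult: "dilate p (f * g) = dilate p f * dilate p g"
  unfolding dilate_def by (rule fps_compose_mult_distrib) simp

lemma dilate_X: "dilate p fps_X = fps_const p * fps_X"
  unfolding dilate_def by (rule fps_X_fps_compose_startby0) simp

lemma dilate_diff: "dilate p (f - g) = dilate p f - dilate p g"
  and dilate_const: "dilate p (fps_const r) = fps_const r"
  and dilate_1: "dilate p 1 = 1"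
  by (simp_all add: dilate_def fps_compose_sub_distrib)

lemmas dilate_simps = dilate_mult dilate_X dilate_diff dilate_const dilate_1

lemma dilate_invariant_imp_const:
  assumes "dilate p f = f" and "\<And>n. n > 0 \<Longrightarrow> p ^ n \<noteq> 1"
  shows "f = fps_const (f $ 0)"
proof (rule fps_ext)
  fix n
  have "p ^ n * f $ n = f $ n" using assms(1) by (metis dilate_nth)
  thus "f $ n = fps_const (f $ 0) $ n" using assms(2)[of n] by (cases "n = 0") auto
qed

text \<open>
  The \<open>q\<close>-analogue of Abel's formula for the Wronskian. The series \<open>\<phi>\<^sub>i\<close> stand for solutions
  with a prefactor \<open>x\<^sup>s\<close> which the dilation multiplies by \<open>z\<^sub>i\<close>. Eliminating the middle
  term between the two second-order equations leaves a first-order equation for the Casoratian,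
  with the same coefficients as the one for the common factor \<open>E\<close> up to a dilation of \<open>1 - h x\<close>;
  dividing by \<open>E\<close> gives a series invariant under dilation.
\<close>
lemma casoratian_const:
  fixes \<phi>1 \<phi>2 \<psi>1 \<psi>2 E :: "complex fps"
  assumes \<phi>: "\<phi>1 = E * \<psi>1" "\<phi>2 = E * \<psi>2"
    and one: "E $ 0 = 1" "\<psi>1 $ 0 = 1" "\<psi>2 $ 0 = 1"
    and E: "(1 - fps_const h * fps_X) * dilate p E = (1 - fps_X) * E"
    and eq1: "\<phi>1 - fps_const (e1 * z1) * dilate p \<phi>1 + fps_const (e2 * z1\<^sup>2) * dilate p (dilate p \<phi>1)
        = fps_X * (\<phi>1 - fps_const (f1 * z1) * dilate p \<phi>1 + fps_const (f2 * z1\<^sup>2) * dilate p (dilate p \<phi>1))"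
    and eq2: "\<phi>2 - fps_const (e1 * z2) * dilate p \<phi>2 + fps_const (e2 * z2\<^sup>2) * dilate p (dilate p \<phi>2)
        = fps_X * (\<phi>2 - fps_const (f1 * z2) * dilate p \<phi>2 + fps_const (f2 * z2\<^sup>2) * dilate p (dilate p \<phi>2))"
    and z: "e2 * z1 * z2 = 1" and f2: "f2 = e2 * h * p"
    and p: "\<And>n. n > 0 \<Longrightarrow> p ^ n \<noteq> 1"
  shows "(1 - fps_const h * fps_X) * (fps_const z1 * dilate p \<phi>1 * \<psi>2 - fps_const z2 * dilate p \<phi>2 * \<psi>1)
       = fps_const (z1 - z2)"
proof -
  define c1 c2 c3 c4 k1 k2 kh kp where
    "c1 = fps_const e1" "c2 = fps_const e2" "c3 = fps_const f1" "c4 = fps_const f2"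
    "k1 = fps_const z1" "k2 = fps_const z2" "kh = fps_const h" "kp = fps_const p"
  note c = this
  define s1 s2 t1 t2 where "s1 = dilate p \<phi>1" "s2 = dilate p \<phi>2" "t1 = dilate p s1" "t2 = dilate p s2"
  note s = this
  define V where "V = k1 * s1 * \<psi>2 - k2 * s2 * \<psi>1"
  define W where "W = k1 * s1 * \<phi>2 - k2 * s2 * \<phi>1"
  have W: "W = E * V" unfolding W_def V_def \<phi> by (simp add: algebra_simps)
  have dW: "dilate p W = k1 * t1 * s2 - k2 * t2 * s1"
    unfolding W_def s c by (simp add: dilate_simps)
  have a1: "\<phi>1 - c1 * k1 * s1 + c2 * k1\<^sup>2 * t1 = fps_X * (\<phi>1 - c3 * k1 * s1 + c4 * k1\<^sup>2 * t1)"
    using eq1 unfolding s c by (simp add: fps_const_mult[symmetric] power2_eq_square del: fps_const_mult)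
  have a2: "\<phi>2 - c1 * k2 * s2 + c2 * k2\<^sup>2 * t2 = fps_X * (\<phi>2 - c3 * k2 * s2 + c4 * k2\<^sup>2 * t2)"
    using eq2 unfolding s c by (simp add: fps_const_mult[symmetric] power2_eq_square del: fps_const_mult)
  have z': "c2 * k1 * k2 = 1" using z unfolding c by simp
  have f2': "c4 = c2 * kh * kp" using f2 unfolding c by simp
  \<comment> \<open>Eliminate the terms with coefficient \<open>c1 - c3 x\<close> between the two equations.\<close>
  have "(c2 - c4 * fps_X) * k1 * k2 * dilate p W = (1 - fps_X) * W"
  proof -
    have b1: "(c2 - c4 * fps_X) * (k1\<^sup>2 * t1) = (c1 - c3 * fps_X) * k1 * s1 - (1 - fps_X) * \<phi>1"
      using a1 by (simp add: algebra_simps)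
    have b2: "(c2 - c4 * fps_X) * (k2\<^sup>2 * t2) = (c1 - c3 * fps_X) * k2 * s2 - (1 - fps_X) * \<phi>2"
      using a2 by (simp add: algebra_simps)
    have "(c2 - c4 * fps_X) * k1 * k2 * dilate p W
        = k2 * s2 * ((c2 - c4 * fps_X) * (k1\<^sup>2 * t1)) - k1 * s1 * ((c2 - c4 * fps_X) * (k2\<^sup>2 * t2))"
      unfolding dW by (simp add: algebra_simps power2_eq_square)
    also have "\<dots> = (1 - fps_X) * W"
      unfolding b1 b2 W_def by (simp add: algebra_simps)
    finally show ?thesis .
  qed
  hence 1: "(1 - kh * kp * fps_X) * dilate p W = (1 - fps_X) * W"
  proof -
    have "(c2 - c4 * fps_X) * k1 * k2 = (c2 * k1 * k2) * (1 - kh * kp * fps_X)"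
      unfolding f2' by (simp add: algebra_simps)
    thus ?thesis using \<open>(c2 - c4 * fps_X) * k1 * k2 * dilate p W = _\<close> z' by simp
  qed
  \<comment> \<open>Divide the equation of \<open>W = E V\<close> by the one of \<open>E\<close>.\<close>
  have "dilate p E * ((1 - kh * kp * fps_X) * dilate p V) = dilate p E * ((1 - kh * fps_X) * V)"
  proof -
    have "dilate p E * ((1 - kh * kp * fps_X) * dilate p V) = ((1 - fps_X) * E) * V"
      using 1 unfolding W dilate_mult by (simp only: mult_ac)
    thus ?thesis unfolding E[folded c, symmetric] by (simp only: mult_ac)
  qed
  moreover have "dilate p E \<noteq> 0"
    using one by (metis dilate_nth fps_zero_nth mult_1 power_0 zero_neq_one)
  ultimately have 2: "(1 - kh * kp * fps_X) * dilate p V = (1 - kh * fps_X) * V"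
    by simp
  have "dilate p ((1 - kh * fps_X) * V) = (1 - kh * fps_X) * V"
    using 2 unfolding c by (simp add: dilate_simps mult_ac)
  hence "(1 - kh * fps_X) * V = fps_const (((1 - kh * fps_X) * V) $ 0)"
    by (rule dilate_invariant_imp_const) (rule p)
  also have "((1 - kh * fps_X) * V) $ 0 = z1 - z2"
    using one by (simp add: V_def s c \<phi>)
  finally show ?thesis unfolding V_def s c .
qed

context nonroot_base
begin

text \<open>
  The power series \<open>\<^sub>2\<phi>\<^sub>1(\<alpha>, \<beta>; \<gamma>; q, w x)\<close>.
\<close>
definition phi21 :: "complex \<Rightarrow> complex \<Rightarrow> complex \<Rightarrow> complex \<Rightarrow> complex fps" where
  "phi21 \<alpha> \<beta> \<gamma> w = Abs_fps (\<lambda>n. qpoch q \<alpha> (int n) * qpoch q \<beta> (int n)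
     / (qpoch q q (int n) * qpoch q \<gamma> (int n)) * w ^ n)"

text \<open>
  By the \<open>q\<close>-binomial theorem this is \<open>(u w x)\<^sub>\<infinity> / (w x)\<^sub>\<infinity>\<close>. It is used
  through its functional equation \<open>binom_series_dilate\<close>.
\<close>
definition binom_series :: "complex \<Rightarrow> complex \<Rightarrow> complex fps" where
  "binom_series u w = Abs_fps (\<lambda>n. qpoch q u (int n) / qpoch q q (int n) * w ^ n)"

lemma q_pow_ne_1: "n > 0 \<Longrightarrow> q ^ n \<noteq> 1"
  using q_powi_ne_1[of "int n"] by simp

lemma phi21_0 [simp]: "phi21 \<alpha> \<beta> \<gamma> w $ 0 = 1"
  and binom_series_0 [simp]: "binom_series u w $ 0 = 1"
  by (simp_all add: phi21_def binom_series_def)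

lemma binom_series_Suc:
  "(1 - q ^ Suc n) * binom_series u w $ Suc n = w * (1 - u * q ^ n) * binom_series u w $ n"
  using qpoch_q_nonzero[of n] q_pow_ne_1[of "Suc n"]
  unfolding binom_series_def fps_nth_Abs_fps qpoch_Suc by (simp add: field_simps)

lemma phi21_Suc:
  assumes "\<gamma> * q ^ n \<noteq> 1"
  shows "(1 - q ^ Suc n) * (1 - \<gamma> * q ^ n) * phi21 \<alpha> \<beta> \<gamma> w $ Suc n
       = w * (1 - \<alpha> * q ^ n) * (1 - \<beta> * q ^ n) * phi21 \<alpha> \<beta> \<gamma> w $ n"
  using qpoch_q_nonzero[of n] q_pow_ne_1[of "Suc n"] assms
  unfolding phi21_def fps_nth_Abs_fps qpoch_Suc by (simp add: divide_simps)

lemma binom_series_dilate: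
  "(1 - fps_const w * fps_X) * binom_series u w = (1 - fps_const (u * w) * fps_X) * dilate q (binom_series u w)"
proof (rule fps_ext)
  fix n
  show "((1 - fps_const w * fps_X) * binom_series u w) $ n
      = ((1 - fps_const (u * w) * fps_X) * dilate q (binom_series u w)) $ n"
    using binom_series_Suc[of "n - 1" u w]
    by (cases n) (auto simp: left_diff_distrib mult.assoc algebra_simps)
qed

text \<open>
  The second-order \<open>q\<close>-difference equation is the recurrence of the coefficients, since dilation
  multiplies the \<open>n\<close>-th coefficient by \<open>q\<^sup>n\<close>.
\<close>
lemma hypergeometric_rec_iff:
  fixes f :: "complex fps"
  shows "(\<forall>n. (1 - q ^ Suc n) * (1 - \<gamma> * q ^ n) * f $ Suc n = w * (1 - \<alpha> * q ^ n) * (1 - \<beta> * q ^ n) * f $ n)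
    \<longleftrightarrow> f - fps_const (1 + \<gamma> / q) * dilate q f + fps_const (\<gamma> / q) * dilate q (dilate q f)
      = fps_const w * fps_X * (f - fps_const (\<alpha> + \<beta>) * dilate q f + fps_const (\<alpha> * \<beta>) * dilate q (dilate q f))"
    (is "?L \<longleftrightarrow> ?l = ?r")
proof -
  have "?l $ 0 = ?r $ 0" by (simp add: algebra_simps)
  moreover have "?l $ Suc n = (1 - q ^ Suc n) * (1 - \<gamma> * q ^ n) * f $ Suc n" for n
    by (simp add: field_simps)
  moreover have "?r $ Suc n = w * (1 - \<alpha> * q ^ n) * (1 - \<beta> * q ^ n) * f $ n" for n
    by (simp add: mult.assoc) (simp add: algebra_simps)
  ultimately show ?thesis unfolding fps_eq_iff by (metis not0_implies_Suc)
qed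

lemma phi21_unique:
  assumes \<gamma>: "\<And>n. \<gamma> * q ^ n \<noteq> 1" and "f $ 0 = 1"
    and "\<And>n. (1 - q ^ Suc n) * (1 - \<gamma> * q ^ n) * f $ Suc n = w * (1 - \<alpha> * q ^ n) * (1 - \<beta> * q ^ n) * f $ n"
  shows "f = phi21 \<alpha> \<beta> \<gamma> w"
proof (rule fps_ext)
  fix n
  show "f $ n = phi21 \<alpha> \<beta> \<gamma> w $ n"
  proof (induction n)
    case (Suc n)
    have "(1 - q ^ Suc n) * (1 - \<gamma> * q ^ n) * f $ Suc n
        = (1 - q ^ Suc n) * (1 - \<gamma> * q ^ n) * phi21 \<alpha> \<beta> \<gamma> w $ Suc n"
      unfolding assms(3) phi21_Suc[OF \<gamma>] Suc ..
    moreover have "(1 - q ^ Suc n) * (1 - \<gamma> * q ^ n) \<noteq> 0"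
      using q_pow_ne_1[of "Suc n"] \<gamma>[of n] by auto
    ultimately show ?case by (simp only: mult_cancel_left) blast
  qed (use assms in simp)
qed

text \<open>
  The right-hand side satisfies the \<open>q\<close>-difference equation of the left-hand side, because the equation
  of the second factor becomes that one on multiplication by the first factor. The recurrence determines
  a solution from its constant term.
\<close>
lemma euler_transformation:
  assumes [simp]: "\<alpha> \<noteq> 0" "\<beta> \<noteq> 0" "\<gamma> \<noteq> 0" and \<gamma>: "\<And>n. \<gamma> * q ^ n \<noteq> 1"
    and u: "u = \<alpha> * \<beta> / \<gamma>"
  shows "phi21 \<alpha> \<beta> \<gamma> w = binom_series u w * phi21 (\<gamma> / \<alpha>) (\<gamma> / \<beta>) \<gamma> (u * w)"
proof -
  define E where "E = binom_series u w"
  define \<psi> where "\<psi> = phi21 (\<gamma> / \<alpha>) (\<gamma> / \<beta>) \<gamma> (u * w)"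
  have "\<psi> - fps_const (1 + \<gamma> / q) * dilate q \<psi> + fps_const (\<gamma> / q) * dilate q (dilate q \<psi>)
      = fps_const (u * w) * fps_X * (\<psi> - fps_const (\<gamma> / \<alpha> + \<gamma> / \<beta>) * dilate q \<psi>
          + fps_const (\<gamma> / \<alpha> * (\<gamma> / \<beta>)) * dilate q (dilate q \<psi>))"
    unfolding \<psi>_def by (rule hypergeometric_rec_iff[THEN iffD1]) (use phi21_Suc[OF \<gamma>] in blast)
  moreover have "fps_const (u * w) * fps_const (\<gamma> / \<alpha> + \<gamma> / \<beta>) = fps_const w * fps_const (\<alpha> + \<beta>)"
    "fps_const (u * w) * fps_const (\<gamma> / \<alpha> * (\<gamma> / \<beta>)) = fps_const (\<gamma> / q) * fps_const (w * q)"
    by (simp_all add: u field_simps)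
  ultimately have \<psi>: "(1 - fps_const (u * w) * fps_X) * \<psi>
      - (fps_const (1 + \<gamma> / q) - fps_const w * fps_X * fps_const (\<alpha> + \<beta>)) * dilate q \<psi>
      + fps_const (\<gamma> / q) * (1 - fps_const (w * q) * fps_X) * dilate q (dilate q \<psi>) = 0"
    by algebra
  have E: "(1 - fps_const w * fps_X) * E = (1 - fps_const (u * w) * fps_X) * dilate q E"
    unfolding E_def by (rule binom_series_dilate)
  have "dilate q ((1 - fps_const w * fps_X) * E) = dilate q ((1 - fps_const (u * w) * fps_X) * dilate q E)"
    by (simp only: E)
  hence E': "(1 - fps_const (w * q) * fps_X) * dilate q E
      = (1 - fps_const (u * w * q) * fps_X) * dilate q (dilate q E)"
    by (simp add: dilate_simps mult.assoc[symmetric])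
  have c: "fps_const w * fps_const (\<alpha> * \<beta>) = fps_const (\<gamma> / q) * fps_const (u * w * q)"
    by (simp add: u)
  have "E * \<psi> - fps_const (1 + \<gamma> / q) * dilate q (E * \<psi>) + fps_const (\<gamma> / q) * dilate q (dilate q (E * \<psi>))
      = fps_const w * fps_X * (E * \<psi> - fps_const (\<alpha> + \<beta>) * dilate q (E * \<psi>)
          + fps_const (\<alpha> * \<beta>) * dilate q (dilate q (E * \<psi>)))"
    unfolding dilate_mult using \<psi> E E' c by algebra
  hence "(1 - q ^ Suc n) * (1 - \<gamma> * q ^ n) * (E * \<psi>) $ Suc n
      = w * (1 - \<alpha> * q ^ n) * (1 - \<beta> * q ^ n) * (E * \<psi>) $ n" for n
    using hypergeometric_rec_iff[of \<gamma> "E * \<psi>" w \<alpha> \<beta>] by blast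
  thus ?thesis
    unfolding E_def[symmetric] \<psi>_def[symmetric]
    by (intro phi21_unique[symmetric] \<gamma>) (simp_all add: E_def \<psi>_def)
qed

lemma binom_series_shift_u:
  "binom_series u w = (1 - fps_const (u * w) * fps_X) * binom_series (u * q) w"
proof (rule fps_ext)
  fix n
  show "binom_series u w $ n = ((1 - fps_const (u * w) * fps_X) * binom_series (u * q) w) $ n"
  proof (cases n)
    case (Suc m)
    have 1: "qpoch q u (int (Suc m)) = (1 - u) * qpoch q (u * q) (int m)"
      unfolding qpoch_int prod.lessThan_Suc_shift by (simp add: mult_ac)
    have 2: "qpoch q (u * q) (int (Suc m)) = (1 - u * q * q ^ m) * qpoch q (u * q) (int m)"
      "qpoch q q (int (Suc m)) = (1 - q * q ^ m) * qpoch q q (int m)"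
      by (rule qpoch_Suc)+
    have 3: "1 - q * q ^ m \<noteq> 0" using q_pow_ne_1[of "Suc m"] by simp
    show ?thesis
      unfolding Suc left_diff_distrib binom_series_def mult.assoc fps_sub_nth mult_1_left
        fps_mult_left_const_nth fps_X_mult_nth fps_nth_Abs_fps 1 2
      using qpoch_q_nonzero[of m] 3 by (simp add: divide_simps) (simp add: algebra_simps)?
  qed simp
qed

text \<open>
  Here \<open>v = u w\<close> is fixed, so that replacing \<open>u\<close> by \<open>u q\<close> changes the denominator \<open>(w x)\<^sub>\<infinity>\<close> instead of
  the numerator.
\<close>
lemma binom_series_shift_u_w:
  assumes [simp]: "u \<noteq> 0"
  shows "binom_series u (v / u) = (1 - fps_const (v / (u * q)) * fps_X) * binom_series (u * q) (v / (u * q))"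
proof (rule fps_ext)
  fix n
  show "binom_series u (v / u) $ n
      = ((1 - fps_const (v / (u * q)) * fps_X) * binom_series (u * q) (v / (u * q))) $ n"
  proof (cases n)
    case (Suc m)
    have 1: "qpoch q u (int (Suc m)) = (1 - u) * qpoch q (u * q) (int m)"
      unfolding qpoch_int prod.lessThan_Suc_shift by (simp add: mult_ac)
    have 2: "qpoch q (u * q) (int (Suc m)) = (1 - u * q * q ^ m) * qpoch q (u * q) (int m)"
      "qpoch q q (int (Suc m)) = (1 - q * q ^ m) * qpoch q q (int m)"
      by (rule qpoch_Suc)+
    have 3: "1 - q * q ^ m \<noteq> 0" using q_pow_ne_1[of "Suc m"] by simp
    show ?thesis
      unfolding Suc left_diff_distrib binom_series_def mult.assoc fps_sub_nth mult_1_left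
        fps_mult_left_const_nth fps_X_mult_nth fps_nth_Abs_fps 1 2
      using qpoch_q_nonzero[of m] 3 by (simp add: divide_simps) (simp add: algebra_simps)?
  qed simp
qed

text \<open>
  The powers of \<open>q\<close> from four reversed factorials (represented by \<open>r\<close>) cancel, two against two.
\<close>
lemma reverse_arith:
  fixes r :: complex
  assumes "r \<noteq> 0" "A \<noteq> 0" "B \<noteq> 0" "C \<noteq> 0" "W \<noteq> 0" "Qn \<noteq> 0" "Cn \<noteq> 0"
    "A' \<noteq> 0" "B' \<noteq> 0" "C' \<noteq> 0" "Q' \<noteq> 0"
  shows "al * be / (Qi * g) * w ^ i * (An * (r / A ^ i) / A' * (Bn * (r / B ^ i) / B')
      / (Qn * (r / q ^ i) / Q' * (Cn * (r / C ^ i) / C')) * (W ^ n / W ^ i))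
    = An * Bn / (Qn * Cn) * W ^ n
      * ((Q' * C' * al * be) / (Qi * g * A' * B') * (w / W * (q * C / (A * B))) ^ i)"
proof -
  have "An * (r / A ^ i) / A' * (Bn * (r / B ^ i) / B')
      / (Qn * (r / q ^ i) / Q' * (Cn * (r / C ^ i) / C')) * (W ^ n / W ^ i)
      = An * Bn / (Qn * Cn) * W ^ n * (Q' * C' / (A' * B')) * (1 / W * (q * C / (A * B))) ^ i"
    using assms by (simp add: power_mult_distrib power_divide divide_simps)
  hence "al * be / (Qi * g) * w ^ i * (An * (r / A ^ i) / A' * (Bn * (r / B ^ i) / B')
      / (Qn * (r / q ^ i) / Q' * (Cn * (r / C ^ i) / C')) * (W ^ n / W ^ i))
      = al * be / (Qi * g) * w ^ i * (An * Bn / (Qn * Cn) * W ^ n * (Q' * C' / (A' * B')) * (1 / W * (q * C / (A * B))) ^ i)"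
    by (simp only:)
  also have "\<dots> = An * Bn / (Qn * Cn) * W ^ n
      * ((Q' * C' * al * be) / (Qi * g * A' * B') * (w ^ i * (1 / W * (q * C / (A * B))) ^ i))"
    by (simp add: divide_inverse power_mult_distrib mult_ac)
  also have "w ^ i * (1 / W * (q * C / (A * B))) ^ i = (w / W * (q * C / (A * B))) ^ i"
    by (simp add: power_mult_distrib power_divide)
  finally show ?thesis .
qed

text \<open>
  In the \<open>i\<close>-th term of the convolution, the factorials of index \<open>n - i\<close> are those of index \<open>n\<close>
  divided by reversed ones of index \<open>i\<close>; the factor \<open>(q\<^sup>-\<^sup>n)\<^sub>i\<close> from \<open>(q)\<^sub>n\<^sub>-\<^sub>i\<close> ends the series at \<open>i = n\<close>.
\<close>
lemma phi21_mult_nth: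
  assumes nz: "A \<noteq> 0" "B \<noteq> 0" "C \<noteq> 0" "W \<noteq> 0"
    and qZ: "A \<notin> qZ q" "B \<notin> qZ q" "C \<notin> qZ q"
  shows "(phi21 A B C W * phi21 \<alpha> \<beta> \<gamma> w) $ n = phi21 A B C W $ n
     * phi43 (q powi (- int n)) (q powi (1 - int n) / C) \<alpha> \<beta>
         \<gamma> (q powi (1 - int n) / A) (q powi (1 - int n) / B) q (w / W * (q * C / (A * B)))"
proof -
  define T where "T i = (qpoch q (q powi (- int n)) (int i) * qpoch q (q powi (1 - int n) / C) (int i)
      * qpoch q \<alpha> (int i) * qpoch q \<beta> (int i))
      / (qpoch q q (int i) * qpoch q \<gamma> (int i) * qpoch q (q powi (1 - int n) / A) (int i)
         * qpoch q (q powi (1 - int n) / B) (int i)) * (w / W * (q * C / (A * B))) ^ i" for i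
  have "(\<Sum>i. T i) = (\<Sum>i=0..n. T i)"
    by (rule suminf_finite) (auto simp: T_def qpoch_q_neg_eq_0)
  moreover have "phi21 \<alpha> \<beta> \<gamma> w $ i * phi21 A B C W $ (n - i) = phi21 A B C W $ n * T i" if "i \<le> n" for i
  proof -
    define r where "r = (\<Prod>j<i. - (q powi (1 - int n + int j)))"
    have r: "r \<noteq> 0" by (simp add: r_def)
    have rev: "qpoch q X (int n) * (r / X ^ i)
       = qpoch q X (int (n - i)) * qpoch q (q powi (1 - int n) / X) (int i)" if "X \<noteq> 0" for X
      unfolding r_def by (rule qpoch_reverse) (use \<open>i \<le> n\<close> that in auto)
    have rev': "qpoch q X (int (n - i)) = qpoch q X (int n) * (r / X ^ i) / qpoch q (q powi (1 - int n) / X) (int i)"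
      if "X \<noteq> 0" "X \<notin> qZ q" for X
      using rev[OF that(1)] qpoch_nonzero[OF qZ_reverse[OF that(2)]] by (simp add: field_simps)
    have "q powi (1 - int n) / q = q powi (- int n)" by (simp add: power_int_diff power_int_minus field_simps)
    hence revq: "qpoch q q (int n) * (r / q ^ i) = qpoch q q (int (n - i)) * qpoch q (q powi (- int n)) (int i)"
      using rev[of q] by simp
    hence ne: "qpoch q (q powi (- int n)) (int i) \<noteq> 0" 
      using qpoch_q_nonzero[of n] r by auto
    have revq': "qpoch q q (int (n - i)) = qpoch q q (int n) * (r / q ^ i) / qpoch q (q powi (- int n)) (int i)"
      using revq ne by (simp add: field_simps)
    have W: "W ^ (n - i) = W ^ n / W ^ i" using that nz by (simp add: power_diff)
    show ?thesis
      unfolding phi21_def fps_nth_Abs_fps T_def rev'[OF nz(1) qZ(1)] rev'[OF nz(2) qZ(2)]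
        rev'[OF nz(3) qZ(3)] revq' W
      by (rule reverse_arith) (use r ne nz qpoch_q_nonzero[of n] qpoch_nonzero[OF qZ(3)]
        qpoch_nonzero[OF qZ_reverse] qZ in auto)
  qed
  ultimately show ?thesis
    unfolding phi43_def T_def[symmetric] mult.commute[of "phi21 A B C W"] fps_mult_nth
    unfolding sum_distrib_left by (simp add: sum_distrib_left)
qed

text \<open>
  The arguments of the \<open>\<^sub>4\<phi>\<^sub>3\<close> as variables, to match the forms in which they occur.
\<close>
lemma phi21_mult_nth':
  assumes "A \<noteq> 0" "B \<noteq> 0" "C \<noteq> 0" "W \<noteq> 0" "A \<notin> qZ q" "B \<notin> qZ q" "C \<notin> qZ q"
    and "C' = q powi (1 - int n) / C" "A' = q powi (1 - int n) / A" "B' = q powi (1 - int n) / B"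
    and "x * (W * (A * B)) = w * (q * C)"
  shows "(phi21 A B C W * phi21 \<alpha> \<beta> \<gamma> w) $ n = phi21 A B C W $ n
     * phi43 (q powi (- int n)) C' \<alpha> \<beta> \<gamma> A' B' q x"
proof -
  have x: "x = w / W * (q * C / (A * B))" using assms by (simp add: field_simps)
  show ?thesis unfolding assms(8-10) x by (rule phi21_mult_nth) (use assms in auto)
qed

lemma q_pow_inverse_ne_1: "n > 0 \<Longrightarrow> (1 / q) ^ n \<noteq> 1"
  using q_pow_ne_1[of n] by (simp add: power_divide)

lemma dilate_inverse [simp]: "dilate (1 / q) (dilate q f) = f"
  by (rule fps_ext) (simp add: power_divide)

text \<open>
  In the variable \<open>1/x\<close> the dilation of \<open>x\<close> is the inverse one. The condition on \<open>w\<close> gives the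
  undilated series the coefficient \<open>1\<close> on both sides.
\<close>
lemma hypergeometric_eq_inverse:
  assumes eq: "f - fps_const (1 + \<gamma> / q) * dilate q f + fps_const (\<gamma> / q) * dilate q (dilate q f)
      = fps_const w * fps_X * (f - fps_const (\<alpha> + \<beta>) * dilate q f + fps_const (\<alpha> * \<beta>) * dilate q (dilate q f))"
    and nz: "\<alpha> \<noteq> 0" "\<beta> \<noteq> 0" "\<gamma> \<noteq> 0" and w: "w * (\<alpha> * \<beta>) = q * \<gamma>"
  defines "R \<equiv> dilate (1 / q)"
  shows "f - fps_const (1 + q / \<gamma>) * R f + fps_const (q / \<gamma>) * R (R f)
      = fps_X * (f - fps_const (1 / \<alpha> + 1 / \<beta>) * R f + fps_const (1 / (\<alpha> * \<beta>)) * R (R f))"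
proof (rule fps_ext)
  fix n
  have rec: "(1 - q ^ Suc n) * (1 - \<gamma> * q ^ n) * f $ Suc n = w * (1 - \<alpha> * q ^ n) * (1 - \<beta> * q ^ n) * f $ n" for n
    using eq hypergeometric_rec_iff[of \<gamma> f w \<alpha> \<beta>] by blast
  show "(f - fps_const (1 + q / \<gamma>) * R f + fps_const (q / \<gamma>) * R (R f)) $ n
      = (fps_X * (f - fps_const (1 / \<alpha> + 1 / \<beta>) * R f + fps_const (1 / (\<alpha> * \<beta>)) * R (R f))) $ n"
  proof (cases n)
    case 0
    thus ?thesis by (simp add: R_def algebra_simps)
  next
    case (Suc m)
    define Q where "Q = q ^ m"
    have Q: "Q \<noteq> 0" by (simp add: Q_def)
    define f0 f1 where "f0 = f $ m" "f1 = f $ Suc m"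
    note f01 = this
    have r: "(1 - q * Q) * (1 - \<gamma> * Q) * f1 = w * (1 - \<alpha> * Q) * (1 - \<beta> * Q) * f0"
      using rec[of m] by (simp add: Q_def f01)
    have "\<alpha> * \<beta> * ((1 - q * Q) * (1 - \<gamma> * Q) * f1) = (w * (\<alpha> * \<beta>)) * ((1 - \<alpha> * Q) * (1 - \<beta> * Q) * f0)"
      unfolding r by (simp only: mult_ac)
    hence r': "\<alpha> * \<beta> * ((1 - q * Q) * (1 - \<gamma> * Q) * f1) = q * \<gamma> * ((1 - \<alpha> * Q) * (1 - \<beta> * Q) * f0)"
      unfolding w .
    have 1: "(1 - 1 / (q * Q)) * (1 - 1 / (\<gamma> * Q)) = (1 - q * Q) * (1 - \<gamma> * Q) / (q * \<gamma> * Q\<^sup>2)"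
      "(1 - 1 / (\<alpha> * Q)) * (1 - 1 / (\<beta> * Q)) = (1 - \<alpha> * Q) * (1 - \<beta> * Q) / (\<alpha> * \<beta> * Q\<^sup>2)"
      using nz Q by (simp_all add: field_simps power2_eq_square)
    have 2: "(1 - 1 / (q * Q)) * (1 - 1 / (\<gamma> * Q)) * f1 = (1 - 1 / (\<alpha> * Q)) * (1 - 1 / (\<beta> * Q)) * f0"
      unfolding 1 using r' nz Q by (simp add: divide_simps mult_ac)
    have "(f - fps_const (1 + q / \<gamma>) * R f + fps_const (q / \<gamma>) * R (R f)) $ Suc m
        = (1 - 1 / (q * Q)) * (1 - 1 / (\<gamma> * Q)) * f1"
      unfolding R_def f01 Q_def using nz by (simp add: power_divide field_simps)
    moreover have "(fps_X * (f - fps_const (1 / \<alpha> + 1 / \<beta>) * R f + fps_const (1 / (\<alpha> * \<beta>)) * R (R f))) $ Suc m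
        = (1 - 1 / (\<alpha> * Q)) * (1 - 1 / (\<beta> * Q)) * f0"
      unfolding R_def f01 Q_def using nz by (simp add: power_divide field_simps)
    ultimately show ?thesis unfolding Suc 2 by simp
  qed
qed

end

section \<open>Contiguous relations on the parameter lattice\<close>

locale hyp_params = nonroot_base +
  fixes a b c :: complex
  assumes nz [simp]: "a \<noteq> 0" "b \<noteq> 0" "c \<noteq> 0"
    and a_qZ: "a \<notin> qZ q" and b_qZ: "b \<notin> qZ q" and c_qZ: "c \<notin> qZ q"
    and ab_qZ: "a / b \<notin> qZ q" and ca_qZ: "c / a \<notin> qZ q" and cb_qZ: "c / b \<notin> qZ q"
begin

text \<open>
  The coefficient of \<open>x\<^sup>j\<close> in a solution \<open>x\<^sup>s \<Sum>\<^sub>j sol z k l m j x\<^sup>j\<close>, where \<open>z = q\<^sup>s\<close>. For \<open>z = 1\<close> and \<open>z = q/c\<close> the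
  denominators make it vanish for small \<open>j\<close>; for \<open>z = 1/a\<close> and \<open>z = 1/b\<close> the numerators make it
  vanish for large \<open>j\<close>. The first quotient is the normalisation for which the contiguous
  relations have coefficients independent of \<open>z\<close>.
\<close>
definition sol :: "complex \<Rightarrow> int \<Rightarrow> int \<Rightarrow> int \<Rightarrow> int \<Rightarrow> complex" where
  "sol z k l m j = qpoch q c m / (qpoch q a k * qpoch q b l)
     * (qpoch q (a * z) (j + k) * qpoch q (b * z) (j + l)
        * inverse (qpoch q (q * z) j) * inverse (qpoch q (c * z) (j + m)))"

text \<open>
  The conditions under which the recurrences of the numerators and of the reciprocal denominators of
  \<open>sol\<close> hold at every integer index.
\<close>
definition admissible :: "complex \<Rightarrow> bool" where
  "admissible z \<longleftrightarrow> (\<forall>t. t < 0 \<longrightarrow> a * z * q powi t \<noteq> 1 \<and> b * z * q powi t \<noteq> 1)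
     \<and> (\<forall>t. 0 \<le> t \<longrightarrow> q * z * q powi t \<noteq> 1 \<and> c * z * q powi t \<noteq> 1)"

lemma qpoch_az_succ:
  assumes "admissible z"
  shows "qpoch q (a * z) (t + 1) = (1 - a * z * q powi t) * qpoch q (a * z) t"
    and "qpoch q (b * z) (t + 1) = (1 - b * z * q powi t) * qpoch q (b * z) t"
    and "inverse (qpoch q (q * z) t) = (1 - q * z * q powi t) * inverse (qpoch q (q * z) (t + 1))"
    and "inverse (qpoch q (c * z) t) = (1 - c * z * q powi t) * inverse (qpoch q (c * z) (t + 1))"
proof -
  show "qpoch q (a * z) (t + 1) = (1 - a * z * q powi t) * qpoch q (a * z) t"
    using assms by (cases "0 \<le> t") (auto simp: admissible_def intro: qpoch_succ)
  show "qpoch q (b * z) (t + 1) = (1 - b * z * q powi t) * qpoch q (b * z) t"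
    using assms by (cases "0 \<le> t") (auto simp: admissible_def intro: qpoch_succ)
  show "inverse (qpoch q (q * z) t) = (1 - q * z * q powi t) * inverse (qpoch q (q * z) (t + 1))"
    by (rule inverse_qpoch_succ) (use assms in \<open>cases "t < 0"; simp add: admissible_def\<close>)
  show "inverse (qpoch q (c * z) t) = (1 - c * z * q powi t) * inverse (qpoch q (c * z) (t + 1))"
    by (rule inverse_qpoch_succ) (use assms in \<open>cases "t < 0"; simp add: admissible_def\<close>)
qed

lemma qpoch_param_succ:
  "qpoch q a (t + 1) = (1 - a * q powi t) * qpoch q a t"
  "qpoch q b (t + 1) = (1 - b * q powi t) * qpoch q b t"
  "qpoch q c (t + 1) = (1 - c * q powi t) * qpoch q c t"
  using qZ_mult_ne_1[OF a_qZ] qZ_mult_ne_1[OF b_qZ] qZ_mult_ne_1[OF c_qZ]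
  by (auto intro!: qpoch_succ)

lemma param_ne [simp]:
  "a * q powi t \<noteq> 1" "b * q powi t \<noteq> 1" "c * q powi t \<noteq> 1"
  using qZ_mult_ne_1[OF a_qZ] qZ_mult_ne_1[OF b_qZ] qZ_mult_ne_1[OF c_qZ] by auto

text \<open>
  These are the classical relations \<open>(1 - a T) F = (1 - a) F(a q)\<close>, \<open>(1 - b T) F = (1 - b) F(b q)\<close> and
  \<open>(1 - (c/q) T) F = (1 - c/q) F(c/q)\<close> with the \<open>q\<close>-shift \<open>T\<close>, which acts on the
  coefficient of \<open>x\<^sup>j\<close> as multiplication by \<open>z q\<^sup>j\<close>.
\<close>
lemma sol_up:
  assumes "admissible z"
  shows "(1 - a * q powi k) * sol z (k + 1) l m j = (1 - a * q powi k * (z * q powi j)) * sol z k l m j"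
    and "(1 - b * q powi l) * sol z k (l + 1) m j = (1 - b * q powi l * (z * q powi j)) * sol z k l m j"
    and "(1 - c * q powi (m - 1)) * sol z k l (m - 1) j
           = (1 - c * q powi (m - 1) * (z * q powi j)) * sol z k l m j"
proof -
  have *: "j + (k + 1) = (j + k) + 1" "j + (l + 1) = (j + l) + 1" by simp_all
  have "(1 - a * q powi k) * (qpoch q c m / (qpoch q a (k + 1) * qpoch q b l))
      = qpoch q c m / (qpoch q a k * qpoch q b l)"
    unfolding qpoch_param_succ by simp
  moreover have "qpoch q (a * z) (j + (k + 1))
      = (1 - a * q powi k * (z * q powi j)) * qpoch q (a * z) (j + k)"
    unfolding * qpoch_az_succ(1)[OF assms] by (simp add: q_powi_add mult_ac)
  ultimately show "(1 - a * q powi k) * sol z (k + 1) l m j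
      = (1 - a * q powi k * (z * q powi j)) * sol z k l m j"
    unfolding sol_def mult.assoc[symmetric] by (simp only: mult_ac)
  have "(1 - b * q powi l) * (qpoch q c m / (qpoch q a k * qpoch q b (l + 1)))
      = qpoch q c m / (qpoch q a k * qpoch q b l)"
    unfolding qpoch_param_succ by simp
  moreover have "qpoch q (b * z) (j + (l + 1))
      = (1 - b * q powi l * (z * q powi j)) * qpoch q (b * z) (j + l)"
    unfolding * qpoch_az_succ(2)[OF assms] by (simp add: q_powi_add mult_ac)
  ultimately show "(1 - b * q powi l) * sol z k (l + 1) m j
      = (1 - b * q powi l * (z * q powi j)) * sol z k l m j"
    unfolding sol_def mult.assoc[symmetric] by (simp only: mult_ac)
  have 1: "qpoch q c m = (1 - c * q powi (m - 1)) * qpoch q c (m - 1)"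
    using qpoch_param_succ(3)[of "m - 1"] by simp
  have 2: "inverse (qpoch q (c * z) (j + (m - 1)))
      = (1 - c * q powi (m - 1) * (z * q powi j)) * inverse (qpoch q (c * z) (j + m))"
    using qpoch_az_succ(4)[OF assms, of "j + (m - 1)"]
    by (simp add: q_powi_add power_int_diff mult_ac)
  show "(1 - c * q powi (m - 1)) * sol z k l (m - 1) j
           = (1 - c * q powi (m - 1) * (z * q powi j)) * sol z k l m j"
    unfolding sol_def 1 2 by (simp add: mult_ac)
qed

text \<open>
  The coefficients of the solutions with parameters \<open>(k, l, m)\<close>, \<open>(k-1, l, m)\<close>, \<open>(k, l-1, m)\<close>, and of \<open>x\<close> times
  those with parameters \<open>(k, l, m+1)\<close> and \<open>(k, l, m)\<close>, have a common part \<open>H\<close>; the cofactors are polynomials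
  of degree at most two in \<open>z q\<^sup>j\<close>. Relations between these solutions are thus relations between polynomials.
\<close>
lemma sol_down:
  assumes "admissible z"
  obtains H where
    "sol z k l m j = (1 - a * q powi (k - 1) * (z * q powi j)) * (1 - b * q powi (l - 1) * (z * q powi j)) * H"
    "sol z (k - 1) l m j = (1 - a * q powi (k - 1)) * (1 - b * q powi (l - 1) * (z * q powi j)) * H"
    "sol z k (l - 1) m j = (1 - b * q powi (l - 1)) * (1 - a * q powi (k - 1) * (z * q powi j)) * H"
    "sol z k l (m + 1) (j - 1) = (1 - c * q powi m) * (1 - z * q powi j) * H"
    "sol z k l m (j - 1) = (1 - z * q powi j) * (1 - c * q powi (m - 1) * (z * q powi j)) * H"
proof
  define A where "A = qpoch q (a * z) (j + k - 1)"
  define B where "B = qpoch q (b * z) (j + l - 1)"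
  define Q where "Q = inverse (qpoch q (q * z) j)"
  define C where "C = inverse (qpoch q (c * z) (j + m))"
  define N where "N = qpoch q c m / (qpoch q a k * qpoch q b l)"
  define H where "H = N * (A * B * Q * C)"
  note S = qpoch_az_succ[OF assms]
  have A1: "qpoch q (a * z) (j + k) = (1 - a * q powi (k - 1) * (z * q powi j)) * A"
    using S(1)[of "j + k - 1"] by (simp add: A_def q_powi_add power_int_diff mult_ac)
  have B1: "qpoch q (b * z) (j + l) = (1 - b * q powi (l - 1) * (z * q powi j)) * B"
    using S(2)[of "j + l - 1"] by (simp add: B_def q_powi_add power_int_diff mult_ac)
  have Q1: "inverse (qpoch q (q * z) (j - 1)) = (1 - z * q powi j) * Q"
    using S(3)[of "j - 1"] by (simp add: Q_def power_int_diff mult_ac)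
  have C1: "inverse (qpoch q (c * z) (j - 1 + m)) = (1 - c * q powi (m - 1) * (z * q powi j)) * C"
    using S(4)[of "j - 1 + m"] by (simp add: C_def q_powi_add power_int_diff mult_ac)
  have "qpoch q a k = (1 - a * q powi (k - 1)) * qpoch q a (k - 1)"
    using qpoch_param_succ(1)[of "k - 1"] by simp
  hence Na: "qpoch q c m / (qpoch q a (k - 1) * qpoch q b l) = (1 - a * q powi (k - 1)) * N"
    unfolding N_def by simp
  have "qpoch q b l = (1 - b * q powi (l - 1)) * qpoch q b (l - 1)"
    using qpoch_param_succ(2)[of "l - 1"] by simp
  hence Nb: "qpoch q c m / (qpoch q a k * qpoch q b (l - 1)) = (1 - b * q powi (l - 1)) * N"
    unfolding N_def by simp
  have Nc: "qpoch q c (m + 1) / (qpoch q a k * qpoch q b l) = (1 - c * q powi m) * N"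
    unfolding N_def qpoch_param_succ by simp
  have ar: "j + (k - 1) = j + k - 1" "j + (l - 1) = j + l - 1" "j - 1 + (m + 1) = j + m"
     "j - 1 + k = j + k - 1" "j - 1 + l = j + l - 1" by simp_all
  show "sol z k l m j = (1 - a * q powi (k - 1) * (z * q powi j)) * (1 - b * q powi (l - 1) * (z * q powi j)) * H"
    unfolding sol_def A1 B1 Q_def[symmetric] C_def[symmetric] N_def[symmetric] H_def by (simp only: mult_ac)
  show "sol z (k - 1) l m j = (1 - a * q powi (k - 1)) * (1 - b * q powi (l - 1) * (z * q powi j)) * H"
    unfolding sol_def ar Na B1 A_def[symmetric] Q_def[symmetric] C_def[symmetric] H_def by (simp only: mult_ac)
  show "sol z k (l - 1) m j = (1 - b * q powi (l - 1)) * (1 - a * q powi (k - 1) * (z * q powi j)) * H"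
    unfolding sol_def ar Nb A1 B_def[symmetric] Q_def[symmetric] C_def[symmetric] H_def by (simp only: mult_ac)
  show "sol z k l (m + 1) (j - 1) = (1 - c * q powi m) * (1 - z * q powi j) * H"
    unfolding sol_def ar Nc Q1 A_def[symmetric] B_def[symmetric] C_def[symmetric] H_def by (simp only: mult_ac)
  show "sol z k l m (j - 1) = (1 - z * q powi j) * (1 - c * q powi (m - 1) * (z * q powi j)) * H"
    unfolding sol_def C1 ar Q1 A_def[symmetric] B_def[symmetric] N_def[symmetric] H_def by (simp only: mult_ac)
qed

text \<open>
  By \<open>sol_up\<close> the four solutions with parameters \<open>(k, l, m)\<close>, \<open>(k+1, l, m)\<close>, \<open>(k, l+1, m)\<close>, \<open>(k, l, m-1)\<close>
  lie in the span of \<open>F\<close> and \<open>T F\<close>, so any three of them are linearly dependent.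
\<close>
lemma sol_up_simplex:
  assumes "admissible z"
  defines "\<alpha> \<equiv> \<lambda>k. a * q powi k" and "\<beta> \<equiv> \<lambda>l. b * q powi l" and "\<gamma> \<equiv> \<lambda>m. c * q powi m"
  shows "(\<beta> l - \<gamma> (m - 1)) * (1 - \<alpha> k) * sol z (k + 1) l m j
       + (\<gamma> (m - 1) - \<alpha> k) * (1 - \<beta> l) * sol z k (l + 1) m j
       + (\<alpha> k - \<beta> l) * (1 - \<gamma> (m - 1)) * sol z k l (m - 1) j = 0"
    and "\<beta> l * (1 - \<alpha> k) * sol z (k + 1) l m j - \<alpha> k * (1 - \<beta> l) * sol z k (l + 1) m j
       = (\<beta> l - \<alpha> k) * sol z k l m j"
  unfolding \<alpha>_def \<beta>_def \<gamma>_def mult.assoc[of _ "1 - _"] sol_up[OF assms(1)]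
  by (simp_all add: algebra_simps)

text \<open>
  The factor \<open>1 - (a b/c) q\<^bsup>k+l-m-1\<^esup> x\<close> in the second relation is the source of the poles of the
  three-term coefficient. It depends on \<open>k + l - m\<close> only.
\<close>
lemma sol_down_simplex:
  assumes "admissible z"
  defines "\<alpha> \<equiv> \<lambda>k. a * q powi k" and "\<beta> \<equiv> \<lambda>l. b * q powi l" and "\<gamma> \<equiv> \<lambda>m. c * q powi m"
  shows "(1 - \<gamma> m) * (sol z k (l - 1) m j - sol z (k - 1) l m j)
       = (\<alpha> (k - 1) - \<beta> (l - 1)) * sol z k l (m + 1) (j - 1)"
    and "(\<alpha> (k - 1) - \<beta> (l - 1))
         * (sol z k l m j - \<alpha> (k - 1) * \<beta> (l - 1) / \<gamma> (m - 1) * sol z k l m (j - 1))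
       = \<alpha> (k - 1) * (1 - \<beta> (l - 1) / \<gamma> (m - 1)) * sol z k (l - 1) m j
         - \<beta> (l - 1) * (1 - \<alpha> (k - 1) / \<gamma> (m - 1)) * sol z (k - 1) l m j"
proof -
  have g: "\<gamma> (m - 1) \<noteq> 0" by (simp add: \<gamma>_def)
  obtain H where H: 
    "sol z k l m j = (1 - \<alpha> (k - 1) * (z * q powi j)) * (1 - \<beta> (l - 1) * (z * q powi j)) * H"
    "sol z (k - 1) l m j = (1 - \<alpha> (k - 1)) * (1 - \<beta> (l - 1) * (z * q powi j)) * H"
    "sol z k (l - 1) m j = (1 - \<beta> (l - 1)) * (1 - \<alpha> (k - 1) * (z * q powi j)) * H"
    "sol z k l (m + 1) (j - 1) = (1 - \<gamma> m) * (1 - z * q powi j) * H"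
    "sol z k l m (j - 1) = (1 - z * q powi j) * (1 - \<gamma> (m - 1) * (z * q powi j)) * H"
    using sol_down[OF assms(1), of k l m j] unfolding \<alpha>_def \<beta>_def \<gamma>_def by metis
  show "(1 - \<gamma> m) * (sol z k (l - 1) m j - sol z (k - 1) l m j)
       = (\<alpha> (k - 1) - \<beta> (l - 1)) * sol z k l (m + 1) (j - 1)"
    unfolding H by (simp add: algebra_simps)
  show "(\<alpha> (k - 1) - \<beta> (l - 1))
         * (sol z k l m j - \<alpha> (k - 1) * \<beta> (l - 1) / \<gamma> (m - 1) * sol z k l m (j - 1))
       = \<alpha> (k - 1) * (1 - \<beta> (l - 1) / \<gamma> (m - 1)) * sol z k (l - 1) m j
         - \<beta> (l - 1) * (1 - \<alpha> (k - 1) / \<gamma> (m - 1)) * sol z (k - 1) l m j"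
    unfolding H using g by (simp add: field_simps)
qed

text \<open>
  The argument \<open>n\<close> is the exponent of \<open>x\<close>. The lattice is layered by the level \<open>k + l - m\<close>. The first two
  relations link points of level \<open>0\<close>, the third one leads from each level to the next lower one below
  \<open>0\<close>, the fourth from each level to the next higher one above \<open>0\<close>. In the fourth, the factor from
  \<open>sol_down_simplex\<close> is absent: it is absorbed in the normalisation of the family.
\<close>
definition contiguous :: "(int \<Rightarrow> int \<Rightarrow> int \<Rightarrow> int \<Rightarrow> complex) \<Rightarrow> bool" where
  "contiguous H \<longleftrightarrow>
    (\<forall>k l m n. k + l - m = -1 \<longrightarrow>
       (b * q powi l - c * q powi (m - 1)) * (1 - a * q powi k) * H (k + 1) l m n
       + (c * q powi (m - 1) - a * q powi k) * (1 - b * q powi l) * H k (l + 1) m n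
       + (a * q powi k - b * q powi l) * (1 - c * q powi (m - 1)) * H k l (m - 1) n = 0) \<and>
    (\<forall>k l m n. k + l - m = 1 \<longrightarrow>
       (1 - c * q powi m) * (H k (l - 1) m n - H (k - 1) l m n)
       = (a * q powi (k - 1) - b * q powi (l - 1)) * H k l (m + 1) (n - 1)) \<and>
    (\<forall>k l m n. k + l - m < 0 \<longrightarrow>
       b * q powi l * (1 - a * q powi k) * H (k + 1) l m n
       - a * q powi k * (1 - b * q powi l) * H k (l + 1) m n
       = (b * q powi l - a * q powi k) * H k l m n) \<and>
    (\<forall>k l m n. 1 \<le> k + l - m \<longrightarrow>
       (a * q powi (k - 1) - b * q powi (l - 1)) * H k l m n
       = a * q powi (k - 1) * (1 - b * q powi (l - 1) / (c * q powi (m - 1))) * H k (l - 1) m n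
         - b * q powi (l - 1) * (1 - a * q powi (k - 1) / (c * q powi (m - 1))) * H (k - 1) l m n)"

lemma contiguousD1:
  assumes "contiguous H" "k + l - m = -1"
  shows "(b * q powi l - c * q powi (m - 1)) * (1 - a * q powi k) * H (k + 1) l m n
       + (c * q powi (m - 1) - a * q powi k) * (1 - b * q powi l) * H k (l + 1) m n
       + (a * q powi k - b * q powi l) * (1 - c * q powi (m - 1)) * H k l (m - 1) n = 0"
  using assms(1)[unfolded contiguous_def, THEN conjunct1, rule_format, OF assms(2)] .

lemma contiguousD2:
  assumes "contiguous H" "k + l - m = 1"
  shows "(1 - c * q powi m) * (H k (l - 1) m n - H (k - 1) l m n)
       = (a * q powi (k - 1) - b * q powi (l - 1)) * H k l (m + 1) (n - 1)"
  using assms(1)[unfolded contiguous_def, THEN conjunct2, THEN conjunct1, rule_format, OF assms(2)] .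

lemma contiguousD3:
  assumes "contiguous H" "k + l - m < 0"
  shows "b * q powi l * (1 - a * q powi k) * H (k + 1) l m n
       - a * q powi k * (1 - b * q powi l) * H k (l + 1) m n
       = (b * q powi l - a * q powi k) * H k l m n"
  using assms(1)[unfolded contiguous_def, THEN conjunct2, THEN conjunct2, THEN conjunct1, rule_format, OF assms(2)] .

lemma contiguousD4:
  assumes "contiguous H" "1 \<le> k + l - m"
  shows "(a * q powi (k - 1) - b * q powi (l - 1)) * H k l m n
       = a * q powi (k - 1) * (1 - b * q powi (l - 1) / (c * q powi (m - 1))) * H k (l - 1) m n
         - b * q powi (l - 1) * (1 - a * q powi (k - 1) / (c * q powi (m - 1))) * H (k - 1) l m n"
  using assms(1)[unfolded contiguous_def, THEN conjunct2, THEN conjunct2, THEN conjunct2, rule_format, OF assms(2)] .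

text \<open>
  Closure under the combination used in \<open>main_identity\<close>; the shift \<open>n + 1\<close> is harmless because no
  coefficient of the relations depends on \<open>n\<close>.
\<close>
lemma contiguous_diff:
  assumes "contiguous F" "contiguous G"
  shows "contiguous (\<lambda>k l m n. F k l m n - r * G k l m (n + 1))"
  unfolding contiguous_def
proof (intro conjI allI impI, goal_cases)
  case (1 k l m n)
  have F: "(b * q powi l - c * q powi (m - 1)) * (1 - a * q powi k) * F (k + 1) l m n
       + (c * q powi (m - 1) - a * q powi k) * (1 - b * q powi l) * F k (l + 1) m n
       + (a * q powi k - b * q powi l) * (1 - c * q powi (m - 1)) * F k l (m - 1) n = 0"
    by (rule contiguousD1[OF assms(1) 1])
  have G: "(b * q powi l - c * q powi (m - 1)) * (1 - a * q powi k) * G (k + 1) l m (n + 1)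
       + (c * q powi (m - 1) - a * q powi k) * (1 - b * q powi l) * G k (l + 1) m (n + 1)
       + (a * q powi k - b * q powi l) * (1 - c * q powi (m - 1)) * G k l (m - 1) (n + 1) = 0"
    by (rule contiguousD1[OF assms(2) 1])
  from F G show ?case by algebra
next
  case (2 k l m n)
  have F: "(1 - c * q powi m) * (F k (l - 1) m n - F (k - 1) l m n)
       = (a * q powi (k - 1) - b * q powi (l - 1)) * F k l (m + 1) (n - 1)"
    by (rule contiguousD2[OF assms(1) 2])
  have G: "(1 - c * q powi m) * (G k (l - 1) m (n + 1) - G (k - 1) l m (n + 1))
       = (a * q powi (k - 1) - b * q powi (l - 1)) * G k l (m + 1) (n + 1 - 1)"
    by (rule contiguousD2[OF assms(2) 2])
  from F G show ?case unfolding diff_add_cancel add_diff_cancel_right' by algebra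
next
  case (3 k l m n)
  have F: "b * q powi l * (1 - a * q powi k) * F (k + 1) l m n
       - a * q powi k * (1 - b * q powi l) * F k (l + 1) m n
       = (b * q powi l - a * q powi k) * F k l m n"
    by (rule contiguousD3[OF assms(1) 3])
  have G: "b * q powi l * (1 - a * q powi k) * G (k + 1) l m (n + 1)
       - a * q powi k * (1 - b * q powi l) * G k (l + 1) m (n + 1)
       = (b * q powi l - a * q powi k) * G k l m (n + 1)"
    by (rule contiguousD3[OF assms(2) 3])
  from F G show ?case by algebra
next
  case (4 k l m n)
  have F: "(a * q powi (k - 1) - b * q powi (l - 1)) * F k l m n
       = a * q powi (k - 1) * (1 - b * q powi (l - 1) / (c * q powi (m - 1))) * F k (l - 1) m n
         - b * q powi (l - 1) * (1 - a * q powi (k - 1) / (c * q powi (m - 1))) * F (k - 1) l m n"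
    by (rule contiguousD4[OF assms(1) 4])
  have G: "(a * q powi (k - 1) - b * q powi (l - 1)) * G k l m (n + 1)
       = a * q powi (k - 1) * (1 - b * q powi (l - 1) / (c * q powi (m - 1))) * G k (l - 1) m (n + 1)
         - b * q powi (l - 1) * (1 - a * q powi (k - 1) / (c * q powi (m - 1))) * G (k - 1) l m (n + 1)"
    by (rule contiguousD4[OF assms(2) 4])
  from F G show ?case by algebra
qed

text \<open>
  The coefficients of the contiguous relations that have to be inverted are nonzero by these inequalities.
\<close>
lemma param_differ:
  "a * q powi i \<noteq> b * q powi j" "a * q powi i \<noteq> c * q powi j" "b * q powi i \<noteq> c * q powi j"
proof -
  have *: "v / u \<in> qZ q" if "u * q powi i = v * q powi j" "u \<noteq> 0" for u v :: complex and i j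
  proof -
    have "v / u = q powi (i - j)" using that by (simp add: power_int_diff field_simps)
    thus ?thesis by (simp add: qZ_def)
  qed
  show "a * q powi i \<noteq> b * q powi j" using *[of b j a i] ab_qZ by auto
  show "a * q powi i \<noteq> c * q powi j" using *[of a i c j] ca_qZ by auto
  show "b * q powi i \<noteq> c * q powi j" using *[of b i c j] cb_qZ by auto
qed

text \<open>
  In level \<open>0\<close> the points are indexed by \<open>(k, l)\<close> and the first two relations are triangles which tile it:
  two vertices of a triangle determine the third. So two adjacent zeros spread over level \<open>0\<close>, and
  the other two relations carry them to all levels. The given point \<open>(1, 0, 0)\<close> has level \<open>1\<close>; it
  yields the second zero of level \<open>0\<close>, at \<open>(1, -1, 0)\<close>.
\<close>
lemma contiguous_zero:
  assumes H: "contiguous H" and base: "\<And>n. H 0 0 0 n = 0" "\<And>n. H 1 0 0 n = 0"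
  shows "H k l m n = 0"
proof -
  \<comment> \<open>The zeros in level \<open>0\<close>, and then the horizontal pairs \<open>S\<close> of adjacent zeros.\<close>
  define Z where "Z k l = (\<forall>n. H k l (k + l) n = 0)" for k l
  note ne = param_differ param_differ[symmetric]
  have U: "(b * q powi l - c * q powi (k + l)) * (1 - a * q powi k) * H (k + 1) l (k + 1 + l) n
       + (c * q powi (k + l) - a * q powi k) * (1 - b * q powi l) * H k (l + 1) (k + (l + 1)) n
       + (a * q powi k - b * q powi l) * (1 - c * q powi (k + l)) * H k l (k + l) n = 0" for k l n
    using contiguousD1[OF H, of k l "k + l + 1" n]
    by (simp add: algebra_simps)
  have U1: "Z k (l + 1)" if "Z k l" "Z (k + 1) l" for k l
    using that U[of l k] ne unfolding Z_def by (simp)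
  have U2: "Z k l" if "Z (k + 1) l" "Z k (l + 1)" for k l
    using that U[of l k] ne unfolding Z_def by (simp)
  have U3: "Z (k + 1) l" if "Z k l" "Z k (l + 1)" for k l
    using that U[of l k] ne unfolding Z_def by (simp)
  have D: "(1 - c * q powi (k + l - 1)) * (H k (l - 1) (k + (l - 1)) n - H (k - 1) l (k - 1 + l) n)
       = (a * q powi (k - 1) - b * q powi (l - 1)) * H k l (k + l) (n - 1)" for k l n
    using contiguousD2[OF H, of k l "k + l - 1" n]
    by (simp add: algebra_simps)
  \<comment> \<open>Solving for the vertex multiplied by \<open>x\<close> only shifts the exponent.\<close>
  have D': "(1 - c * q powi (k + l - 1)) * (H k (l - 1) (k + (l - 1)) (n + 1) - H (k - 1) l (k - 1 + l) (n + 1))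
       = (a * q powi (k - 1) - b * q powi (l - 1)) * H k l (k + l) n" for k l n
    using D[of k l "n + 1"] by simp
  have D1: "Z k l" if "Z k (l - 1)" "Z (k - 1) l" for k l
    using that D'[of k l] ne unfolding Z_def by (simp)
  have D2: "Z k (l - 1)" if "Z k l" "Z (k - 1) l" for k l
    using that D[of k l] ne unfolding Z_def by (simp)
  have D3: "Z (k - 1) l" if "Z k l" "Z k (l - 1)" for k l
    using that D[of k l] ne unfolding Z_def by (simp)
  define S where "S k l \<longleftrightarrow> Z k l \<and> Z (k + 1) l" for k l
  have S1: "S k (l + 1)" if "S k l" for k l
    using that U1[of k l] D1[of "k + 1" "l + 1"] by (auto simp: S_def)
  have S2: "S (k + 1) l" if "S k l" for k l
    using that S1[OF that] U3[of "k + 1" l] by (auto simp: S_def)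
  have S3: "S k (l - 1)" if "S k l" for k l
    using that D2[of "k + 1" l] U2[of k "l - 1"] by (auto simp: S_def)
  have S4: "S (k - 1) l" if "S k l" for k l
    using that S1[OF that] D3[of k "l + 1"] U2[of "k - 1" l] by (auto simp: S_def)
  have R4: "(a * q powi (k - 1) - b * q powi (l - 1)) * H k l m n
       = a * q powi (k - 1) * (1 - b * q powi (l - 1) / (c * q powi (m - 1))) * H k (l - 1) m n
         - b * q powi (l - 1) * (1 - a * q powi (k - 1) / (c * q powi (m - 1))) * H (k - 1) l m n"
    if "1 \<le> k + l - m" for k l m n
    by (rule contiguousD4[OF H that])
  have R3: "b * q powi l * (1 - a * q powi k) * H (k + 1) l m n
       - a * q powi k * (1 - b * q powi l) * H k (l + 1) m n
       = (b * q powi l - a * q powi k) * H k l m n" if "k + l - m < 0" for k l m n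
    by (rule contiguousD3[OF H that])
  have "Z 0 0" using base by (simp add: Z_def)
  moreover have "Z 1 (- 1)"
    using base R4[of 1 0 0] ne(3)[of "-1" "-1"] by (simp add: Z_def)
  ultimately have "S 0 (- 1)" using U2[of 0 "- 1"] by (simp add: S_def)
  hence S0: "S 0 l" for l
    by (induction l rule: int_induct[where k = "- 1"]) (use S1 S3 in auto)
  have S: "S k l" for k l
    by (induction k rule: int_induct[where k = 0]) (use S0 S2 S4 in auto)
  show ?thesis
  proof (cases "0 \<le> k + l - m")
    case True
    then obtain s where "k + l - m = int s" using nonneg_int_cases by blast
    thus ?thesis
    proof (induction s arbitrary: k l m n)
      case 0
      hence "m = k + l" by simp
      thus ?case using S[of k l] by (simp add: S_def Z_def)
    next
      case (Suc s)
      have "H k (l - 1) m n = 0" "H (k - 1) l m n = 0"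
        using Suc.prems by (auto intro!: Suc.IH)
      thus ?case using R4[of k l m n] Suc.prems ne(1)[of "k - 1" "l - 1"] by simp
    qed
  next
    case False
    define s where "s = nat (m - k - l)"
    have "m - k - l = int s" using False by (simp add: s_def)
    thus ?thesis
    proof (induction s arbitrary: k l m n)
      case 0
      hence "m = k + l" by simp
      thus ?case using S[of k l] by (simp add: S_def Z_def)
    next
      case (Suc s)
      have "H k (l + 1) m n = 0" "H (k + 1) l m n = 0"
        using Suc.prems by (auto intro!: Suc.IH)
      thus ?case using R3[of k l m n] Suc.prems ne(1)[of k l] by simp
    qed
  qed
qed

section \<open>The four formal solutions\<close>

lemma quotient_qZ:
  "a / c \<notin> qZ q" "b / c \<notin> qZ q" "b / a \<notin> qZ q" "1 / a \<notin> qZ q" "1 / b \<notin> qZ q" "1 / c \<notin> qZ q"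
proof -
  have inv: "u / v \<in> qZ q" if "v / u \<in> qZ q" for u v
    using qZ_inverse[of "u / v"] that by (simp add: inverse_divide)
  show "a / c \<notin> qZ q" "b / c \<notin> qZ q" "b / a \<notin> qZ q" "1 / a \<notin> qZ q" "1 / b \<notin> qZ q" "1 / c \<notin> qZ q"
    using inv[of a c] inv[of b c] inv[of b a] inv[of 1 a] inv[of 1 b] inv[of 1 c]
      a_qZ b_qZ c_qZ ab_qZ ca_qZ cb_qZ by auto
qed

lemma scaled_qZ:
  assumes "u \<notin> qZ q" and "v = u * q powi n"
  shows "v \<notin> qZ q"
  using assms by simp

lemma powi_1_add: "q * q powi n = q powi (n + 1)" "q powi n * q = q powi (n + 1)"
  by (simp_all add: q_powi_add)

lemma admissible_1: "admissible 1"
  using qZ_mult_ne_1[OF a_qZ] qZ_mult_ne_1[OF b_qZ] qZ_mult_ne_1[OF c_qZ] q_powi_ne_1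
  by (auto simp: admissible_def powi_1_add)

lemma admissible_c: "admissible (q / c)"
proof -
  have *: "a * (q / c) * q powi t = a / c * q powi (t + 1)" "b * (q / c) * q powi t = b / c * q powi (t + 1)"
    "q * (q / c) * q powi t = 1 / c * q powi (t + 2)" "c * (q / c) * q powi t = q powi (t + 1)" for t
    by (simp_all add: q_powi_add power2_eq_square)
  have "q powi (t + 1) \<noteq> 1" if "0 \<le> t" for t using q_powi_ne_1[of "t + 1"] that by simp
  thus ?thesis
    unfolding admissible_def * using qZ_mult_ne_1 quotient_qZ by blast
qed

lemma admissible_a: "admissible (1 / a)"
proof -
  have *: "a * (1 / a) * q powi t = q powi t" "b * (1 / a) * q powi t = b / a * q powi t"
    "q * (1 / a) * q powi t = 1 / a * q powi (t + 1)" "c * (1 / a) * q powi t = c / a * q powi t" for t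
    by (simp_all add: q_powi_add)
  have "q powi t \<noteq> 1" if "t < 0" for t using q_powi_ne_1[of t] that by simp
  thus ?thesis
    unfolding admissible_def * using qZ_mult_ne_1 quotient_qZ ca_qZ by blast
qed

lemma qpoch_q_neg: "j < 0 \<Longrightarrow> qpoch q q j = 0"
  by (auto simp: qpoch_def power_int_minus intro!: bexI[of _ 1])

lemma qpoch_1_pos: "0 < j \<Longrightarrow> qpoch q 1 j = 0"
  by (auto simp: qpoch_def intro!: bexI[of _ 0])

lemma expansion_nth:
  fixes L :: complex
  shows   "(fls_const L * fls_shift i (fps_to_fls f)) $$ j = (if j < - i then 0 else L * f $ nat (j + i))"
  by auto

definition zero_series1 :: "int \<Rightarrow> int \<Rightarrow> int \<Rightarrow> complex fls" where
  "zero_series1 k l m = fps_to_fls (phi21 (a * q powi k) (b * q powi l) (c * q powi m) 1)"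

text \<open>
  The leading coefficient of the solution at \<open>0\<close> with \<open>z = q/c\<close>.
\<close>
definition zero_lead2 :: "int \<Rightarrow> int \<Rightarrow> int \<Rightarrow> complex" where
  "zero_lead2 k l m = qpoch q c m * (qpoch q (a * q / c) (k - m) * qpoch q (b * q / c) (l - m))
     / (qpoch q a k * qpoch q b l * qpoch q (q\<^sup>2 / c) (- m))"

definition zero_series2 :: "int \<Rightarrow> int \<Rightarrow> int \<Rightarrow> complex fls" where
  "zero_series2 k l m = fls_const (zero_lead2 k l m) * fls_shift m (fps_to_fls (phi21 (a * q powi (k - m + 1) / c) (b * q powi (l - m + 1) / c) (q powi (2 - m) / c) 1))"

text \<open>
  The leading coefficient of the solution at infinity with \<open>z = 1/a\<close>.
\<close>
definition inf_lead :: "int \<Rightarrow> int \<Rightarrow> int \<Rightarrow> complex" where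
  "inf_lead k l m = qpoch q c m / (qpoch q a k * qpoch q b l)
     * (qpoch q (b / a) (l - k) / (qpoch q (q / a) (- k) * qpoch q (c / a) (m - k)))"

text \<open>
  A series in the variable \<open>1/x\<close>.
\<close>
definition inf_series :: "int \<Rightarrow> int \<Rightarrow> int \<Rightarrow> complex fls" where
  "inf_series k l m = fls_const (inf_lead k l m) * fls_shift (- k) (fps_to_fls (phi21 (a * q powi k) (a * q powi (k - m + 1) / c) (a * q powi (k - l + 1) / b)
       (c * q powi (m - k - l + 1) / (a * b))))"

lemma zero_series1_nth: "zero_series1 k l m $$ j = sol 1 k l m j"
proof (cases "j < 0")
  case True
  thus ?thesis by (simp add: zero_series1_def sol_def qpoch_q_neg)
next
  case False
  then obtain n where j: "j = int n" using nonneg_int_cases[of j] by auto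
  have *: "qpoch q a (k + int n) = qpoch q a k * qpoch q (a * q powi k) (int n)"
    "qpoch q b (l + int n) = qpoch q b l * qpoch q (b * q powi l) (int n)"
    "qpoch q c (m + int n) = qpoch q c m * qpoch q (c * q powi m) (int n)"
    by (rule qpoch_add; rule a_qZ b_qZ c_qZ)+
  show ?thesis
    unfolding zero_series1_def sol_def j
    using qpoch_nonzero[OF a_qZ, of k] qpoch_nonzero[OF b_qZ, of l] qpoch_nonzero[OF c_qZ, of m]
      qpoch_nonzero[of "c * q powi m" "int n"] c_qZ qpoch_q_nonzero[of n]
    by (simp add: phi21_def add.commute[of "int n"] * divide_simps)
qed

lemma zero_series2_nth: "zero_series2 k l m $$ j = sol (q / c) k l m j"
proof (cases "j < - m")
  case True
  thus ?thesis unfolding zero_series2_def sol_def expansion_nth by (simp add: qpoch_q_neg)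
next
  case False
  define n where "n = nat (j + m)"
  have j: "j = int n - m" using False by (simp add: n_def)
  have qz: "a * q / c \<notin> qZ q" "b * q / c \<notin> qZ q" "q\<^sup>2 / c \<notin> qZ q"
    using scaled_qZ[OF quotient_qZ(1), of _ 1] scaled_qZ[OF quotient_qZ(2), of _ 1]
      scaled_qZ[OF quotient_qZ(6), of _ 2] by auto
  have *: "qpoch q (a * q / c) ((k - m) + int n)
      = qpoch q (a * q / c) (k - m) * qpoch q (a * q / c * q powi (k - m)) (int n)"
    "qpoch q (b * q / c) ((l - m) + int n)
      = qpoch q (b * q / c) (l - m) * qpoch q (b * q / c * q powi (l - m)) (int n)"
    "qpoch q (q\<^sup>2 / c) (- m + int n)
      = qpoch q (q\<^sup>2 / c) (- m) * qpoch q (q\<^sup>2 / c * q powi (- m)) (int n)"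
    by (rule qpoch_add; rule qz)+
  have e: "a * q powi (k - m + 1) / c = a * q / c * q powi (k - m)"
    "b * q powi (l - m + 1) / c = b * q / c * q powi (l - m)"
    "q powi (2 - m) / c = q\<^sup>2 / c * q powi (- m)"
    by (simp_all add: q_powi_add power_int_diff power_int_minus field_simps)
  have i: "j + k = (k - m) + int n" "j + l = (l - m) + int n" "j + m = int n" "j = - m + int n"
    by (simp_all add: j)
  have "\<not> j < - m" "nat (j + m) = n" using False by (simp_all add: n_def)
  hence "zero_series2 k l m $$ j = zero_lead2 k l m * phi21 (a * q powi (k - m + 1) / c)
      (b * q powi (l - m + 1) / c) (q powi (2 - m) / c) 1 $ n"
    unfolding zero_series2_def expansion_nth by (simp only: if_False)
  also have "\<dots> = qpoch q c m / (qpoch q a k * qpoch q b l)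
     * (qpoch q (a * (q / c)) (j + k) * qpoch q (b * (q / c)) (j + l)
        * inverse (qpoch q (q * (q / c)) j) * inverse (qpoch q (c * (q / c)) (j + m)))"
  proof -
    have z: "a * (q / c) = a * q / c" "b * (q / c) = b * q / c" "q * (q / c) = q\<^sup>2 / c" "c * (q / c) = q"
      by (simp_all add: power2_eq_square)
    show ?thesis unfolding phi21_def fps_nth_Abs_fps zero_lead2_def e i(1,2,3) z
      unfolding i(4) * by (simp add: divide_inverse mult_ac)
  qed
  finally show ?thesis unfolding sol_def .
qed

text \<open>
  In the exponent \<open>-j\<close>, factorials of index \<open>r - n\<close> become reciprocal factorials of index \<open>n\<close>; the powers
  of \<open>q\<close> with quadratic exponent cancel, as two of the four factorials are in the denominator.
\<close>
lemma inf_series_nth: "inf_series k l m $$ j = sol (1 / a) k l m (- j)"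
proof (cases "j < k")
  case True
  thus ?thesis unfolding inf_series_def sol_def expansion_nth by (simp add: qpoch_1_pos)
next
  case False
  define n where "n = nat (j - k)"
  have j: "j = int n + k" using False by (simp add: n_def)
  define v2 v3 v4 where "v2 = b / a * q powi (l - k)" "v3 = q / a * q powi (- k)"
    "v4 = c / a * q powi (m - k)"
  note v = this
  have qz: "q / a \<notin> qZ q" using scaled_qZ[OF quotient_qZ(4), of _ 1] by auto
  have vq: "v2 \<notin> qZ q" "v3 \<notin> qZ q" "v4 \<notin> qZ q"
    unfolding v qZ_mult_iff using qz quotient_qZ ca_qZ by blast+
  have v0: "v2 \<noteq> 0" "v3 \<noteq> 0" "v4 \<noteq> 0" by (simp_all add: v)
  have *: "qpoch q (b / a) ((l - k) + - int n) = qpoch q (b / a) (l - k) * qpoch q v2 (- int n)"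
    "qpoch q (q / a) (- k + - int n) = qpoch q (q / a) (- k) * qpoch q v3 (- int n)"
    "qpoch q (c / a) ((m - k) + - int n) = qpoch q (c / a) (m - k) * qpoch q v4 (- int n)"
    unfolding v by (rule qpoch_add; rule qz quotient_qZ ca_qZ)+
  have r: "q / v2 = a * q powi (k - l + 1) / b" "q / v3 = a * q powi k"
    "q / v4 = a * q powi (k - m + 1) / c"
    by (simp_all add: v q_powi_add power_int_diff power_int_minus field_simps)
  have neg1: "qpoch q 1 (- int n) = (- q) ^ n * q powi triangular (int n) / qpoch q q (int n)"
    using qpoch_neg[of 1 n] q_powi_ne_1 qpoch_q_nonzero[of n] by (simp add: field_simps)
  have i: "- j + k = - int n" "- j + l = (l - k) + - int n" "- j + m = (m - k) + - int n"
     "- j = - k + - int n"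
    by (simp_all add: j)
  have w: "c * q powi (m - k - l + 1) / (a * b) = v3 * v4 / v2"
    by (simp add: v q_powi_add power_int_diff power_int_minus field_simps)
  have "\<not> j < - (- k)" "nat (j + - k) = n" using False by (simp_all add: n_def)
  hence "inf_series k l m $$ j = inf_lead k l m * phi21 (a * q powi k) (a * q powi (k - m + 1) / c)
      (a * q powi (k - l + 1) / b) (c * q powi (m - k - l + 1) / (a * b)) $ n"
    unfolding inf_series_def expansion_nth by (simp only: if_False)
  also have "\<dots> = qpoch q c m / (qpoch q a k * qpoch q b l)
     * (qpoch q (a * (1 / a)) (- j + k) * qpoch q (b * (1 / a)) (- j + l)
        * inverse (qpoch q (q * (1 / a)) (- j)) * inverse (qpoch q (c * (1 / a)) (- j + m)))"
  proof -
    have z: "a * (1 / a) = 1" "b * (1 / a) = b / a" "q * (1 / a) = q / a" "c * (1 / a) = c / a"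
      by simp_all
    define T where "T = q powi triangular (int n)"
    have T: "T \<noteq> 0" by (simp add: T_def)
    define p2 p3 p4 where "p2 = qpoch q (q / v2) (int n)" "p3 = qpoch q (q / v3) (int n)"
      "p4 = qpoch q (q / v4) (int n)"
    note p = this
    have p0: "p2 \<noteq> 0" "p3 \<noteq> 0" "p4 \<noteq> 0" 
      unfolding p using qpoch_nonzero qZ_q_div vq by blast+
    have gen: "N * (x2 / (x3 * x4)) * L = N * (X1 * (x2 * X2) * inverse (x3 * X3) * inverse (x4 * X4))"
      if "L = X1 * X2 * inverse X3 * inverse X4" for N x2 x3 x4 L X1 X2 X3 X4 :: complex
      unfolding that by (simp add: divide_inverse mult_ac)
    have core: "p3 * p4 / (qpoch q q (int n) * p2) * (v3 * v4 / v2) ^ n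
        = ((- q) ^ n * T / qpoch q q (int n)) * ((- q / v2) ^ n * T / p2)
          * inverse ((- q / v3) ^ n * T / p3) * inverse ((- q / v4) ^ n * T / p4)"
      using T p0 v0 qpoch_q_nonzero[of n]
      unfolding power_divide power_mult_distrib by (simp add: divide_simps)
    show ?thesis
      unfolding phi21_def fps_nth_Abs_fps inf_lead_def w z i(1,2,3)
      unfolding i(4) * qpoch_neg_qZ[OF v0(1) vq(1)] qpoch_neg_qZ[OF v0(2) vq(2)] qpoch_neg_qZ[OF v0(3) vq(3)] neg1
        T_def[symmetric] r[symmetric] p[symmetric]
      by (rule gen[OF core])
  qed
  finally show ?thesis unfolding sol_def .
qed

text \<open>
  The variable \<open>x\<close> is \<open>fls_X\<close> for the expansions at \<open>0\<close> and \<open>fls_X_inv\<close> for those at infinity.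
\<close>
definition pole_factor :: "complex fls \<Rightarrow> nat \<Rightarrow> complex fls" where
  "pole_factor x M = (\<Prod>i<M. 1 - fls_const (a * b / c * q ^ i) * x)"

text \<open>
  The Casoratian is linear in the pair \<open>(S1, S2)\<close>, with fixed series \<open>T1\<close>, \<open>T2\<close>, and so inherits the
  contiguous relations of the solutions. The sign \<open>\<epsilon>\<close> distinguishes series in \<open>x\<close> from series in \<open>1/x\<close>.
\<close>
lemma casoratian_contiguous:
  fixes S1 S2 :: "int \<Rightarrow> int \<Rightarrow> int \<Rightarrow> complex fls" and T1 T2 x :: "complex fls"
  assumes \<epsilon>: "\<epsilon> * \<epsilon> = 1" and x: "x = fls_X_intpow \<epsilon>"
    and z: "admissible z1" "admissible z2"
    and S: "\<And>k l m j. S1 k l m $$ (\<epsilon> * j) = sol z1 k l m j" "\<And>k l m j. S2 k l m $$ (\<epsilon> * j) = sol z2 k l m j"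
  shows "contiguous (\<lambda>k l m n. (pole_factor x (nat (k + l - m))
           * (S1 k l m * T2 - S2 k l m * T1)) $$ (\<epsilon> * n))"
proof -
  define P where "P k l m = S1 k l m * T2 - S2 k l m * T1" for k l m
  have all_index: "(\<And>j. F $$ (\<epsilon> * j) = 0) \<Longrightarrow> F = 0" for F :: "complex fls"
  proof (rule fls_eqI)
    fix i
    assume "\<And>j. F $$ (\<epsilon> * j) = 0"
    from this[of "\<epsilon> * i"] show "F $$ i = 0 $$ i"
      using \<epsilon> by (simp add: mult.assoc[symmetric])
  qed
  have x_nth: "(x * F) $$ (\<epsilon> * j) = F $$ (\<epsilon> * (j - 1))" for F :: "complex fls" and j
    unfolding x by (simp add: fls_X_intpow_times_conv_shift algebra_simps)
  have L1: "fls_const ((b * q powi l - c * q powi (m - 1)) * (1 - a * q powi k)) * S (k + 1) l m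
       + fls_const ((c * q powi (m - 1) - a * q powi k) * (1 - b * q powi l)) * S k (l + 1) m
       + fls_const ((a * q powi k - b * q powi l) * (1 - c * q powi (m - 1))) * S k l (m - 1) = 0"
    if "\<And>k l m j. S k l m $$ (\<epsilon> * j) = sol z k l m j" "admissible z"
    for S :: "int \<Rightarrow> int \<Rightarrow> int \<Rightarrow> complex fls" and z k l m
    by (rule all_index) (use sol_up_simplex(1)[OF that(2)] in \<open>simp add: that(1)\<close>)
  have L2: "fls_const (1 - c * q powi m) * (S k (l - 1) m - S (k - 1) l m)
       - fls_const (a * q powi (k - 1) - b * q powi (l - 1)) * (x * S k l (m + 1)) = 0"
    if "\<And>k l m j. S k l m $$ (\<epsilon> * j) = sol z k l m j" "admissible z"
    for S :: "int \<Rightarrow> int \<Rightarrow> int \<Rightarrow> complex fls" and z k l m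
    by (rule all_index) (use sol_down_simplex(1)[OF that(2)] in \<open>simp add: that(1) x_nth\<close>)
  have L3: "fls_const (b * q powi l * (1 - a * q powi k)) * S (k + 1) l m
       - fls_const (a * q powi k * (1 - b * q powi l)) * S k (l + 1) m
       - fls_const (b * q powi l - a * q powi k) * S k l m = 0"
    if "\<And>k l m j. S k l m $$ (\<epsilon> * j) = sol z k l m j" "admissible z"
    for S :: "int \<Rightarrow> int \<Rightarrow> int \<Rightarrow> complex fls" and z k l m
    by (rule all_index) (use sol_up_simplex(2)[OF that(2)] in \<open>simp add: that(1)\<close>)
  have L4: "fls_const (a * q powi (k - 1) - b * q powi (l - 1))
         * ((1 - fls_const (a * q powi (k - 1) * (b * q powi (l - 1)) / (c * q powi (m - 1))) * x) * S k l m)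
       - fls_const (a * q powi (k - 1) * (1 - b * q powi (l - 1) / (c * q powi (m - 1)))) * S k (l - 1) m
       + fls_const (b * q powi (l - 1) * (1 - a * q powi (k - 1) / (c * q powi (m - 1)))) * S (k - 1) l m = 0"
    if "\<And>k l m j. S k l m $$ (\<epsilon> * j) = sol z k l m j" "admissible z"
    for S :: "int \<Rightarrow> int \<Rightarrow> int \<Rightarrow> complex fls" and z k l m
  proof (rule all_index)
    fix j
    show "(fls_const (a * q powi (k - 1) - b * q powi (l - 1))
         * ((1 - fls_const (a * q powi (k - 1) * (b * q powi (l - 1)) / (c * q powi (m - 1))) * x) * S k l m)
       - fls_const (a * q powi (k - 1) * (1 - b * q powi (l - 1) / (c * q powi (m - 1)))) * S k (l - 1) m
       + fls_const (b * q powi (l - 1) * (1 - a * q powi (k - 1) / (c * q powi (m - 1)))) * S (k - 1) l m)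
       $$ (\<epsilon> * j) = 0"
      using sol_down_simplex(2)[OF that(2), of k l m j]
      by (simp add: left_diff_distrib[of 1] mult.assoc[of "fls_const _" x] x_nth that(1))
  qed
  have PL: "u1 * P k1 l1 m1 + u2 * P k2 l2 m2 + u3 * P k3 l3 m3 = 0"
    if "u1 * S1 k1 l1 m1 + u2 * S1 k2 l2 m2 + u3 * S1 k3 l3 m3 = 0"
       "u1 * S2 k1 l1 m1 + u2 * S2 k2 l2 m2 + u3 * S2 k3 l3 m3 = 0"
    for u1 u2 u3 k1 l1 m1 k2 l2 m2 k3 l3 m3
  proof -
    have "u1 * P k1 l1 m1 + u2 * P k2 l2 m2 + u3 * P k3 l3 m3
      = (u1 * S1 k1 l1 m1 + u2 * S1 k2 l2 m2 + u3 * S1 k3 l3 m3) * T2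
      - (u1 * S2 k1 l1 m1 + u2 * S2 k2 l2 m2 + u3 * S2 k3 l3 m3) * T1"
      unfolding P_def by (simp add: algebra_simps)
    thus ?thesis using that by simp
  qed
  have PF: "pole_factor x 0 = 1"
    "pole_factor x (Suc N) = pole_factor x N * (1 - fls_const (a * b / c * q ^ N) * x)" for N
    by (simp_all add: pole_factor_def)
  show ?thesis
    unfolding contiguous_def P_def[symmetric]
  proof (intro conjI allI impI, goal_cases)
    case (1 k l m n)
    have e: "nat (k + 1 + l - m) = 0" "nat (k + (l + 1) - m) = 0" "nat (k + l - (m - 1)) = 0"
      using 1 by simp_all
    have "fls_const ((b * q powi l - c * q powi (m - 1)) * (1 - a * q powi k)) * P (k + 1) l m
       + fls_const ((c * q powi (m - 1) - a * q powi k) * (1 - b * q powi l)) * P k (l + 1) m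
       + fls_const ((a * q powi k - b * q powi l) * (1 - c * q powi (m - 1))) * P k l (m - 1) = 0"
      by (rule PL[OF L1[OF S(1) z(1)] L1[OF S(2) z(2)]])
    from arg_cong[OF this, of "\<lambda>f. f $$ (\<epsilon> * n)"] show ?case
      unfolding e PF mult_1_left by simp
  next
    case (2 k l m n)
    have e: "nat (k - 1 + l - m) = 0" "nat (k + (l - 1) - m) = 0" "nat (k + l - (m + 1)) = 0"
      using 2 by simp_all
    have "fls_const (1 - c * q powi m) * P k (l - 1) m + (- fls_const (1 - c * q powi m)) * P (k - 1) l m
       + (- (fls_const (a * q powi (k - 1) - b * q powi (l - 1)) * x)) * P k l (m + 1) = 0"
      by (rule PL; use L2[OF S(1) z(1), of m k l] L2[OF S(2) z(2), of m k l]
        in \<open>simp add: algebra_simps\<close>)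
    from arg_cong[OF this, of "\<lambda>f. f $$ (\<epsilon> * n)"] show ?case
      unfolding e PF mult_1_left by (simp add: mult.assoc x_nth right_diff_distrib)
  next
    case (3 k l m n)
    have e: "nat (k + 1 + l - m) = 0" "nat (k + (l + 1) - m) = 0" "nat (k + l - m) = 0"
      using 3 by simp_all
    have "fls_const (b * q powi l * (1 - a * q powi k)) * P (k + 1) l m
       + (- fls_const (a * q powi k * (1 - b * q powi l))) * P k (l + 1) m
       + (- fls_const (b * q powi l - a * q powi k)) * P k l m = 0"
      by (rule PL; use L3[OF S(1) z(1), of l k m] L3[OF S(2) z(2), of l k m] in simp)
    from arg_cong[OF this, of "\<lambda>f. f $$ (\<epsilon> * n)"] show ?case
      unfolding e PF mult_1_left by simp
  next
    case (4 k l m n)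
    define N where "N = nat (k + l - m - 1)"
    have e: "nat (k - 1 + l - m) = N" "nat (k + (l - 1) - m) = N" "nat (k + l - m) = Suc N"
      using 4 by (simp_all add: N_def)
    have "a * q powi (k - 1) * (b * q powi (l - 1)) / (c * q powi (m - 1))
        = a * b / c * q powi (k - 1 + (l - 1) - (m - 1))"
      by (simp add: power_int_add power_int_diff mult_ac)
    also have "k - 1 + (l - 1) - (m - 1) = int N" using 4 by (simp add: N_def)
    finally have u: "a * q powi (k - 1) * (b * q powi (l - 1)) / (c * q powi (m - 1)) = a * b / c * q ^ N"
      by simp
    define y where "y = 1 - fls_const (a * b / c * q ^ N) * x"
    have "(fls_const (a * q powi (k - 1) - b * q powi (l - 1)) * y) * P k l m
       + (- fls_const (a * q powi (k - 1) * (1 - b * q powi (l - 1) / (c * q powi (m - 1))))) * P k (l - 1) m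
       + fls_const (b * q powi (l - 1) * (1 - a * q powi (k - 1) / (c * q powi (m - 1)))) * P (k - 1) l m = 0"
      unfolding y_def u[symmetric]
      by (rule PL; use L4[OF S(1) z(1), of k l m] L4[OF S(2) z(2), of k l m] in \<open>simp add: mult.assoc\<close>)
    hence "pole_factor x N * ((fls_const (a * q powi (k - 1) - b * q powi (l - 1)) * y) * P k l m
       + (- fls_const (a * q powi (k - 1) * (1 - b * q powi (l - 1) / (c * q powi (m - 1))))) * P k (l - 1) m
       + fls_const (b * q powi (l - 1) * (1 - a * q powi (k - 1) / (c * q powi (m - 1)))) * P (k - 1) l m) = 0"
      by simp
    hence "fls_const (a * q powi (k - 1) - b * q powi (l - 1)) * (pole_factor x N * y * P k l m)
       - fls_const (a * q powi (k - 1) * (1 - b * q powi (l - 1) / (c * q powi (m - 1)))) * (pole_factor x N * P k (l - 1) m)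
       + fls_const (b * q powi (l - 1) * (1 - a * q powi (k - 1) / (c * q powi (m - 1)))) * (pole_factor x N * P (k - 1) l m) = 0"
      by (simp add: algebra_simps)
    from arg_cong[OF this, of "\<lambda>f. f $$ (\<epsilon> * n)"] show ?case
      unfolding e PF y_def by (simp add: mult.assoc eq_diff_eq diff_add_eq)
  qed
qed

section \<open>The Casoratians at zero and at infinity\<close>

text \<open>
  The symmetry \<open>(a, k) \<leftrightarrow> (b, l)\<close> supplies the second solution at infinity and every fact about it.
\<close>
lemma swapped: "hyp_params q b a c"
  by unfold_locales (use a_qZ b_qZ c_qZ ca_qZ cb_qZ quotient_qZ in auto)

abbreviation inf_series' :: "int \<Rightarrow> int \<Rightarrow> int \<Rightarrow> complex fls" where
  "inf_series' k l m \<equiv> hyp_params.inf_series q b a c l k m"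

abbreviation inf_lead' :: "int \<Rightarrow> int \<Rightarrow> int \<Rightarrow> complex" where
  "inf_lead' k l m \<equiv> hyp_params.inf_lead q b a c l k m"

lemma inf_series'_nth: "inf_series' k l m $$ j = sol (1 / b) k l m (- j)"
proof -
  interpret swap: hyp_params q b a c by (rule swapped)
  show ?thesis unfolding swap.inf_series_nth swap.sol_def sol_def by (simp only: mult_ac)
qed

lemma inf_series'_eq:
  "inf_series' k l m = fls_const (inf_lead' k l m) * fls_shift (- l) (fps_to_fls
     (phi21 (b * q powi l) (b * q powi (l - m + 1) / c) (b * q powi (l - k + 1) / a)
       (c * q powi (m - k - l + 1) / (a * b))))"
proof -
  interpret swap: hyp_params q b a c by (rule swapped)
  have "m - l - k + 1 = m - k - l + 1" by simp
  thus ?thesis unfolding swap.inf_series_def by (simp only: mult.commute[of b a])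
qed

lemma admissible_b: "admissible (1 / b)"
proof -
  interpret swap: hyp_params q b a c by (rule swapped)
  show ?thesis using swap.admissible_a unfolding swap.admissible_def admissible_def by blast
qed

lemma inf_lead_0 [simp]: "inf_lead 0 0 0 = 1" "inf_lead' 0 0 0 = 1"
proof -
  interpret swap: hyp_params q b a c by (rule swapped)
  show "inf_lead 0 0 0 = 1" "inf_lead' 0 0 0 = 1" by (simp_all add: inf_lead_def swap.inf_lead_def)
qed

lemma zero_lead2_0 [simp]: "zero_lead2 0 0 0 = 1"
  by (simp add: zero_lead2_def)

lemma c_pow_ne_1: "v \<notin> qZ q \<Longrightarrow> v * q ^ n \<noteq> 1"
  using qZ_mult_ne_1[of v "int n"] by simp

text \<open>
  In this and the following two lemmas the first factor is the same for the two solutions at one point: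
  it depends only on \<open>k + l - m\<close>.
\<close>
lemma euler_zero1:
  "phi21 (a * q powi k) (b * q powi l) (c * q powi m) 1
   = binom_series (a * b / c * q powi (k + l - m)) 1
     * phi21 (c * q powi (m - k) / a) (c * q powi (m - l) / b) (c * q powi m) (a * b / c * q powi (k + l - m))"
proof -
  have e: "c * q powi (m - k) / a = c * q powi m / (a * q powi k)"
    "c * q powi (m - l) / b = c * q powi m / (b * q powi l)"
    "a * b / c * q powi (k + l - m) = a * b / c * q powi (k + l - m) * 1"
    by (simp_all add: power_int_diff)
  show ?thesis
    unfolding e(1,2) by (subst (2) e(3), rule euler_transformation)
      (use c_pow_ne_1[of "c * q powi m"] c_qZ in \<open>auto simp: power_int_diff q_powi_add\<close>)
qed

lemma euler_zero2:
  "phi21 (a * q powi (k - m + 1) / c) (b * q powi (l - m + 1) / c) (q powi (2 - m) / c) 1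
   = binom_series (a * b / c * q powi (k + l - m)) 1
     * phi21 (q powi (1 - k) / a) (q powi (1 - l) / b) (q powi (2 - m) / c) (a * b / c * q powi (k + l - m))"
proof -
  have e: "q powi (1 - k) / a = q powi (2 - m) / c / (a * q powi (k - m + 1) / c)"
    "q powi (1 - l) / b = q powi (2 - m) / c / (b * q powi (l - m + 1) / c)"
    "a * b / c * q powi (k + l - m) = a * b / c * q powi (k + l - m) * 1"
    by (simp_all add: power_int_diff q_powi_add power2_eq_square field_simps)
  have "q powi (2 - m) / c \<notin> qZ q" using scaled_qZ[OF quotient_qZ(6), of _ "2 - m"] by simp
  thus ?thesis
    unfolding e(1,2) by (subst (2) e(3), intro euler_transformation)
      (use c_pow_ne_1[of "q powi (2 - m) / c"]
       in \<open>auto simp: power_int_diff q_powi_add power2_eq_square field_simps\<close>)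
qed

lemma euler_inf:
  "phi21 (a * q powi k) (a * q powi (k - m + 1) / c) (a * q powi (k - l + 1) / b) (c * q powi (m - k - l + 1) / (a * b))
   = binom_series (a * b / c * q powi (k + l - m)) (q / (a * b / c * q powi (k + l - m)))
     * phi21 (q powi (1 - l) / b) (c * q powi (m - l) / b) (a * q powi (k - l + 1) / b) q"
proof -
  define \<alpha> \<beta> \<gamma> where "\<alpha> = a * q powi k" "\<beta> = a * q powi (k - m + 1) / c" "\<gamma> = a * q powi (k - l + 1) / b"
  note d = this
  have e: "q powi (1 - l) / b = \<gamma> / \<alpha>" "c * q powi (m - l) / b = \<gamma> / \<beta>"
    "c * q powi (m - k - l + 1) / (a * b) = q / (a * b / c * q powi (k + l - m))"
    by (simp_all add: d power_int_diff q_powi_add field_simps)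
  have q: "q = a * b / c * q powi (k + l - m) * (q / (a * b / c * q powi (k + l - m)))" by simp
  have "\<gamma> \<notin> qZ q" using scaled_qZ[OF ab_qZ, of _ "k - l + 1"] by (simp add: d)
  hence "phi21 \<alpha> \<beta> \<gamma> (q / (a * b / c * q powi (k + l - m)))
   = binom_series (a * b / c * q powi (k + l - m)) (q / (a * b / c * q powi (k + l - m)))
     * phi21 (\<gamma> / \<alpha>) (\<gamma> / \<beta>) \<gamma> (a * b / c * q powi (k + l - m) * (q / (a * b / c * q powi (k + l - m))))"
    by (intro euler_transformation)
      (use c_pow_ne_1[of \<gamma>] in \<open>auto simp: d power_int_diff q_powi_add field_simps\<close>)
  thus ?thesis unfolding e d(3)[symmetric] d(1)[symmetric] d(2)[symmetric] q[symmetric] .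
qed

text \<open>
  The relation \<open>(1 - a) F(a q) = (1 - a T) F\<close>, for the whole series.
\<close>
lemma casoratian_base:
  fixes S :: "int \<Rightarrow> int \<Rightarrow> int \<Rightarrow> complex fls"
  assumes \<epsilon>: "\<epsilon> * \<epsilon> = 1" and "admissible z"
    and S: "\<And>k l m j. S k l m $$ (\<epsilon> * j) = sol z k l m j" and S0: "S 0 0 0 = fps_to_fls \<phi>"
  shows "fls_const (1 - a) * S 1 0 0
    = fps_to_fls (\<phi> - fps_const (a * z) * dilate (q powi \<epsilon>) \<phi>)"
proof (rule fls_eqI)
  fix i
  have i: "\<epsilon> * (\<epsilon> * i) = i" using \<epsilon> by (simp add: mult.assoc[symmetric])
  have "(fls_const (1 - a) * S 1 0 0) $$ i = (1 - a) * sol z 1 0 0 (\<epsilon> * i)"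
    using S[of 1 0 0 "\<epsilon> * i"] i by simp
  also have "\<dots> = (1 - a * (z * q powi (\<epsilon> * i))) * S 0 0 0 $$ i"
    using sol_up(1)[OF assms(2), of 0 0 0 "\<epsilon> * i"] S[of 0 0 0 "\<epsilon> * i"] i by simp
  also have "\<dots> = fps_to_fls (\<phi> - fps_const (a * z) * dilate (q powi \<epsilon>) \<phi>) $$ i"
  proof (cases "i < 0")
    case False
    hence "q powi (\<epsilon> * i) = (q powi \<epsilon>) ^ nat i"
      by (metis int_nat_eq not_less power_int_mult power_int_of_nat)
    thus ?thesis using False by (simp add: S0 algebra_simps)
  qed (simp add: S0)
  finally show "(fls_const (1 - a) * S 1 0 0) $$ i
      = fps_to_fls (\<phi> - fps_const (a * z) * dilate (q powi \<epsilon>) \<phi>) $$ i" .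
qed

text \<open>
  The solutions \<open>\<phi>\<^sub>i\<close> have the common factor \<open>E\<close>, which makes the Casoratian at \<open>(0, 0, 0)\<close> vanish and
  leaves only the term with the dilation at \<open>(1, 0, 0)\<close>.
\<close>
lemma casoratian_initial:
  fixes S1 S2 :: "int \<Rightarrow> int \<Rightarrow> int \<Rightarrow> complex fls"
  assumes \<epsilon>: "\<epsilon> * \<epsilon> = 1" and z: "admissible z1" "admissible z2"
    and S: "\<And>k l m j. S1 k l m $$ (\<epsilon> * j) = sol z1 k l m j" "\<And>k l m j. S2 k l m $$ (\<epsilon> * j) = sol z2 k l m j"
    and S0: "S1 0 0 0 = fps_to_fls \<phi>1" "S2 0 0 0 = fps_to_fls \<phi>2"
    and \<phi>: "\<phi>1 = E * \<psi>1" "\<phi>2 = E * \<psi>2"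
  shows "S1 0 0 0 * fps_to_fls \<psi>2 - S2 0 0 0 * fps_to_fls \<psi>1 = 0"
    and "fls_const (1 - a) * (S1 1 0 0 * fps_to_fls \<psi>2 - S2 1 0 0 * fps_to_fls \<psi>1)
       = fps_to_fls (fps_const (- a) * (fps_const z1 * dilate (q powi \<epsilon>) \<phi>1 * \<psi>2
           - fps_const z2 * dilate (q powi \<epsilon>) \<phi>2 * \<psi>1))"
proof -
  show "S1 0 0 0 * fps_to_fls \<psi>2 - S2 0 0 0 * fps_to_fls \<psi>1 = 0"
    unfolding S0 \<phi> fls_times_fps_to_fls by (simp add: mult_ac)
  have "fls_const (1 - a) * (S1 1 0 0 * fps_to_fls \<psi>2 - S2 1 0 0 * fps_to_fls \<psi>1)
      = (fls_const (1 - a) * S1 1 0 0) * fps_to_fls \<psi>2 - (fls_const (1 - a) * S2 1 0 0) * fps_to_fls \<psi>1"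
    by (simp only: right_diff_distrib mult.assoc)
  also have "\<dots> = fps_to_fls ((\<phi>1 - fps_const (a * z1) * dilate (q powi \<epsilon>) \<phi>1) * \<psi>2
      - (\<phi>2 - fps_const (a * z2) * dilate (q powi \<epsilon>) \<phi>2) * \<psi>1)"
    unfolding casoratian_base[OF \<epsilon> z(1) S(1) S0(1)] casoratian_base[OF \<epsilon> z(2) S(2) S0(2)]
    by (simp add: fls_times_fps_to_fls)
  also have "(\<phi>1 - fps_const (a * z1) * dilate (q powi \<epsilon>) \<phi>1) * \<psi>2
      - (\<phi>2 - fps_const (a * z2) * dilate (q powi \<epsilon>) \<phi>2) * \<psi>1
      = (\<phi>1 * \<psi>2 - \<phi>2 * \<psi>1) + fps_const (- a) * (fps_const z1 * dilate (q powi \<epsilon>) \<phi>1 * \<psi>2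
           - fps_const z2 * dilate (q powi \<epsilon>) \<phi>2 * \<psi>1)"
    by (simp add: algebra_simps fps_const_mult[symmetric] fps_const_neg[symmetric]
        del: fps_const_mult fps_const_neg)
  also have "\<phi>1 * \<psi>2 - \<phi>2 * \<psi>1 = 0" unfolding \<phi> by (simp add: mult_ac)
  finally show "fls_const (1 - a) * (S1 1 0 0 * fps_to_fls \<psi>2 - S2 1 0 0 * fps_to_fls \<psi>1)
       = fps_to_fls (fps_const (- a) * (fps_const z1 * dilate (q powi \<epsilon>) \<phi>1 * \<psi>2
           - fps_const z2 * dilate (q powi \<epsilon>) \<phi>2 * \<psi>1))" by simp
qed

text \<open>
  The series of the parameters \<open>(0, 0, 0)\<close> are divided by the factor from Euler's transformation. That
  factor differs at zero and at infinity; without it the initial values would not be monomials.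
\<close>
definition zero_casoratian :: "int \<Rightarrow> int \<Rightarrow> int \<Rightarrow> complex fls" where
  "zero_casoratian k l m = pole_factor fls_X (nat (k + l - m))
     * (zero_series1 k l m * fps_to_fls (phi21 (q / a) (q / b) (q\<^sup>2 / c) (a * b / c))
      - zero_series2 k l m * fps_to_fls (phi21 (c / a) (c / b) c (a * b / c)))"

definition inf_casoratian :: "int \<Rightarrow> int \<Rightarrow> int \<Rightarrow> complex fls" where
  "inf_casoratian k l m = pole_factor fls_X_inv (nat (k + l - m))
     * (inf_series k l m * fps_to_fls (phi21 (q / a) (c / a) (b * q / a) q)
      - inf_series' k l m * fps_to_fls (phi21 (q / b) (c / b) (a * q / b) q))"

lemma zero_casoratian_contiguous: "contiguous (\<lambda>k l m n. zero_casoratian k l m $$ n)"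
  using casoratian_contiguous[of 1 fls_X 1 "q / c" zero_series1 zero_series2]
  unfolding zero_casoratian_def
  by (simp add: admissible_1 admissible_c zero_series1_nth zero_series2_nth fls_X_conv_shift_1)

lemma inf_casoratian_contiguous: "contiguous (\<lambda>k l m n. inf_casoratian k l m $$ (- n))"
  using casoratian_contiguous[of "- 1" fls_X_inv "1 / a" "1 / b" inf_series inf_series']
  unfolding inf_casoratian_def
  by (simp add: admissible_a admissible_b inf_series_nth inf_series'_nth fls_X_inv_conv_shift_1)

lemma pole_factor_0: "pole_factor x 0 = 1"
  and pole_factor_1: "pole_factor x (Suc 0) = 1 - fls_const (a * b / c) * x"
  by (simp_all add: pole_factor_def)

lemma one_minus_a: "1 - a \<noteq> 0"
  using qZ_mult_ne_1[OF a_qZ, of 0] by simp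

text \<open>
  The \<open>q\<close>-difference equation at \<open>0\<close>, with \<open>z\<close> equal to \<open>1\<close> and \<open>q/c\<close>, in the form required by \<open>casoratian_const\<close>.
\<close>
lemma zero_casoratian_initial:
  "zero_casoratian 0 0 0 = 0"
  "fls_const (1 - a) * zero_casoratian 1 0 0 = fls_const (- a * (1 - q / c))"
proof -
  define \<phi>1 \<phi>2 \<psi>1 \<psi>2 E where
    "\<phi>1 = phi21 a b c 1" "\<phi>2 = phi21 (a * q / c) (b * q / c) (q\<^sup>2 / c) 1"
    "\<psi>1 = phi21 (c / a) (c / b) c (a * b / c)" "\<psi>2 = phi21 (q / a) (q / b) (q\<^sup>2 / c) (a * b / c)"
    "E = binom_series (a * b / c) 1"
  note d = this
  have \<phi>: "\<phi>1 = E * \<psi>1" "\<phi>2 = E * \<psi>2"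
    using euler_zero1[of 0 0 0] euler_zero2[of 0 0 0] by (simp_all add: d)
  have S0: "zero_series1 0 0 0 = fps_to_fls \<phi>1" "zero_series2 0 0 0 = fps_to_fls \<phi>2"
    by (simp_all add: zero_series1_def zero_series2_def d)
  note init = casoratian_initial[of 1 1 "q / c" zero_series1 zero_series2, OF _ admissible_1 admissible_c
      _ _ S0 \<phi>, simplified, OF zero_series1_nth zero_series2_nth]
  show "zero_casoratian 0 0 0 = 0"
    using init(1) by (simp add: zero_casoratian_def pole_factor_0 d)
  have eq1: "\<phi>1 - fps_const ((1 + c / q) * 1) * dilate q \<phi>1 + fps_const ((c / q) * 1\<^sup>2) * dilate q (dilate q \<phi>1)
    = fps_X * (\<phi>1 - fps_const ((a + b) * 1) * dilate q \<phi>1 + fps_const ((a * b) * 1\<^sup>2) * dilate q (dilate q \<phi>1))"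
    using hypergeometric_rec_iff[of c \<phi>1 1 a b] phi21_Suc[OF c_pow_ne_1[OF c_qZ]] by (simp add: d)
  have qc: "q\<^sup>2 / c \<notin> qZ q" using scaled_qZ[OF quotient_qZ(6), of _ 2] by simp
  have e: "1 + q\<^sup>2 / c / q = (1 + c / q) * (q / c)" "q\<^sup>2 / c / q = (c / q) * (q / c)\<^sup>2"
    "a * q / c + b * q / c = (a + b) * (q / c)" "a * q / c * (b * q / c) = (a * b) * (q / c)\<^sup>2"
    by (simp_all add: field_simps power2_eq_square)
  have eq2: "\<phi>2 - fps_const ((1 + c / q) * (q / c)) * dilate q \<phi>2 + fps_const ((c / q) * (q / c)\<^sup>2) * dilate q (dilate q \<phi>2)
    = fps_X * (\<phi>2 - fps_const ((a + b) * (q / c)) * dilate q \<phi>2 + fps_const ((a * b) * (q / c)\<^sup>2) * dilate q (dilate q \<phi>2))"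
    unfolding e[symmetric]
    using hypergeometric_rec_iff[of "q\<^sup>2 / c" \<phi>2 1 "a * q / c" "b * q / c"] phi21_Suc[OF c_pow_ne_1[OF qc]]
    by (simp add: d)
  have "(1 - fps_const (a * b / c) * fps_X) * (fps_const 1 * dilate q \<phi>1 * \<psi>2 - fps_const (q / c) * dilate q \<phi>2 * \<psi>1)
      = fps_const (1 - q / c)"
    by (rule casoratian_const[OF \<phi> _ _ _ _ eq1 eq2])
      (use binom_series_dilate[of 1 "a * b / c"] q_pow_ne_1 in \<open>simp_all add: d\<close>)
  hence "(1 - fps_const (a * b / c) * fps_X) * (fps_const (- a) * (fps_const 1 * dilate q \<phi>1 * \<psi>2
      - fps_const (q / c) * dilate q \<phi>2 * \<psi>1)) = fps_const (- a) * fps_const (1 - q / c)"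
    by (simp only: mult.left_commute[of _ "fps_const (- a)"])
  moreover have "fls_const (1 - a) * zero_casoratian 1 0 0
      = (1 - fls_const (a * b / c) * fls_X) * fps_to_fls (fps_const (- a) * (fps_const 1 * dilate q \<phi>1 * \<psi>2
          - fps_const (q / c) * dilate q \<phi>2 * \<psi>1))"
    using init(2) unfolding zero_casoratian_def
    by (simp add: pole_factor_1 d mult.left_commute[of "fls_const (1 - a)"])
  moreover have "1 - fls_const (a * b / c) * fls_X = fps_to_fls (1 - fps_const (a * b / c) * fps_X)"
    by (simp add: fls_times_fps_to_fls)
  ultimately have "fls_const (1 - a) * zero_casoratian 1 0 0 = fps_to_fls (fps_const (- a) * fps_const (1 - q / c))"
    by (simp only: fls_times_fps_to_fls[symmetric])
  thus "fls_const (1 - a) * zero_casoratian 1 0 0 = fls_const (- a * (1 - q / c))" by simp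
qed

text \<open>
  The same argument in the variable \<open>1/x\<close>, with the dilation by \<open>1/q\<close>. The pole factor
  \<open>1 - u x\<close> is \<open>- u x (1 - 1/(u x))\<close>, which accounts for the power of \<open>x\<close>.
\<close>
lemma inf_casoratian_initial:
  "inf_casoratian 0 0 0 = 0"
  "fls_const (1 - a) * inf_casoratian 1 0 0 = fls_const (b - a) * fls_const (a / c) * fls_X_inv"
proof -
  \<comment> \<open>The argument of both solutions is \<open>q/(u x)\<close>.\<close>
  define u where "u = a * b / c"
  have u: "u \<noteq> 0" by (simp add: u_def)
  define \<phi>1 \<phi>2 \<psi>1 \<psi>2 E where
    "\<phi>1 = phi21 a (a * q / c) (a * q / b) (q / u)" "\<phi>2 = phi21 b (b * q / c) (b * q / a) (q / u)"
    "\<psi>1 = phi21 (q / b) (c / b) (a * q / b) q" "\<psi>2 = phi21 (q / a) (c / a) (b * q / a) q"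
    "E = binom_series u (q / u)"
  note d = this
  interpret swap: hyp_params q b a c by (rule swapped)
  have \<phi>: "\<phi>1 = E * \<psi>1" "\<phi>2 = E * \<psi>2"
    using euler_inf[of 0 0 0] swap.euler_inf[of 0 0 0] by (simp_all add: d u_def mult_ac)
  have S0: "inf_series 0 0 0 = fps_to_fls \<phi>1" "inf_series' 0 0 0 = fps_to_fls \<phi>2"
    unfolding inf_series'_eq by (simp_all add: inf_series_def d u_def mult_ac)
  note init = casoratian_initial[of "-1" "1 / a" "1 / b" inf_series inf_series', OF _ admissible_a admissible_b
      _ _ S0 \<phi>, simplified, OF inf_series_nth[of _ _ _ "- _", simplified] inf_series'_nth[of _ _ _ "- _", simplified]]
  show "inf_casoratian 0 0 0 = 0"
    using init(1) by (simp add: inf_casoratian_def pole_factor_0 d)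
  have qz: "a * q / b \<notin> qZ q" "b * q / a \<notin> qZ q"
    using scaled_qZ[OF ab_qZ, of _ 1] scaled_qZ[OF quotient_qZ(3), of _ 1] by simp_all
  have e1: "1 + q / (a * q / b) = (a + b) * (1 / a)" "q / (a * q / b) = (a * b) * (1 / a)\<^sup>2"
    "1 / a + 1 / (a * q / c) = (1 + c / q) * (1 / a)" "1 / (a * (a * q / c)) = (c / q) * (1 / a)\<^sup>2"
    by (simp_all add: field_simps power2_eq_square)
  have eq1: "\<phi>1 - fps_const ((a + b) * (1 / a)) * dilate (1 / q) \<phi>1 + fps_const ((a * b) * (1 / a)\<^sup>2) * dilate (1 / q) (dilate (1 / q) \<phi>1)
    = fps_X * (\<phi>1 - fps_const ((1 + c / q) * (1 / a)) * dilate (1 / q) \<phi>1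
        + fps_const ((c / q) * (1 / a)\<^sup>2) * dilate (1 / q) (dilate (1 / q) \<phi>1))"
    unfolding e1[symmetric]
    by (rule hypergeometric_eq_inverse[OF hypergeometric_rec_iff[THEN iffD1], of "a * q / b" \<phi>1 "q / u" a "a * q / c"])
      (use phi21_Suc[OF c_pow_ne_1[OF qz(1)]] in \<open>auto simp: d u_def\<close>)
  have e2: "1 + q / (b * q / a) = (a + b) * (1 / b)" "q / (b * q / a) = (a * b) * (1 / b)\<^sup>2"
    "1 / b + 1 / (b * q / c) = (1 + c / q) * (1 / b)" "1 / (b * (b * q / c)) = (c / q) * (1 / b)\<^sup>2"
    by (simp_all add: field_simps power2_eq_square)
  have eq2: "\<phi>2 - fps_const ((a + b) * (1 / b)) * dilate (1 / q) \<phi>2 + fps_const ((a * b) * (1 / b)\<^sup>2) * dilate (1 / q) (dilate (1 / q) \<phi>2)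
    = fps_X * (\<phi>2 - fps_const ((1 + c / q) * (1 / b)) * dilate (1 / q) \<phi>2
        + fps_const ((c / q) * (1 / b)\<^sup>2) * dilate (1 / q) (dilate (1 / q) \<phi>2))"
    unfolding e2[symmetric]
    by (rule hypergeometric_eq_inverse[OF hypergeometric_rec_iff[THEN iffD1], of "b * q / a" \<phi>2 "q / u" b "b * q / c"])
      (use phi21_Suc[OF c_pow_ne_1[OF qz(2)]] in \<open>auto simp: d u_def\<close>)
  have "dilate (1 / q) ((1 - fps_const (q / u) * fps_X) * E)
      = dilate (1 / q) ((1 - fps_const (u * (q / u)) * fps_X) * dilate q E)"
    unfolding d by (simp only: binom_series_dilate)
  \<comment> \<open>The functional equation of \<open>E\<close>, dilated back by \<open>1/q\<close>.\<close>
  hence E: "(1 - fps_const (1 / u) * fps_X) * dilate (1 / q) E = (1 - fps_X) * E"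
    using u by (simp add: dilate_simps mult.assoc[symmetric])
  define W where "W = fps_const (1 / a) * dilate (1 / q) \<phi>1 * \<psi>2 - fps_const (1 / b) * dilate (1 / q) \<phi>2 * \<psi>1"
  have W: "(1 - fps_const (1 / u) * fps_X) * W = fps_const (1 / a - 1 / b)"
    unfolding W_def
    by (rule casoratian_const[OF \<phi> _ _ _ E eq1 eq2])
      (use q_pow_inverse_ne_1 in \<open>simp_all add: d u_def\<close>)
  have pole: "1 - fls_const u * fls_X_inv
      = fls_const (- u) * fls_X_inv * fps_to_fls (1 - fps_const (1 / u) * fps_X)"
  proof -
    have "fls_const (- u) * fls_X_inv * fps_to_fls (1 - fps_const (1 / u) * fps_X)
        = fls_const (- u) * fls_X_inv + (fls_const u * fls_const (1 / u)) * (fls_X_inv * fls_X)"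
      by (simp add: fls_times_fps_to_fls algebra_simps)
    moreover have "fls_X_inv * fls_X = (1 :: complex fls)"
      by (simp add: fls_X_inv_times_conv_shift fls_X_conv_shift_1)
    ultimately show ?thesis using u by simp
  qed
  have "fls_const (1 - a) * inf_casoratian 1 0 0
      = (1 - fls_const u * fls_X_inv) * fps_to_fls (fps_const (- a) * W)"
    using init(2) unfolding inf_casoratian_def W_def
    by (simp add: pole_factor_1 d u_def mult.left_commute[of "fls_const (1 - a)"] power_int_minus divide_inverse)
  also have "\<dots> = fls_const (- u) * fls_X_inv * fps_to_fls (fps_const (- a) * ((1 - fps_const (1 / u) * fps_X) * W))"
    unfolding pole mult.assoc fls_times_fps_to_fls[symmetric]
    by (simp only: mult.left_commute[of _ "fps_const (- a)"])
  also have "\<dots> = fls_const (- u * (- a) * (1 / a - 1 / b)) * fls_X_inv"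
    unfolding W by (simp add: mult_ac)
  also have "- u * (- a) * (1 / a - 1 / b) = (b - a) * (a / c)"
    by (simp add: u_def field_simps)
  finally show "fls_const (1 - a) * inf_casoratian 1 0 0 = fls_const (b - a) * fls_const (a / c) * fls_X_inv"
    by simp
qed

text \<open>
  The constant and the shift by one are those that make the two sides agree at \<open>(1, 0, 0)\<close>.
\<close>
lemma main_identity:
  "zero_casoratian k l m $$ n = (q - c) / (b - a) * inf_casoratian k l m $$ (- (n + 1))"
proof -
  have "b - a \<noteq> 0" using param_differ(1)[of 0 0] by simp
  let ?H = "\<lambda>k l m n. zero_casoratian k l m $$ n - (q - c) / (b - a) * inf_casoratian k l m $$ (- (n + 1))"
  have "?H k l m n = 0"
  proof (rule contiguous_zero[of ?H])
    show "contiguous ?H"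
      using contiguous_diff[OF zero_casoratian_contiguous inf_casoratian_contiguous] .
    show "?H 0 0 0 n = 0" for n
      by (simp add: zero_casoratian_initial(1) inf_casoratian_initial(1))
    show "?H 1 0 0 n = 0" for n
    proof -
      have "(1 - a) * (x - r * y) = (1 - a) * x - r * ((1 - a) * y)" for x r y
        by (simp add: algebra_simps)
      hence "(1 - a) * (?H 1 0 0 n) = (fls_const (1 - a) * zero_casoratian 1 0 0) $$ n
        - (q - c) / (b - a) * (fls_const (1 - a) * inf_casoratian 1 0 0) $$ (- (n + 1))"
        by (simp only: fls_mult_const_nth)
      also have "\<dots> = 0"
        unfolding zero_casoratian_initial(2) inf_casoratian_initial(2)
        using \<open>b - a \<noteq> 0\<close> by (simp add: mult.assoc) (simp add: field_simps)
      finally show ?thesis using one_minus_a by simp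
    qed
  qed
  thus ?thesis by simp
qed

section \<open>Coefficients as terminating series\<close>

lemma shifted_quotient_qZ:
  "a * q powi i / c \<notin> qZ q" "b * q powi i / c \<notin> qZ q" "q powi i / c \<notin> qZ q"
  "q powi i / a \<notin> qZ q" "q powi i / b \<notin> qZ q" "a * q powi i / b \<notin> qZ q" "b * q powi i / a \<notin> qZ q"
  "c * q powi i / a \<notin> qZ q" "c * q powi i / b \<notin> qZ q"
  using scaled_qZ[OF quotient_qZ(1), of _ i] scaled_qZ[OF quotient_qZ(2), of _ i]
    scaled_qZ[OF quotient_qZ(6), of _ i] scaled_qZ[OF quotient_qZ(4), of _ i]
    scaled_qZ[OF quotient_qZ(5), of _ i] scaled_qZ[OF ab_qZ, of _ i]
    scaled_qZ[OF quotient_qZ(3), of _ i] scaled_qZ[OF ca_qZ, of _ i] scaled_qZ[OF cb_qZ, of _ i]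
  by auto

lemma quotient_q_qZ:
  "a * q / c \<notin> qZ q" "b * q / c \<notin> qZ q" "q\<^sup>2 / c \<notin> qZ q" "q / a \<notin> qZ q" "q / b \<notin> qZ q"
  "a * q / b \<notin> qZ q" "b * q / a \<notin> qZ q"
  using shifted_quotient_qZ(1,2,4,5,6,7)[of 1] shifted_quotient_qZ(3)[of 2] by auto

lemmas powi_simps = power_int_diff power_int_add power_int_minus power2_eq_square

text \<open>
  In each of the eight identities of this kind one factor is a solution and the other one a solution
  divided by its Euler factor; the factor whose factorials are reversed stands first.
\<close>
lemma B_coef_eq:
  "B_coef q k l m a b c (int n) = (phi21 (a * q / c) (b * q / c) (q\<^sup>2 / c) 1
     * phi21 (c * q powi (m - k) / a) (c * q powi (m - l) / b) (c * q powi m) (a * b / c * q powi (k + l - m))) $ n"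
  by (subst phi21_mult_nth'[where C' = "c * q powi (- int n - 1)" and A' = "c * q powi (- int n) / a"
        and B' = "c * q powi (- int n) / b" and x = "q powi (k + l - m + 1)"])
    (use quotient_q_qZ in \<open>simp_all add: B_coef_def phi21_def powi_simps field_simps\<close>)

lemma C_coef_eq:
  "C_coef q k l m a b c (int n) = mu1 q k l m a b c * (phi21 b (b * q / c) (b * q / a) (c * q / (a * b))
     * phi21 (q powi (1 - l) / b) (c * q powi (m - l) / b) (a * q powi (k - l + 1) / b) q) $ n"
  by (subst phi21_mult_nth'[where C' = "a * q powi (- int n) / b" and A' = "q powi (1 - int n) / b"
        and B' = "c * q powi (- int n) / b" and x = q])
    (use quotient_q_qZ b_qZ in \<open>simp_all add: C_coef_def phi21_def powi_simps field_simps\<close>)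

lemma D_coef_eq:
  "D_coef q k l m a b c (int n) = mu2 q k l m a b c
     * (phi21 (q powi (1 - k) / a) (c * q powi (m - k) / a) (b * q powi (l - k + 1) / a) q
        * phi21 a (a * q / c) (a * q / b) (c * q / (a * b))) $ n"
  by (subst phi21_mult_nth'[where C' = "a * q powi (k - l - int n) / b" and A' = "a * q powi (k - int n)"
        and B' = "a * q powi (k - m - int n + 1) / c" and x = "q powi (k + l - m + 1)"])
    (use shifted_quotient_qZ(4)[of "1 - k"] shifted_quotient_qZ(8)[of "m - k"]
       shifted_quotient_qZ(7)[of "l - k + 1"]
     in \<open>simp_all add: D_coef_def phi21_def powi_simps field_simps\<close>)

lemma Ct_coef_eq:
  "Ct_coef q k l m a b c (int n) = mu1 q k l m a b c
     * (phi21 (a * q powi k) (a * q powi (k - m + 1) / c) (a * q powi (k - l + 1) / b)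
          (c * q powi (m - k - l + 1) / (a * b))
        * phi21 (q / a) (c / a) (b * q / a) q) $ n"
  by (subst phi21_mult_nth'[where C' = "b * q powi (l - k - int n) / a" and A' = "q powi (1 - k - int n) / a"
        and B' = "c * q powi (m - k - int n) / a" and x = q])
    (use shifted_quotient_qZ(1)[of "k - m + 1"] shifted_quotient_qZ(6)[of "k - l + 1"] a_qZ
     in \<open>simp_all add: Ct_coef_def phi21_def powi_simps field_simps\<close>)

lemma Dt_coef_eq:
  "Dt_coef q k l m a b c (int n) = mu2 q k l m a b c
     * (phi21 (q / b) (c / b) (a * q / b) q
        * phi21 (b * q powi l) (b * q powi (l - m + 1) / c) (b * q powi (l - k + 1) / a)
          (c * q powi (m - k - l + 1) / (a * b))) $ n"
  by (subst phi21_mult_nth'[where C' = "b * q powi (- int n) / a" and A' = "b * q powi (- int n)"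
        and B' = "b * q powi (1 - int n) / c" and x = "q powi (m - k - l + 1)"])
    (use quotient_q_qZ cb_qZ
     in \<open>simp_all add: Dt_coef_def phi21_def powi_simps field_simps\<close>)

lemma Bt_coef_eq:
  "Bt_coef q k l m a b c (int n) = (phi21 (q / a) (q / b) (q\<^sup>2 / c) (a * b / c)
     * phi21 (a * q powi k) (b * q powi l) (c * q powi m) 1) $ n"
proof -
  define T where "T = q powi triangular (int n)"
  have T: "T \<noteq> 0" by (simp add: T_def)
  have cq: "c / q \<notin> qZ q" using scaled_qZ[OF c_qZ, of _ "- 1"] by (simp add: divide_inverse power_int_minus)
  have c1: "c * q powi (- int n - 1) = c / q * q powi (- int n)" by (simp add: power_int_diff)
  have qcq: "q / (c / q) = q\<^sup>2 / c" by (simp add: power2_eq_square)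
  have "qpoch q (a * q powi (- int n)) (int n) * qpoch q (b * q powi (- int n)) (int n)
       / (qpoch q (q powi (- int n)) (int n) * qpoch q (c * q powi (- int n - 1)) (int n)) * q powi (- int n)
     = phi21 (q / a) (q / b) (q\<^sup>2 / c) (a * b / c) $ n"
  proof -
    have x: "(- q) ^ n * (- (q\<^sup>2 / c)) ^ n / ((- (q / a)) ^ n * (- (q / b)) ^ n) / q ^ n = (a * b / c) ^ n"
      unfolding power_mult_distrib[symmetric] power_divide[symmetric]
      by (rule arg_cong[of _ _ "\<lambda>x. x ^ n"]) (simp add: field_simps power2_eq_square)
    have gen: "(pa / (xa * T)) * (pb / (xb * T)) / (pq / (xq * T) * (pc / (xc * T))) * y
      = pa * pb / (pq * pc) * w" if "xq * xc / (xa * xb) * y = w" for pa pb pq pc xa xb xq xc y w :: complex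
      unfolding that[symmetric] using T by (simp add: field_simps)
    have cq0: "c / q \<noteq> 0" by simp
    have cd: "qpoch q (c / q * q powi (- int n)) (int n)
        = qpoch q (q\<^sup>2 / c) (int n) / ((- (q\<^sup>2 / c)) ^ n * T)"
      using qpoch_down_shifted[OF cq0 cq, of n]
      unfolding minus_divide_left[symmetric] qcq T_def[symmetric] .
    show ?thesis
      unfolding c1 cd qpoch_down_shifted[OF nz(1) a_qZ] qpoch_down_shifted[OF nz(2) b_qZ]
        qpoch_q_down phi21_def fps_nth_Abs_fps
        T_def[symmetric] qcq minus_divide_left[symmetric]
      by (rule gen) (use x in \<open>simp add: power_int_minus divide_inverse\<close>)
  qed
  moreover have "(phi21 (q / a) (q / b) (q\<^sup>2 / c) (a * b / c)
     * phi21 (a * q powi k) (b * q powi l) (c * q powi m) 1) $ n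
     = phi21 (q / a) (q / b) (q\<^sup>2 / c) (a * b / c) $ n
       * phi43 (q powi (- int n)) (c * q powi (- int n - 1)) (a * q powi k) (b * q powi l)
         (c * q powi m) (a * q powi (- int n)) (b * q powi (- int n)) q q"
    by (rule phi21_mult_nth') (use quotient_q_qZ in \<open>simp_all add: powi_simps field_simps\<close>)
  ultimately show ?thesis unfolding Bt_coef_def by simp
qed

text \<open>
  The prefactor is the value of \<open>sol\<close> at the exponent \<open>n - m\<close>, hence known from \<open>zero_series2_nth\<close>.
\<close>
lemma At_coef_eq:
  "At_coef q k l m a b c (int n) = zero_lead2 k l m
     * (phi21 (a * q powi (k - m + 1) / c) (b * q powi (l - m + 1) / c) (q powi (2 - m) / c) 1
        * phi21 (c / a) (c / b) c (a * b / c)) $ n"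
proof -
  have "zero_series2 k l m $$ (int n - m)
      = zero_lead2 k l m * phi21 (a * q powi (k - m + 1) / c) (b * q powi (l - m + 1) / c) (q powi (2 - m) / c) 1 $ n"
    unfolding zero_series2_def expansion_nth by simp
  moreover have "sol (q / c) k l m (int n - m) = qpoch q c m / (qpoch q a k * qpoch q b l)
     * ((qpoch q (a * q / c) (int n + k - m) * qpoch q (b * q / c) (int n + l - m))
       / (qpoch q q (int n) * qpoch q (q\<^sup>2 / c) (int n - m)))"
  proof -
    have e: "int n - m + k = int n + k - m" "int n - m + l = int n + l - m" "int n - m + m = int n"
      by simp_all
    have z: "a * (q / c) = a * q / c" "b * (q / c) = b * q / c" "q * (q / c) = q\<^sup>2 / c" "c * (q / c) = q"
      by (simp_all add: power2_eq_square)
    show ?thesis unfolding sol_def e z by (simp add: divide_inverse mult_ac)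
  qed
  ultimately have "qpoch q c m / (qpoch q a k * qpoch q b l)
     * ((qpoch q (a * q / c) (int n + k - m) * qpoch q (b * q / c) (int n + l - m))
       / (qpoch q q (int n) * qpoch q (q\<^sup>2 / c) (int n - m)))
     = zero_lead2 k l m * phi21 (a * q powi (k - m + 1) / c) (b * q powi (l - m + 1) / c) (q powi (2 - m) / c) 1 $ n"
    by (simp add: zero_series2_nth)
  moreover have "(phi21 (a * q powi (k - m + 1) / c) (b * q powi (l - m + 1) / c) (q powi (2 - m) / c) 1
        * phi21 (c / a) (c / b) c (a * b / c)) $ n
     = phi21 (a * q powi (k - m + 1) / c) (b * q powi (l - m + 1) / c) (q powi (2 - m) / c) 1 $ n
       * phi43 (q powi (- int n)) (c * q powi (m - int n - 1)) (c / a) (c / b)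
         c (c * q powi (m - k - int n) / a) (c * q powi (m - l - int n) / b) q (q powi (m - k - l + 1))"
    by (rule phi21_mult_nth')
      (use shifted_quotient_qZ(1)[of "k - m + 1"] shifted_quotient_qZ(2)[of "l - m + 1"]
         shifted_quotient_qZ(3)[of "2 - m"] in \<open>simp_all add: powi_simps field_simps\<close>)
  ultimately show ?thesis unfolding At_coef_def by simp
qed

text \<open>
  The prefactor contains factorials of index \<open>k - n\<close>, \<open>l - n\<close> and \<open>m - n - 1\<close>. Splitting off the index \<open>- n\<close> and
  inverting leaves at \<open>n = 0\<close> the identity
  \<open>- c q\<^bsup>m-1\<^esup> (c)\<^bsub>m-1\<^esub> / (q\<^sup>2/c)\<^bsub>-m-1\<^esub> = (c)\<^sub>m / (q\<^sup>2/c)\<^bsub>-m\<^esub>\<close>.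
\<close>
lemma A_coef_eq:
  "A_coef q k l m a b c (int n) = zero_lead2 k l m
     * (phi21 (q powi (1 - k) / a) (q powi (1 - l) / b) (q powi (2 - m) / c) (a * b / c * q powi (k + l - m))
        * phi21 a b c 1) $ n"
proof -
  define T where "T = q powi triangular (int n)"
  have T: "T \<noteq> 0" by (simp add: T_def)
  define pa pb pc where "pa = qpoch q (q powi (1 - k) / a) (int n)"
    "pb = qpoch q (q powi (1 - l) / b) (int n)" "pc = qpoch q (q powi (2 - m) / c) (int n)"
  note p = this
  have p0: "pa \<noteq> 0" "pb \<noteq> 0" "pc \<noteq> 0"
    unfolding p by (rule qpoch_nonzero; rule shifted_quotient_qZ)+
  have d: "q / (a * q powi k) = q powi (1 - k) / a" "q / (b * q powi l) = q powi (1 - l) / b"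
    "q / (c * q powi (m - 1)) = q powi (2 - m) / c"
    by (simp_all add: powi_simps field_simps)
  have 1: "qpoch q a (k - int n) = qpoch q a k * ((- (q powi (1 - k) / a)) ^ n * T / pa)"
    using qpoch_add[OF a_qZ, of k "- int n"] qpoch_neg_qZ[of "a * q powi k" n] a_qZ d(1)
    by (simp add: T_def p)
  have 2: "qpoch q b (l - int n) = qpoch q b l * ((- (q powi (1 - l) / b)) ^ n * T / pb)"
    using qpoch_add[OF b_qZ, of l "- int n"] qpoch_neg_qZ[of "b * q powi l" n] b_qZ d(2)
    by (simp add: T_def p)
  have m: "m - int n - 1 = (m - 1) + - int n" by simp
  have 3: "qpoch q c (m - int n - 1) = qpoch q c (m - 1) * ((- (q powi (2 - m) / c)) ^ n * T / pc)"
    using qpoch_add[OF c_qZ, of "m - 1" "- int n"] qpoch_neg_qZ[of "c * q powi (m - 1)" n] c_qZ d(3)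
    unfolding m by (simp add: T_def p)
  define Q where "Q = q powi (m - 1)"
  have Q0: "Q \<noteq> 0" "1 - c * Q \<noteq> 0" "c * Q \<noteq> 0" unfolding Q_def by simp_all
  have 4: "qpoch q c m = (1 - c * Q) * qpoch q c (m - 1)"
    using qpoch_param_succ(3)[of "m - 1"] by (simp add: Q_def)
  have 5: "qpoch q (q\<^sup>2 / c) (- m) = (1 - 1 / (c * Q)) * qpoch q (q\<^sup>2 / c) (- m - 1)"
  proof -
    have "q\<^sup>2 / c * q powi (- m - 1) = 1 / (c * Q)" by (simp add: Q_def powi_simps field_simps)
    thus ?thesis
      using qpoch_succ[of "- m - 1" "q\<^sup>2 / c" q] qZ_mult_ne_1[OF quotient_q_qZ(3), of "- m - 1"] by simp
  qed
  have r0: "qpoch q (q\<^sup>2 / c) (- m - 1) \<noteq> 0" by (rule qpoch_nonzero[OF quotient_q_qZ(3)])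
  have x: "(- q) ^ n * (- (q powi (2 - m) / c)) ^ n
       / ((- (q powi (1 - k) / a)) ^ n * (- (q powi (1 - l) / b)) ^ n) / q ^ n
     = (a * b / c * q powi (k + l - m)) ^ n"
    unfolding power_mult_distrib[symmetric] power_divide[symmetric]
    by (rule arg_cong[of _ _ "\<lambda>x. x ^ n"]) (simp add: powi_simps field_simps)
  have qm: "q powi (m - int n - 1) = Q / q ^ n"
    unfolding m by (simp add: Q_def power_int_add power_int_diff power_int_minus field_simps)
  have gen: "(- c * X1 * X2) / r * (c1 * (xc * T / pc) / (pq / (xq * T) * (a1 * (xa * T / pa)) * (b1 * (xb * T / pb))))
       * (Q / y)
     = ((1 - c * Q) * c1 * (X1 * X2)) / (a1 * b1 * ((1 - 1 / (c * Q)) * r)) * (pa * pb / (pq * pc) * w)"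
    if "xq * xc / (xa * xb) / y = w" and nzs: "r \<noteq> 0" "a1 \<noteq> 0" "b1 \<noteq> 0" "pq \<noteq> 0" "xa \<noteq> 0" "xb \<noteq> 0" "xq \<noteq> 0" "y \<noteq> 0"
    for X1 X2 r c1 xc pq xq a1 xa b1 xb y w
  proof -
    have 1: "1 - 1 / (c * Q) = - (1 - c * Q) / (c * Q)" using Q0 by (simp add: field_simps)
    have 2: "((1 - c * Q) * c1 * (X1 * X2)) / (a1 * b1 * ((1 - 1 / (c * Q)) * r))
      = (- c * X1 * X2) / r * c1 * Q / (a1 * b1)"
      unfolding 1 using Q0 nzs by (simp add: divide_simps) (simp add: algebra_simps)
    show ?thesis unfolding that(1)[symmetric] 2 using T p0 nzs by (simp add: divide_simps)
  qed
  have "(- c * qpoch q (a * q / c) (k - m) * qpoch q (b * q / c) (l - m)) / qpoch q (q\<^sup>2 / c) (- m - 1)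
     * (qpoch q c (m - int n - 1)
       / (qpoch q (q powi (- int n)) (int n) * qpoch q a (k - int n) * qpoch q b (l - int n)))
     * q powi (m - int n - 1)
     = zero_lead2 k l m * phi21 (q powi (1 - k) / a) (q powi (1 - l) / b) (q powi (2 - m) / c)
         (a * b / c * q powi (k + l - m)) $ n"
    unfolding zero_lead2_def phi21_def fps_nth_Abs_fps 1 2 3 4 5 qm qpoch_q_down T_def[symmetric] p[symmetric]
    by (rule gen) (use x r0 qpoch_nonzero[OF a_qZ] qpoch_nonzero[OF b_qZ] qpoch_q_nonzero[of n] in simp_all)
  moreover have "(phi21 (q powi (1 - k) / a) (q powi (1 - l) / b) (q powi (2 - m) / c) (a * b / c * q powi (k + l - m))
        * phi21 a b c 1) $ n
     = phi21 (q powi (1 - k) / a) (q powi (1 - l) / b) (q powi (2 - m) / c) (a * b / c * q powi (k + l - m)) $ n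
       * phi43 (q powi (- int n)) (c * q powi (m - int n - 1)) a b
         c (a * q powi (k - int n)) (b * q powi (l - int n)) q q"
    by (rule phi21_mult_nth')
      (use shifted_quotient_qZ(4)[of "1 - k"] shifted_quotient_qZ(5)[of "1 - l"]
         shifted_quotient_qZ(3)[of "2 - m"] in \<open>simp_all add: powi_simps field_simps\<close>)
  ultimately show ?thesis unfolding A_coef_def by simp
qed

text \<open>
  The pole factor is the quotient of the Euler factors of the levels \<open>0\<close> and \<open>N\<close>.
\<close>
lemma pole_factor_zero:
  "pole_factor fls_X N * fps_to_fls (binom_series (a * b / c * q ^ N) 1)
     = fps_to_fls (binom_series (a * b / c) 1)"
proof (induction N)
  case (Suc N)
  have "1 - fls_const (a * b / c * q ^ N) * fls_X = fps_to_fls (1 - fps_const (a * b / c * q ^ N * 1) * fps_X)"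
    by (simp add: fls_times_fps_to_fls)
  hence "(1 - fls_const (a * b / c * q ^ N) * fls_X) * fps_to_fls (binom_series (a * b / c * q ^ Suc N) 1)
      = fps_to_fls (binom_series (a * b / c * q ^ N) 1)"
    using binom_series_shift_u[of "a * b / c * q ^ N" 1]
    by (simp only: fls_times_fps_to_fls[symmetric] power_Suc2 mult.assoc)
  thus ?case using Suc by (simp add: pole_factor_def mult.assoc)
qed (simp add: pole_factor_def)

text \<open>
  At infinity the same holds up to the leading term of the pole factor, of degree \<open>N\<close> in \<open>x\<close>.
\<close>
lemma pole_factor_inf:
  "pole_factor fls_X_inv N * fps_to_fls (binom_series (a * b / c * q ^ N) (q / (a * b / c * q ^ N)))
     = fls_const ((- (a * b / c)) ^ N * q powi triangular (int N))
       * (fls_X_inv ^ N * fps_to_fls (binom_series (a * b / c) (q / (a * b / c))))"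
proof (induction N)
  case (Suc N)
  define u where "u = a * b / c * q ^ N"
  have u: "u \<noteq> 0" "a * b / c * q ^ Suc N = u * q" by (simp_all add: u_def)
  have "fls_X_inv * fls_X = (1 :: complex fls)"
    by (simp add: fls_X_inv_times_conv_shift fls_X_conv_shift_1)
  hence "fls_const (- u) * fls_X_inv * fps_to_fls (1 - fps_const (1 / u) * fps_X)
      = 1 - fls_const u * fls_X_inv"
    using u by (simp add: fls_times_fps_to_fls right_diff_distrib mult.assoc mult.left_commute[of fls_X_inv])
  moreover have "binom_series u (q / u) = (1 - fps_const (1 / u) * fps_X) * binom_series (u * q) (q / (u * q))"
    using binom_series_shift_u_w[OF u(1), of q] by simp
  ultimately have "(1 - fls_const u * fls_X_inv) * fps_to_fls (binom_series (u * q) (q / (u * q)))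
      = fls_const (- u) * fls_X_inv * fps_to_fls (binom_series u (q / u))"
    by (metis fls_times_fps_to_fls mult.assoc)
  moreover have "pole_factor fls_X_inv (Suc N) = pole_factor fls_X_inv N * (1 - fls_const u * fls_X_inv)"
    by (simp add: pole_factor_def u_def)
  ultimately have "pole_factor fls_X_inv (Suc N) * fps_to_fls (binom_series (u * q) (q / (u * q)))
      = fls_const (- u) * fls_X_inv * (pole_factor fls_X_inv N * fps_to_fls (binom_series u (q / u)))"
    by (simp only: mult.assoc mult.left_commute[of "pole_factor fls_X_inv N"])
  also have "\<dots> = (fls_const (- u) * fls_const ((- (a * b / c)) ^ N * q powi triangular (int N)))
      * (fls_X_inv ^ Suc N * fps_to_fls (binom_series (a * b / c) (q / (a * b / c))))"
    unfolding u_def Suc by (simp only: mult_ac power_Suc)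
  also have "fls_const (- u) * fls_const ((- (a * b / c)) ^ N * q powi triangular (int N))
      = fls_const ((- (a * b / c)) ^ Suc N * q powi triangular (int (Suc N)))"
  proof -
    have "triangular (int (Suc N)) = triangular (int N) + int N" using triangular_succ[of "int N"] by (simp add: add.commute)
    thus ?thesis by (simp add: u_def q_powi_add mult_ac)
  qed
  finally show ?case unfolding u(2) .
qed (simp add: pole_factor_def)

section \<open>Coefficients of the Casoratians\<close>

text \<open>
  The pole factor moves the Euler factor from the solution with parameters \<open>(k, l, m)\<close> to the one with
  parameters \<open>(0, 0, 0)\<close>.
\<close>
lemma zero_casoratian_nth_nonneg:
  assumes "0 \<le> k + l - m"
  shows "zero_casoratian k l m $$ j = B_coef q k l m a b c j - A_coef q k l m a b c (j + m)"
proof -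
  define N where "N = nat (k + l - m)"
  have N: "q powi (k + l - m) = q ^ N" using assms by (simp add: N_def power_int_def)
  have e0: "phi21 (a * q / c) (b * q / c) (q\<^sup>2 / c) 1
      = binom_series (a * b / c) 1 * phi21 (q / a) (q / b) (q\<^sup>2 / c) (a * b / c)"
    "phi21 a b c 1 = binom_series (a * b / c) 1 * phi21 (c / a) (c / b) c (a * b / c)"
    using euler_zero2[of 0 0 0] euler_zero1[of 0 0 0] by simp_all
  have "pole_factor fls_X N * (zero_series1 k l m * fps_to_fls (phi21 (q / a) (q / b) (q\<^sup>2 / c) (a * b / c)))
      = (pole_factor fls_X N * fps_to_fls (binom_series (a * b / c * q ^ N) 1))
        * fps_to_fls (phi21 (c * q powi (m - k) / a) (c * q powi (m - l) / b) (c * q powi m) (a * b / c * q ^ N)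
            * phi21 (q / a) (q / b) (q\<^sup>2 / c) (a * b / c))"
    unfolding zero_series1_def euler_zero1 N by (simp only: fls_times_fps_to_fls mult_ac)
  also have "\<dots> = fps_to_fls (phi21 (a * q / c) (b * q / c) (q\<^sup>2 / c) 1
     * phi21 (c * q powi (m - k) / a) (c * q powi (m - l) / b) (c * q powi m) (a * b / c * q powi (k + l - m)))"
    unfolding pole_factor_zero e0 N by (simp only: fls_times_fps_to_fls mult_ac)
  finally have 1: "(pole_factor fls_X N * (zero_series1 k l m
      * fps_to_fls (phi21 (q / a) (q / b) (q\<^sup>2 / c) (a * b / c)))) $$ j = B_coef q k l m a b c j"
    using B_coef_eq[of k l m "nat j"] by (cases "j < 0") (simp_all add: B_coef_def)
  have "pole_factor fls_X N * (zero_series2 k l m * fps_to_fls (phi21 (c / a) (c / b) c (a * b / c)))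
      = fls_const (zero_lead2 k l m) * fls_shift m ((pole_factor fls_X N * fps_to_fls (binom_series (a * b / c * q ^ N) 1))
        * fps_to_fls (phi21 (q powi (1 - k) / a) (q powi (1 - l) / b) (q powi (2 - m) / c) (a * b / c * q ^ N)
            * phi21 (c / a) (c / b) c (a * b / c)))"
    unfolding zero_series2_def euler_zero2 N
    by (simp only: fls_times_fps_to_fls fls_shifted_times_simps mult_ac)
  also have "\<dots> = fls_const (zero_lead2 k l m) * fls_shift m (fps_to_fls
     (phi21 (q powi (1 - k) / a) (q powi (1 - l) / b) (q powi (2 - m) / c) (a * b / c * q powi (k + l - m))
        * phi21 a b c 1))"
    unfolding pole_factor_zero e0 N by (simp only: fls_times_fps_to_fls mult_ac)
  finally have "(pole_factor fls_X N * (zero_series2 k l m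
      * fps_to_fls (phi21 (c / a) (c / b) c (a * b / c)))) $$ j = A_coef q k l m a b c (j + m)"
    using A_coef_eq[of k l m "nat (j + m)"] unfolding expansion_nth
    by (cases "j < - m") (simp_all add: A_coef_def)
  with 1 show ?thesis
    unfolding zero_casoratian_def N_def[symmetric] right_diff_distrib fls_minus_nth by simp
qed

lemma zero_casoratian_nth_neg:
  assumes "k + l - m < 0"
  shows "zero_casoratian k l m $$ j = Bt_coef q k l m a b c j - At_coef q k l m a b c (j + m)"
proof -
  have N: "nat (k + l - m) = 0" using assms by simp
  have 1: "(zero_series1 k l m * fps_to_fls (phi21 (q / a) (q / b) (q\<^sup>2 / c) (a * b / c))) $$ j
      = Bt_coef q k l m a b c j"
    unfolding zero_series1_def fls_times_fps_to_fls[symmetric] mult.commute[of "phi21 (a * q powi k) _ _ _"]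
    using Bt_coef_eq[of k l m "nat j"] by (cases "j < 0") (simp_all add: Bt_coef_def)
  have "zero_series2 k l m * fps_to_fls (phi21 (c / a) (c / b) c (a * b / c))
     = fls_const (zero_lead2 k l m) * fls_shift m (fps_to_fls
      (phi21 (a * q powi (k - m + 1) / c) (b * q powi (l - m + 1) / c) (q powi (2 - m) / c) 1
        * phi21 (c / a) (c / b) c (a * b / c)))"
    unfolding zero_series2_def by (simp only: fls_times_fps_to_fls fls_shifted_times_simps mult_ac)
  hence "(zero_series2 k l m * fps_to_fls (phi21 (c / a) (c / b) c (a * b / c))) $$ j
      = At_coef q k l m a b c (j + m)"
    using At_coef_eq[of k l m "nat (j + m)"] by (cases "j < - m") (simp_all add: expansion_nth At_coef_def)
  with 1 show ?thesis
    unfolding zero_casoratian_def N pole_factor_0 by simp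
qed

lemma inf_part_nth_nonneg:
  assumes "0 \<le> k + l - m"
  shows "(pole_factor fls_X_inv (nat (k + l - m))
       * (inf_series k l m * fps_to_fls (phi21 (q / a) (c / a) (b * q / a) q))) $$ j
    = (- (a * b / c)) ^ nat (k + l - m) * q powi triangular (k + l - m) * (if j + (k + l - m) < k then 0 else
        inf_lead k l m * (phi21 b (b * q / c) (b * q / a) (c * q / (a * b))
          * phi21 (q powi (1 - l) / b) (c * q powi (m - l) / b) (a * q powi (k - l + 1) / b) q)
          $ nat (j + (k + l - m) - k))"
proof -
  interpret swap: hyp_params q b a c by (rule swapped)
  define N where "N = nat (k + l - m)"
  have iN: "k + l - m = int N" using assms by (simp add: N_def)
  have N: "q powi (k + l - m) = q ^ N" by (simp add: iN)
  define F where "F = phi21 (q powi (1 - l) / b) (c * q powi (m - l) / b) (a * q powi (k - l + 1) / b) q"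
  have e0: "phi21 b (b * q / c) (b * q / a) (c * q / (a * b))
      = binom_series (a * b / c) (q / (a * b / c)) * phi21 (q / a) (c / a) (b * q / a) q"
    using swap.euler_inf[of 0 0 0] by (simp add: mult_ac)
  have "pole_factor fls_X_inv N * (inf_series k l m * fps_to_fls (phi21 (q / a) (c / a) (b * q / a) q))
      = fls_const (inf_lead k l m) * fls_shift (- k) ((pole_factor fls_X_inv N
           * fps_to_fls (binom_series (a * b / c * q ^ N) (q / (a * b / c * q ^ N))))
          * fps_to_fls (F * phi21 (q / a) (c / a) (b * q / a) q))"
    unfolding inf_series_def euler_inf N F_def
    by (simp only: fls_times_fps_to_fls fls_shifted_times_simps mult_ac)
  also have "\<dots> = fls_const ((- (a * b / c)) ^ N * q powi triangular (int N)) * (fls_X_inv ^ N *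
      (fls_const (inf_lead k l m) * fls_shift (- k) (fps_to_fls (phi21 b (b * q / c) (b * q / a) (c * q / (a * b)) * F))))"
    unfolding pole_factor_inf e0
    by (simp only: fls_times_fps_to_fls fls_shifted_times_simps mult_ac)
  finally show ?thesis
    unfolding N_def[symmetric] F_def[symmetric] iN
    by (simp only: fls_mult_const_nth fls_X_inv_power_times_conv_shift fls_shift_nth expansion_nth minus_minus)
      (simp add: algebra_simps)
qed

lemma inf_part_nth_neg:
  "(inf_series k l m * fps_to_fls (phi21 (q / a) (c / a) (b * q / a) q)) $$ j
    = (if j < k then 0 else inf_lead k l m
      * (phi21 (a * q powi k) (a * q powi (k - m + 1) / c) (a * q powi (k - l + 1) / b)
          (c * q powi (m - k - l + 1) / (a * b))
        * phi21 (q / a) (c / a) (b * q / a) q) $ nat (j - k))"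
proof -
  have "inf_series k l m * fps_to_fls (phi21 (q / a) (c / a) (b * q / a) q)
    = fls_const (inf_lead k l m) * fls_shift (- k) (fps_to_fls
      (phi21 (a * q powi k) (a * q powi (k - m + 1) / c) (a * q powi (k - l + 1) / b)
          (c * q powi (m - k - l + 1) / (a * b))
        * phi21 (q / a) (c / a) (b * q / a) q))"
    unfolding inf_series_def by (simp only: fls_times_fps_to_fls fls_shifted_times_simps mult_ac)
  thus ?thesis by (simp add: expansion_nth)
qed

text \<open>
  The connection factor \<open>\<lambda>\<close> without \<open>(q - c)/(b - a)\<close>. Unlike \<open>\<lambda>\<close> it is invariant under \<open>(a, k) \<leftrightarrow> (b, l)\<close>.
\<close>
definition conn_factor :: "int \<Rightarrow> int \<Rightarrow> int \<Rightarrow> int \<Rightarrow> complex" where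
  "conn_factor k l m M = (- 1) powi (k + l - m - 1 + M)
     * q powi ((k * (k - 1) + l * (l - 1) - m * (m - 1) + M * (M - 1)) div 2)
     * (a powi k * b powi l / c powi m) * (a * b / c) powi M
     * (qpoch q c m / (qpoch q a k * qpoch q b l))"

text \<open>
  The factorials agree by reflection. What remains is an identity of monomials, which is checked separately
  for the sign, for \<open>q\<close> and for \<open>a\<close>, \<open>b\<close>, \<open>c\<close>.
\<close>
lemma conn_factor_mu1:
  "conn_factor k l m (int N) * mu1 q k l m a b c
     = - ((- (a * b / c)) ^ N * q powi triangular (int N)) * inf_lead k l m"
proof -
  define P1 P2 P3 N0 where "P1 = qpoch q (a * q / b) (k - l)" "P2 = qpoch q a k"
    "P3 = qpoch q (a * q / c) (k - m)" "N0 = qpoch q c m / (qpoch q a k * qpoch q b l)"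
  note P = this
  have P0: "P1 \<noteq> 0" "P2 \<noteq> 0" "P3 \<noteq> 0"
    unfolding P by (rule qpoch_nonzero; rule quotient_q_qZ a_qZ)+
  have "(k * (k - 1) + l * (l - 1) - m * (m - 1) + int N * (int N - 1)) div 2
      = triangular k + triangular l - triangular m + triangular (int N)"
  proof -
    have "k * (k - 1) + l * (l - 1) - m * (m - 1) + int N * (int N - 1)
        = 2 * (triangular k + triangular l - triangular m + triangular (int N))"
      unfolding two_triangular[symmetric] by simp
    thus ?thesis by simp
  qed
  note ex = this
  \<comment> \<open>The factorials of \<open>inf_lead\<close> in terms of those of \<open>mu1\<close>.\<close>
  have r1: "qpoch q (b / a) (l - k) = (- (b / a)) powi (l - k) * q powi triangular (l - k) / P1"
    using qpoch_reflect[OF quotient_qZ(3), of "l - k"] P0(1) by (simp add: P field_simps)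
  have r2: "qpoch q (q / a) (- k) = (- a) powi k * q powi triangular k / P2"
    using qpoch_reflect[OF a_qZ, of k] P0(2) by (simp add: P field_simps)
  have r3: "qpoch q (c / a) (m - k) = (- (c / a)) powi (m - k) * q powi triangular (m - k) / P3"
    using qpoch_reflect[OF ca_qZ, of "m - k"] P0(3) by (simp add: P field_simps)
  have neg: "(- x) powi i = (- 1) powi i * x powi i" for x :: complex and i
    by (metis mult_minus1 power_int_mult_distrib)
  define sg :: "int \<Rightarrow> complex" where "sg i = (- 1) powi i" for i
  have sg_sq: "sg i * sg i = 1" and sg_nz: "sg i \<noteq> 0" for i by (simp_all add: sg_def)
  have sg: "sg (k + l - m - 1 + int N) = - sg (int N) * sg (l - k) / (sg k * sg (m - k))"
  proof -
    have sg_add: "sg (i + j) = sg i * sg j" for i j by (simp add: sg_def power_int_add)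
    have "sg (k + l - m - 1 + int N) * (sg k * sg (m - k)) = sg (k + l - m - 1 + int N + (k + (m - k)))"
      by (simp only: sg_add)
    \<comment> \<open>Even exponents drop out, which removes \<open>k + k\<close>.\<close>
    also have "k + l - m - 1 + int N + (k + (m - k)) = (int N + (l - k)) + (- 1) + (k + k)" by simp
    also have "sg \<dots> = sg (int N) * sg (l - k) * sg (- 1) * (sg k * sg k)"
      by (simp only: sg_add)
    also have "\<dots> = - sg (int N) * sg (l - k)" unfolding sg_sq by (simp add: sg_def)
    finally show ?thesis using sg_nz by (simp add: field_simps)
  qed
  have qq: "q powi (triangular k + triangular l - triangular m + triangular (int N)) * q powi (k * (m - k - l + 1))
      = q powi triangular (int N) * q powi triangular (l - k) / (q powi triangular k * q powi triangular (m - k))"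
  proof -
    have "2 * (triangular k + triangular l - triangular m + triangular (int N) + k * (m - k - l + 1) + (triangular k + triangular (m - k)))
        = 2 * (triangular (int N) + triangular (l - k))"
      unfolding distrib_left right_diff_distrib two_triangular by (simp add: algebra_simps)
    hence E: "triangular k + triangular l - triangular m + triangular (int N) + k * (m - k - l + 1) + (triangular k + triangular (m - k))
        = triangular (int N) + triangular (l - k)"
      by (rule mult_left_cancel[THEN iffD1, rotated]) simp
    have "q powi (triangular k + triangular l - triangular m + triangular (int N)) * q powi (k * (m - k - l + 1)) * (q powi triangular k * q powi triangular (m - k))
        = q powi triangular (int N) * q powi triangular (l - k)"
      unfolding q_powi_add[symmetric] by (simp only: E)
    thus ?thesis by (simp add: field_simps)
  qed
  have abc: "(a powi k * b powi l / c powi m) * (a powi (m - k - l) * (c / (a * b)) powi k)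
      = (b / a) powi (l - k) / (a powi k * (c / a) powi (m - k))"
    by (simp add: power_int_add power_int_diff power_int_divide_distrib power_int_mult_distrib field_simps)
  have "conn_factor k l m (int N) * mu1 q k l m a b c
     = sg (k + l - m - 1 + int N) * (q powi (triangular k + triangular l - triangular m + triangular (int N)) * q powi (k * (m - k - l + 1)))
       * ((a powi k * b powi l / c powi m) * (a powi (m - k - l) * (c / (a * b)) powi k))
       * (a * b / c) ^ N * N0 * (P2 * P3 / P1)"
    unfolding conn_factor_def mu1_def ex sg_def P power_int_of_nat by (simp only: mult_ac)
  also have "\<dots> = - (sg (int N) * (a * b / c) ^ N * q powi triangular (int N)) * (N0
      * ((sg (l - k) * (b / a) powi (l - k) * q powi triangular (l - k) / P1)
        / ((sg k * a powi k * q powi triangular k / P2) * (sg (m - k) * (c / a) powi (m - k) * q powi triangular (m - k) / P3))))"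
    unfolding sg qq abc using P0 by (simp add: divide_inverse mult_ac)
  also have "sg (int N) * (a * b / c) ^ N = (- (a * b / c)) ^ N"
    using neg[of "a * b / c" "int N"] by (simp add: sg_def)
  also have "N0 * ((sg (l - k) * (b / a) powi (l - k) * q powi triangular (l - k) / P1)
        / ((sg k * a powi k * q powi triangular k / P2) * (sg (m - k) * (c / a) powi (m - k) * q powi triangular (m - k) / P3)))
      = inf_lead k l m"
    unfolding inf_lead_def r1 r2 r3 neg[of "b / a"] neg[of a] neg[of "c / a"] sg_def P ..
  finally show ?thesis .
qed

lemma conn_factor_mu2:
  "conn_factor k l m (int N) * mu2 q k l m a b c
     = - ((- (a * b / c)) ^ N * q powi triangular (int N)) * inf_lead' k l m"
proof -
  interpret swap: hyp_params q b a c by (rule swapped)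
  have "mu2 q k l m a b c = mu1 q l k m b a c"
    unfolding mu1_def mu2_def by (simp only: mult.commute[of b a] diff_diff_eq add.commute[of l k])
  moreover have "conn_factor k l m (int N) = swap.conn_factor l k m (int N)"
    unfolding swap.conn_factor_def conn_factor_def
    by (simp only: mult.commute[of b a] add.commute[of l k] add.commute[of "l * (l - 1)"]
        mult.commute[of "b powi l"] mult.commute[of "qpoch q b l"])
  ultimately show ?thesis using swap.conn_factor_mu1[of l k m N]
    by (simp only: mult.commute[of b a])
qed

lemma conn_factor_C_D:
  assumes s: "0 \<le> k + l - m" and n: "0 \<le> n"
  shows "conn_factor k l m (k + l - m) * (C_coef q k l m a b c n - D_coef q k l m a b c (n + k - l))
    = - (inf_casoratian k l m $$ (n + k - (k + l - m)))"
proof -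
  interpret swap: hyp_params q b a c by (rule swapped)
  define N where "N = nat (k + l - m)"
  define K where "K = (- (a * b / c)) ^ N * q powi triangular (int N)"
  have iN: "k + l - m = int N" "nat (int N) = N" using s by (simp_all add: N_def)
  define i where "i = n + k - (k + l - m)"
  have pole: "swap.pole_factor = pole_factor"
    by (intro ext) (simp add: swap.pole_factor_def pole_factor_def mult.commute[of b a])
  have i1: "i + (k + l - m) = n + k" by (simp add: i_def)
  have "(pole_factor fls_X_inv N * (inf_series k l m * fps_to_fls (phi21 (q / a) (c / a) (b * q / a) q))) $$ i
    = K * (inf_lead k l m * (phi21 b (b * q / c) (b * q / a) (c * q / (a * b))
          * phi21 (q powi (1 - l) / b) (c * q powi (m - l) / b) (a * q powi (k - l + 1) / b) q) $ nat n)"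
    using inf_part_nth_nonneg[OF s, of i] n unfolding i1 unfolding iN K_def by simp
  moreover have "mu1 q k l m a b c * (phi21 b (b * q / c) (b * q / a) (c * q / (a * b))
          * phi21 (q powi (1 - l) / b) (c * q powi (m - l) / b) (a * q powi (k - l + 1) / b) q) $ nat n
      = C_coef q k l m a b c n"
    using C_coef_eq[of k l m "nat n"] n by simp
  ultimately have 1: "conn_factor k l m (int N) * C_coef q k l m a b c n
     = - ((pole_factor fls_X_inv N * (inf_series k l m * fps_to_fls (phi21 (q / a) (c / a) (b * q / a) q))) $$ i)"
    using conn_factor_mu1[of k l m N] unfolding K_def[symmetric] by (metis mult.assoc mult_minus_left)
  have s': "0 \<le> l + k - m" using s by simp
  have e: "l + k - m = int N" "c * q / (b * a) = c * q / (a * b)" "b * a / c = a * b / c"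
    using iN by (simp_all add: mult.commute)
  have i2: "i + int N = n + k" "i + int N - l = n + k - l" using i1 iN by simp_all
  have p2: "(pole_factor fls_X_inv N * (inf_series' k l m * fps_to_fls (phi21 (q / b) (c / b) (a * q / b) q))) $$ i
    = (if n + k - l < 0 then 0 else K * (inf_lead' k l m * (phi21 (q powi (1 - k) / a) (c * q powi (m - k) / a) (b * q powi (l - k + 1) / a) q
        * phi21 a (a * q / c) (a * q / b) (c * q / (a * b))) $ nat (n + k - l)))"
    using swap.inf_part_nth_nonneg[OF s', of i] unfolding pole e iN(2) i2 K_def
    by (simp add: mult.commute[of "phi21 a _ _ _"])
  have 2: "conn_factor k l m (int N) * D_coef q k l m a b c (n + k - l)
     = - ((pole_factor fls_X_inv N * (inf_series' k l m * fps_to_fls (phi21 (q / b) (c / b) (a * q / b) q))) $$ i)"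
  proof (cases "n + k - l < 0")
    case True
    thus ?thesis unfolding p2 by (simp add: D_coef_def)
  next
    case False
    thus ?thesis unfolding p2
      using D_coef_eq[of k l m "nat (n + k - l)"] conn_factor_mu2[of k l m N] unfolding K_def[symmetric]
      by (simp add: mult.assoc[symmetric])
  qed
  have "n + k - int N = i" by (simp add: i_def iN(1))
  thus ?thesis
    unfolding iN inf_casoratian_def right_diff_distrib fls_minus_nth 1 2 by (simp only: minus_diff_minus)
qed

lemma conn_factor_Ct_Dt:
  assumes s: "k + l - m < 0" and n: "0 \<le> n"
  shows "conn_factor k l m 0 * (Ct_coef q k l m a b c n - Dt_coef q k l m a b c (n + k - l))
    = - (inf_casoratian k l m $$ (n + k))"
proof -
  interpret swap: hyp_params q b a c by (rule swapped)
  have N: "nat (k + l - m) = 0" using s by simp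
  have mu: "conn_factor k l m 0 * mu1 q k l m a b c = - inf_lead k l m"
    "conn_factor k l m 0 * mu2 q k l m a b c = - inf_lead' k l m"
    using conn_factor_mu1[of k l m 0] conn_factor_mu2[of k l m 0] by simp_all
  have 1: "conn_factor k l m 0 * Ct_coef q k l m a b c n
     = - ((inf_series k l m * fps_to_fls (phi21 (q / a) (c / a) (b * q / a) q)) $$ (n + k))"
    using Ct_coef_eq[of k l m "nat n"] mu(1) n unfolding inf_part_nth_neg
    by (simp add: mult.assoc[symmetric])
  have e: "m - l - k + 1 = m - k - l + 1" by simp
  have p2: "(inf_series' k l m * fps_to_fls (phi21 (q / b) (c / b) (a * q / b) q)) $$ (n + k)
    = (if n + k - l < 0 then 0 else inf_lead' k l m
      * (phi21 (q / b) (c / b) (a * q / b) q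
        * phi21 (b * q powi l) (b * q powi (l - m + 1) / c) (b * q powi (l - k + 1) / a)
          (c * q powi (m - k - l + 1) / (a * b))) $ nat (n + k - l))"
    unfolding swap.inf_part_nth_neg e mult.commute[of b a]
    by (simp add: mult.commute[of "phi21 (q / b) _ _ _"])
  have 2: "conn_factor k l m 0 * Dt_coef q k l m a b c (n + k - l)
     = - ((inf_series' k l m * fps_to_fls (phi21 (q / b) (c / b) (a * q / b) q)) $$ (n + k))"
  proof (cases "n + k - l < 0")
    case True
    thus ?thesis unfolding p2 by (simp add: Dt_coef_def)
  next
    case False
    thus ?thesis unfolding p2
      using Dt_coef_eq[of k l m "nat (n + k - l)"] mu(2) by (simp add: mult.assoc[symmetric])
  qed
  show ?thesis
    unfolding inf_casoratian_def N pole_factor_0 right_diff_distrib fls_minus_nth 1 2 by simp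
qed

section \<open>The polynomial identity\<close>

text \<open>
  The four cases of the definition have one form: the bound on \<open>n\<close> is always
  \<open>max m 0 + max (k + l - m) 0 - k - 1\<close>, and the shift that makes both indices agree with
  exponents of the Casoratian is \<open>max m 0\<close>.
\<close>
lemma P_poly_eq:
  "P_poly q k l m a b c = (\<Sum>n = 0..max m 0 + max (k + l - m) 0 - k - 1.
     monom (- (zero_casoratian k l m $$ (n - max m 0))) (nat n))"
proof -
  have e: "m + (k + l - m) - k - 1 = l - 1" "m + 0 - k - 1 = m - k - 1"
    "0 + (k + l - m) - k - 1 = l - m - 1" "0 + 0 - k - 1 = - k - 1" by simp_all
  show ?thesis
  proof (cases "0 \<le> m"; cases "0 \<le> k + l - m")
    assume *: "0 \<le> m" "0 \<le> k + l - m"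
    hence **: "max m 0 = m" "max (k + l - m) 0 = k + l - m" by simp_all
    show ?thesis unfolding ** e using * by (simp add: P_poly_def zero_casoratian_nth_nonneg)
  next
    assume *: "0 \<le> m" "\<not> 0 \<le> k + l - m"
    hence **: "max m 0 = m" "max (k + l - m) 0 = 0" by simp_all
    show ?thesis unfolding ** e using * by (simp add: P_poly_def zero_casoratian_nth_neg)
  next
    assume *: "\<not> 0 \<le> m" "0 \<le> k + l - m"
    hence **: "max m 0 = 0" "max (k + l - m) 0 = k + l - m" by simp_all
    show ?thesis unfolding ** e using * by (simp add: P_poly_def zero_casoratian_nth_nonneg)
  next
    assume *: "\<not> 0 \<le> m" "\<not> 0 \<le> k + l - m"
    hence **: "max m 0 = 0" "max (k + l - m) 0 = 0" by simp_all
    show ?thesis unfolding ** e using * by (simp add: P_poly_def zero_casoratian_nth_neg)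
  qed
qed

definition Pt_term :: "int \<Rightarrow> int \<Rightarrow> int \<Rightarrow> int \<Rightarrow> complex" where
  "Pt_term k l m n = (if 0 \<le> k + l - m then C_coef q k l m a b c n - D_coef q k l m a b c (n + k - l)
     else Ct_coef q k l m a b c n - Dt_coef q k l m a b c (n + k - l))"

lemma Pt_poly_eq:
  defines "d \<equiv> \<lambda>k l m. max m 0 + max (k + l - m) 0 - k - 1"
  shows "Pt_poly q k l m a b c = (\<Sum>n = 0..d k l m. monom (Pt_term k l m n) (nat (d k l m - n)))"
proof -
  have e: "m + (k + l - m) - k - 1 = l - 1" "m + 0 - k - 1 = m - k - 1"
    "0 + (k + l - m) - k - 1 = l - m - 1" "0 + 0 - k - 1 = - k - 1" by simp_all
  show ?thesis
  proof (cases "0 \<le> m"; cases "0 \<le> k + l - m")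
    assume *: "0 \<le> m" "0 \<le> k + l - m"
    hence **: "max m 0 = m" "max (k + l - m) 0 = k + l - m" by simp_all
    show ?thesis unfolding d_def ** e using * by (simp add: Pt_poly_def Pt_term_def)
  next
    assume *: "0 \<le> m" "\<not> 0 \<le> k + l - m"
    hence **: "max m 0 = m" "max (k + l - m) 0 = 0" by simp_all
    show ?thesis unfolding d_def ** e using * by (simp add: Pt_poly_def Pt_term_def)
  next
    assume *: "\<not> 0 \<le> m" "0 \<le> k + l - m"
    hence **: "max m 0 = 0" "max (k + l - m) 0 = k + l - m" by simp_all
    show ?thesis unfolding d_def ** e using * by (simp add: Pt_poly_def Pt_term_def)
  next
    assume *: "\<not> 0 \<le> m" "\<not> 0 \<le> k + l - m"
    hence **: "max m 0 = 0" "max (k + l - m) 0 = 0" by simp_all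
    show ?thesis unfolding d_def ** e using * by (simp add: Pt_poly_def Pt_term_def)
  qed
qed

lemma conn_factor_Pt_term:
  assumes "0 \<le> n"
  shows "conn_factor k l m (max (k + l - m) 0) * Pt_term k l m n
    = - (inf_casoratian k l m $$ (n + k - max (k + l - m) 0))"
proof (cases "0 \<le> k + l - m")
  case True
  hence "max (k + l - m) 0 = k + l - m" by simp
  thus ?thesis using conn_factor_C_D[OF True assms] True by (simp only: Pt_term_def if_True)
next
  case False
  hence "max (k + l - m) 0 = 0" by simp
  thus ?thesis using conn_factor_Ct_Dt[OF _ assms, of k l m] False by (simp add: Pt_term_def)
qed

lemma P_poly_eq_smult:
  "P_poly q k l m a b c
    = smult ((q - c) / (b - a) * conn_factor k l m (max (k + l - m) 0)) (Pt_poly q k l m a b c)"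
proof -
  define M where "M = max (k + l - m) 0"
  define d where "d = max m 0 + M - k - 1"
  have "smult ((q - c) / (b - a) * conn_factor k l m M) (Pt_poly q k l m a b c)
      = (\<Sum>n = 0..d. monom ((q - c) / (b - a) * (conn_factor k l m M * Pt_term k l m n)) (nat (d - n)))"
    unfolding Pt_poly_eq M_def[symmetric] d_def[symmetric]
    by (intro poly_eqI) (auto simp: coeff_sum sum_distrib_left intro!: sum.cong)
  also have "\<dots> = (\<Sum>n = 0..d. monom (- (zero_casoratian k l m $$ (d - n - max m 0))) (nat (d - n)))"
  proof (intro sum.cong refl)
    fix n assume "n \<in> {0..d}"
    hence "0 \<le> n" by simp
    have idx: "- (d - n - max m 0 + 1) = n + k - M" by (simp add: d_def)
    from \<open>0 \<le> n\<close> have "conn_factor k l m M * Pt_term k l m n = - (inf_casoratian k l m $$ (n + k - M))"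
      unfolding M_def by (rule conn_factor_Pt_term)
    hence "(q - c) / (b - a) * (conn_factor k l m M * Pt_term k l m n)
        = - (zero_casoratian k l m $$ (d - n - max m 0))"
      using main_identity[of k l m "d - n - max m 0"] unfolding idx by simp
    thus "monom ((q - c) / (b - a) * (conn_factor k l m M * Pt_term k l m n)) (nat (d - n))
        = monom (- (zero_casoratian k l m $$ (d - n - max m 0))) (nat (d - n))" by simp
  qed
  also have "\<dots> = (\<Sum>n = 0..d. monom (- (zero_casoratian k l m $$ (n - max m 0))) (nat n))"
    by (rule sum.reindex_bij_witness[of _ "\<lambda>n. d - n" "\<lambda>n. d - n"]) auto
  also have "\<dots> = P_poly q k l m a b c"
    unfolding P_poly_eq M_def[symmetric] d_def[symmetric] ..
  finally show ?thesis unfolding M_def ..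
qed

lemma Pt_term_0:
  assumes "k \<le> l"
  shows "Pt_term k l m 0 = mu1 q k l m a b c - (if k = l then mu2 q k l m a b c else 0)"
proof (cases "k = l")
  case True
  thus ?thesis
    using C_coef_eq[of k l m 0] D_coef_eq[of k l m 0] Ct_coef_eq[of k l m 0] Dt_coef_eq[of k l m 0]
    by (simp add: Pt_term_def)
next
  case False
  hence "D_coef q k l m a b c (0 + k - l) = 0" "Dt_coef q k l m a b c (0 + k - l) = 0"
    using assms by (simp_all add: D_coef_def Dt_coef_def)
  thus ?thesis
    using False C_coef_eq[of k l m 0] Ct_coef_eq[of k l m 0] by (simp add: Pt_term_def)
qed

lemma conn_factor_nonzero: "conn_factor k l m M \<noteq> 0"
  using qpoch_nonzero[OF a_qZ] qpoch_nonzero[OF b_qZ] qpoch_nonzero[OF c_qZ]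
  by (simp add: conn_factor_def)

end

lemma coeff_sum_monom_reversed:
  fixes f :: "int \<Rightarrow> 'a :: comm_monoid_add"
  assumes "0 \<le> d"
  shows "coeff (\<Sum>n = 0..d. monom (f n) (nat (d - n))) (nat d) = f 0"
proof -
  have "coeff (\<Sum>n = 0..d. monom (f n) (nat (d - n))) (nat d) = (\<Sum>n = 0..d. if n = 0 then f n else 0)"
    unfolding coeff_sum coeff_monom by (intro sum.cong) auto
  thus ?thesis using assms by simp
qed

lemma nonroot_base_of_norm:
  assumes "0 < norm q" "norm q < 1"
  shows "nonroot_base q"
proof
  show "q \<noteq> 0" using assms by auto
  fix n :: int assume n: "n \<noteq> 0"
  have *: "norm q ^ i \<noteq> 1" if "0 < i" for i
    using power_Suc_less_one[of "norm q" "i - 1"] assms that by simp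
  show "q powi n \<noteq> 1"
  proof
    assume "q powi n = 1"
    hence "norm q powi n = 1" by (metis norm_one norm_power_int)
    thus False using *[of "nat n"] *[of "nat (- n)"] n
      by (auto simp: power_int_def power_inverse split: if_splits)
  qed
qed

theorem corollary4:
  fixes q a b c :: complex and k l m :: int
  assumes "0 < norm q" and "norm q < 1"
    and "a \<noteq> 0" and "b \<noteq> 0" and "c \<noteq> 0"
    and "c \<notin> qZ q" and "a / b \<notin> qZ q"
    and "a \<notin> qZ q" and "b \<notin> qZ q" and "c / a \<notin> qZ q" and "c / b \<notin> qZ q"
    and "k \<le> l"
  shows
    "(let M = max (k + l - m) 0;
          lam = (- 1) powi (k + l - m - 1 + M)
            * q powi ((k * (k - 1) + l * (l - 1) - m * (m - 1) + M * (M - 1)) div 2)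
            * (((q - c) * a powi k * b powi l) / ((b - a) * c powi m))
            * (a * b / c) powi M
            * (qpoch q c m / (qpoch q a k * qpoch q b l));
          d = max m 0 + max (k + l - m) 0 - k - 1
      in P_poly q k l m a b c = smult lam (Pt_poly q k l m a b c)
       \<and> degree (P_poly q k l m a b c) = degree (Pt_poly q k l m a b c)
       \<and> (P_poly q k l m a b c = 0 \<longleftrightarrow> Pt_poly q k l m a b c = 0)
       \<and> degree_le (Pt_poly q k l m a b c) d
       \<and> int_coeff (Pt_poly q k l m a b c) d =
           (if k = l then
              (c / (a * b)) powi k * q powi (k * (m - k - l + 1))
              * (a powi (m - 2 * k) * qpoch q a k * qpoch q (a * q / c) (k - m)
                 - b powi (m - 2 * k) * qpoch q b k * qpoch q (b * q / c) (k - m))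
            else
              (c / (a * b)) powi k * q powi (k * (m - k - l + 1)) * a powi (m - k - l)
              * ((qpoch q a k * qpoch q (a * q / c) (k - m)) / qpoch q (a * q / b) (k - l))))"
proof -
  interpret nonroot_base q using assms(1,2) by (rule nonroot_base_of_norm)
  interpret hyp_params q a b c by unfold_locales (use assms in auto)
  define M where "M = max (k + l - m) 0"
  define lam where "lam = (- 1) powi (k + l - m - 1 + M)
            * q powi ((k * (k - 1) + l * (l - 1) - m * (m - 1) + M * (M - 1)) div 2)
            * (((q - c) * a powi k * b powi l) / ((b - a) * c powi m))
            * (a * b / c) powi M
            * (qpoch q c m / (qpoch q a k * qpoch q b l))"
  define d where "d = max m 0 + M - k - 1"
  define lc where "lc = (if k = l then
              (c / (a * b)) powi k * q powi (k * (m - k - l + 1))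
              * (a powi (m - 2 * k) * qpoch q a k * qpoch q (a * q / c) (k - m)
                 - b powi (m - 2 * k) * qpoch q b k * qpoch q (b * q / c) (k - m))
            else
              (c / (a * b)) powi k * q powi (k * (m - k - l + 1)) * a powi (m - k - l)
              * ((qpoch q a k * qpoch q (a * q / c) (k - m)) / qpoch q (a * q / b) (k - l)))"
  have lam: "lam = (q - c) / (b - a) * conn_factor k l m M"
    unfolding lam_def conn_factor_def by (simp add: divide_inverse mult_ac)
  have "b - a \<noteq> 0" using param_differ(1)[of 0 0] by simp
  moreover have "q - c \<noteq> 0"
    using c_qZ by (auto simp: qZ_def image_iff dest: spec[of _ 1])
  ultimately have lam0: "lam \<noteq> 0" using conn_factor_nonzero by (simp add: lam)
  have P: "P_poly q k l m a b c = smult lam (Pt_poly q k l m a b c)"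
    unfolding lam M_def by (rule P_poly_eq_smult)
  have Pt: "Pt_poly q k l m a b c = (\<Sum>n = 0..d. monom (Pt_term k l m n) (nat (d - n)))"
    unfolding Pt_poly_eq M_def d_def ..
  have "degree_le (Pt_poly q k l m a b c) d"
  proof (cases "d < 0")
    case False
    have "degree (Pt_poly q k l m a b c) \<le> nat d"
      unfolding Pt by (intro degree_sum_le) (auto intro: order.trans[OF degree_monom_le])
    thus ?thesis using False unfolding degree_le_def by linarith
  qed (simp add: Pt degree_le_def)
  moreover have "int_coeff (Pt_poly q k l m a b c) d = lc"
  proof (cases "d < 0")
    case True
    \<comment> \<open>The only case of an empty sum; then both terms of the claimed coefficient are \<open>1\<close>.\<close>
    hence "k = 0 \<and> l = 0 \<and> m = 0"
      using assms(12) by (auto simp: d_def M_def max_def split: if_splits)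
    thus ?thesis using True by (simp add: int_coeff_def lc_def)
  next
    case False
    hence "int_coeff (Pt_poly q k l m a b c) d = Pt_term k l m 0"
      unfolding int_coeff_def Pt by (simp add: coeff_sum_monom_reversed)
    also have "\<dots> = lc"
    proof (cases "k = l")
      case True
      have "m - l - l = m - 2 * l" by simp
      thus ?thesis
        unfolding Pt_term_0[OF assms(12)] lc_def mu1_def mu2_def
        by (simp add: True algebra_simps)
    next
      case False
      thus ?thesis
        unfolding Pt_term_0[OF assms(12)] lc_def mu1_def by (simp add: mult_ac)
    qed
    finally show ?thesis .
  qed
  ultimately show ?thesis
    unfolding Let_def M_def[symmetric] lam_def[symmetric] d_def[symmetric] lc_def[symmetric]
    using P lam0 by simp
qed

end
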